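(* Let $(\xi_i)_{i\in\mathbb{Z}}$ be i.i.d. centered random variables with finite second moment $\sigma^2=\mathbb{E}\xi_0^2$. Assume that for a certain $t>2$ and a slowly varying function $h$ one has $\mathbb{P}(\xi_0\ge x)=h(x)/x^t$ as $x\to\infty$ (i.e. for all sufficiently large $x$), and that $\mathbb{E}|\xi_0|^p<\infty$ for a certain $p>2$. Let $c_{ni}>0$ ($n\ge1$, $1\le i\le k_n$) be constants, $S_n=\sum_{i=1}^{k_n}c_{ni}\xi_i$, $\sigma_n^2=\mathrm{var}(S_n)=\sigma^2\sum_{i=1}^{k_n}c_{ni}^2$, and assume $\max_{1\le i\le k_n}c_{ni}^2/\sigma_n^2\to0$ as $n\to\infty$. Let $(x_n)_{n\ge1}$ be any sequence of reals such that for some $c>0$, $x_n\ge c$ for all $n$. Then, as $n\to\infty$, $$\mathbb{P}(S_n\ge x_n\sigma_n)=(1+o(1))\sum_{i=1}^{k_n}\mathbb{P}(c_{ni}\xi_0\ge x_n\sigma_n)+(1-\Phi(x_n))(1+o(1)).$$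
   Context: $\Phi$ is the standard normal distribution function. $k_n$ are positive integers. A (measurable, eventually positive) function $h$ is slowly varying if $\lim_{x\to\infty}h(\lambda x)/h(x)=1$ for all $\lambda>0$. Each $o(1)$ denotes a (possibly different) sequence, which may depend on $(x_n)$ and on the underlying distribution, converging to $0$ as $n\to\infty$. *)

theory Defs
  imports "HOL-Probability.Probability"
begin

(* A slowly varying function is usually given only on some half-line [a, \<infinity>); here it is a
   total function on the reals, whose values outside such a half-line are immaterial. *)
definition slowly_varying :: "(real \<Rightarrow> real) \<Rightarrow> bool" where
  "slowly_varying h \<longleftrightarrow>
     h \<in> borel_measurable borel \<and>
     (\<forall>\<^sub>F x in at_top. h x > 0) \<and>
     (\<forall>r>0. ((\<lambda>x. h (r * x) / h x) \<longlongrightarrow> 1) at_top)"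

definition iid :: "'a measure \<Rightarrow> ('i \<Rightarrow> 'a \<Rightarrow> real) \<Rightarrow> bool" where
  "iid M \<xi> \<longleftrightarrow>
     prob_space.indep_vars M (\<lambda>_. borel) \<xi> UNIV \<and>
     (\<forall>i j. distr M borel (\<xi> i) = distr M borel (\<xi> j))"

definition weighted_sum ::
    "(nat \<Rightarrow> nat \<Rightarrow> real) \<Rightarrow> (nat \<Rightarrow> nat) \<Rightarrow> (int \<Rightarrow> 'a \<Rightarrow> real) \<Rightarrow> nat \<Rightarrow> 'a \<Rightarrow> real" where
  "weighted_sum c k \<xi> n \<omega> = (\<Sum>i = 1..k n. c n i * \<xi> (int i) \<omega>)"

definition std_dev :: "'a measure \<Rightarrow> ('a \<Rightarrow> real) \<Rightarrow> real" where
  "std_dev M X = sqrt (prob_space.variance M X)"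

end

theory Submission
  imports Defs "HOL-Real_Asymp.Real_Asymp"
begin

text \<open>
  After division by \<open>\<sigma> n\<close> one has weights \<open>b i\<close> whose sum has variance 1 and whose maximum
  \<open>B\<close> tends to 0. Since the ratio of the two sides must tend to 1, it suffices to show
  \<open>P(S \<ge> x) = (1 + o(1)) (A(x) + 1 - \<Phi>(x))\<close>, with \<open>A(x) = \<Sum>i. P(b i \<xi> \<ge> x)\<close> and
  \<open>o(1)\<close> depending only on \<open>B\<close>. If a summand exceeds \<open>y = \<eta> x\<close>, Chebyshev's inequality for the remaining
  sum and regular variation give the contribution \<open>A(x)\<close>. Otherwise \<open>S\<close> equals the sum \<open>W\<close> of the
  summands truncated at \<open>y\<close>.

  If \<open>x\<^sup>2 \<ge> K ln (1/B)\<close>, a Fuk--Nagaev exponential bound makes \<open>P(W \<ge> x)\<close> smaller than any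
  prescribed power of \<open>B/x\<close>, while \<open>A(x)\<close> is at least of order \<open>(B/x)\<close> to the power \<open>t + 1\<close>.

  If \<open>x\<^sup>2 \<le> K ln (1/B)\<close>, then \<open>exp (x y)\<close> is at most a small negative power of \<open>B\<close>, and Lindeberg's
  replacement argument yields \<open>P(W \<ge> x) \<sim> 1 - \<Phi>(x)\<close> with relative precision, without a change of
  measure: a smoothed indicator \<open>f\<close> of \<open>[x, \<infinity>)\<close> vanishes to the left of \<open>x\<close>, so \<open>f\<close> and its derivatives at \<open>v\<close>
  are bounded by a multiple of \<open>exp (x (v - x))\<close>, and the total replacement error acquires
  the factor \<open>exp (- x\<^sup>2) E exp (x W) \<approx> exp (- x\<^sup>2 / 2)\<close>.
\<close>

text \<open>The precision must be relative to probabilities as small as exp(-x^2/2), yet the law has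
  only p > 2 moments: exponential moments are available only after truncation from above, at the
  cost of a factor exp(x y). This forces the two regimes. In the moderate one y = \<eta> x with
  \<eta> proportional to 1/K keeps exp(x y) below B^(-(p-2)/4), against a Lyapunov sum of order
  B^(p-2). In the large one the sharp Gaussian constant is given up for a bound by (B/x)^(t+2); the
  spare factor B/x over the lower bound (B/x)^(t+1) for A(x) makes this negligible. K comes from the
  large regime; the moderate one then adapts its own \<eta> to that K.

  For bounded x Chebyshev's bound 1/(e x)^2 for the remaining sum is not small. There A(x) itself is
  small against the normal tail, because A(x) tends to 0 with B.

  The estimates hold eventually as B tends to 0 from the right, uniformly in index set, weights and
  x, so no relation between x_n and the weights is needed when they are evaluated along n.\<close>

section \<open>Taylor bounds and smooth test functions with exponential weight\<close>

text \<open>One constant serves \<open>f\<close> and its three derivatives, and the weight is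
  multiplicative under translation: \<open>v\<close> mapped to \<open>f (w + v)\<close> is again of
  this class, with \<open>A * exp (s * w)\<close> for \<open>A\<close>. Hence the factor
  \<open>exp (s * w)\<close> in the error bounds below.\<close>

definition C3_exp_bounded ::
    "real \<Rightarrow> real \<Rightarrow> (real \<Rightarrow> real) \<Rightarrow> (real \<Rightarrow> real) \<Rightarrow> (real \<Rightarrow> real) \<Rightarrow> (real \<Rightarrow> real) \<Rightarrow> bool" where
  "C3_exp_bounded A s f f1 f2 f3 \<longleftrightarrow>
     (\<forall>v. (f has_real_derivative f1 v) (at v)) \<and>
     (\<forall>v. (f1 has_real_derivative f2 v) (at v)) \<and>
     (\<forall>v. (f2 has_real_derivative f3 v) (at v)) \<and>
     (\<forall>v. \<bar>f v\<bar> \<le> A * exp (s * v)) \<and> (\<forall>v. \<bar>f1 v\<bar> \<le> A * exp (s * v)) \<and>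
     (\<forall>v. \<bar>f2 v\<bar> \<le> A * exp (s * v)) \<and> (\<forall>v. \<bar>f3 v\<bar> \<le> A * exp (s * v))"

lemma C3_exp_bounded_nonneg:
  assumes "C3_exp_bounded A s f f1 f2 f3"
  shows "A \<ge> 0"
proof -
  have "0 \<le> A * exp (s * 0)" using assms unfolding C3_exp_bounded_def
    by (meson abs_ge_zero order_trans)
  then show ?thesis by simp
qed

lemma powr_le_cube_near_zero:
  fixes u p :: real
  assumes "\<bar>u\<bar> \<le> 1" "2 < p" "p \<le> 3"
  shows "\<bar>u\<bar> ^ 3 \<le> \<bar>u\<bar> powr p"
proof (cases "u = 0")
  case False
  have "\<bar>u\<bar> ^ 3 = \<bar>u\<bar> powr 3" using False by (simp add: powr_numeral)
  also have "\<dots> \<le> \<bar>u\<bar> powr p" using assms False by (intro powr_mono') auto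
  finally show ?thesis .
qed simp

lemma square_le_powr:
  fixes u p :: real
  assumes "\<bar>u\<bar> \<ge> 1" "2 < p"
  shows "u\<^sup>2 \<le> \<bar>u\<bar> powr p"
proof -
  have "u\<^sup>2 = \<bar>u\<bar> powr 2" using assms by (simp add: powr_numeral)
  also have "\<dots> \<le> \<bar>u\<bar> powr p" using assms by (intro powr_mono) auto
  finally show ?thesis .
qed

text \<open>For |u| at most 1 this is the cubic Taylor remainder, as then |u|^3 is at most |u|^p.
  For |u| > 1 no cancellation is used: 1, |u| and u^2 are all below |u|^p, and the four terms are
  bounded one by one, which the factor 4 accommodates. The factor \<open>1 + exp (s * u)\<close>
  covers the weights at both ends \<open>w\<close> and \<open>w + u\<close>.\<close>

lemma Taylor2_exp_bound:
  assumes f: "C3_exp_bounded A s f f1 f2 f3" and "s \<ge> 0" and p: "2 < p" "p \<le> 3"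
  shows "\<bar>f (w + u) - f w - f1 w * u - f2 w * u\<^sup>2 / 2\<bar>
           \<le> 4 * A * exp (s * w) * (1 + exp (s * u)) * \<bar>u\<bar> powr p"
proof -
  let ?e = "exp (s * w)" and ?d = "exp (s * u)" and ?P = "\<bar>u\<bar> powr p"
  note A = C3_exp_bounded_nonneg[OF f]
  have b0: "\<bar>f v\<bar> \<le> A * exp (s * v)" and b1: "\<bar>f1 v\<bar> \<le> A * exp (s * v)"
    and b2: "\<bar>f2 v\<bar> \<le> A * exp (s * v)" and b3: "\<bar>f3 v\<bar> \<le> A * exp (s * v)" for v
    using f unfolding C3_exp_bounded_def by blast+
  consider "u = 0" | "u \<noteq> 0" "\<bar>u\<bar> \<le> 1" | "\<bar>u\<bar> > 1" by linarith
  then show ?thesis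
  proof cases
    case 1
    then show ?thesis by simp
  next
    case 2
    define D where "D = (\<lambda>m::nat. if m = 0 then f else if m = 1 then f1 else if m = 2 then f2 else f3)"
    have der: "\<forall>m t. m < 3 \<and> min w (w+u) \<le> t \<and> t \<le> max w (w+u) \<longrightarrow> DERIV (D m) t :> D (Suc m) t"
    proof (intro allI impI)
      fix m :: nat and t assume "m < 3 \<and> min w (w+u) \<le> t \<and> t \<le> max w (w+u)"
      then have "m = 0 \<or> m = 1 \<or> m = 2" by auto
      then show "DERIV (D m) t :> D (Suc m) t"
        using f by (auto simp: D_def C3_exp_bounded_def)
    qed
    have "\<exists>r. (if w + u < w then w + u < r \<and> r < w else w < r \<and> r < w + u) \<and>
        f (w + u) = (\<Sum>m<3. D m w / fact m * (w + u - w) ^ m) + D 3 r / fact 3 * (w + u - w) ^ 3"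
      by (rule Taylor[OF _ _ der]) (use 2 in \<open>auto simp: D_def\<close>)
    then obtain r where r: "if w + u < w then w + u < r \<and> r < w else w < r \<and> r < w + u"
      and eq: "f (w + u) = (\<Sum>m<3. D m w / fact m * (w + u - w) ^ m) + D 3 r / fact 3 * (w + u - w) ^ 3"
      by blast
    have "f (w + u) - f w - f1 w * u - f2 w * u\<^sup>2 / 2 = f3 r / 6 * u ^ 3"
      unfolding eq by (simp add: D_def eval_nat_numeral)
    moreover have "\<bar>f3 r\<bar> \<le> A * (?e * (1 + ?d))"
    proof -
      have "s * r \<le> s * w \<or> s * r \<le> s * (w + u)"
        using r \<open>s \<ge> 0\<close> by (metis less_imp_le mult_left_mono)
      then have "exp (s * r) \<le> ?e \<or> exp (s * r) \<le> ?e * ?d"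
        by (simp add: distrib_left flip: exp_add)
      then have "exp (s * r) \<le> ?e * (1 + ?d)"
        using mult_pos_pos[OF exp_gt_zero exp_gt_zero, of "s * w" "s * u"] exp_gt_zero[of "s * w"]
        unfolding distrib_left mult_1_right by argo
      then show ?thesis using b3[of r] A by (meson mult_left_mono order_trans)
    qed
    moreover have "\<bar>u\<bar> ^ 3 \<le> ?P" by (rule powr_le_cube_near_zero) (use 2 p in auto)
    moreover have "0 \<le> A * (?e * (1 + ?d))" using A by (simp add: add_nonneg_nonneg)
    ultimately have "\<bar>f3 r\<bar> * \<bar>u\<bar> ^ 3 \<le> (A * (?e * (1 + ?d))) * ?P"
      by (intro mult_mono) auto
    then have "\<bar>f (w + u) - f w - f1 w * u - f2 w * u\<^sup>2 / 2\<bar> \<le> (A * (?e * (1 + ?d)) / 6) * ?P"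
      using \<open>f (w + u) - f w - f1 w * u - f2 w * u\<^sup>2 / 2 = f3 r / 6 * u ^ 3\<close>
      by (simp only: abs_mult abs_divide power_abs) simp
    also have "\<dots> \<le> (4 * A * ?e * (1 + ?d)) * ?P"
      by (intro mult_right_mono) (use A in \<open>auto simp: field_simps\<close>)
    finally show ?thesis .
  next
    case 3
    have P2: "u\<^sup>2 \<le> ?P" using 3 p by (intro square_le_powr) auto
    have Pu: "\<bar>u\<bar> \<le> ?P" using 3 P2 self_le_power[of "\<bar>u\<bar>" 2] by auto
    have P1: "1 \<le> ?P" using Pu 3 by linarith
    have "\<bar>f (w + u)\<bar> \<le> A * ?e * ?d * ?P"
    proof -
      have "\<bar>f (w + u)\<bar> \<le> A * ?e * ?d * 1" using b0[of "w + u"] by (simp add: distrib_left exp_add mult.assoc)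
      also have "\<dots> \<le> A * ?e * ?d * ?P" using A P1 by (intro mult_left_mono) auto
      finally show ?thesis .
    qed
    moreover have "\<bar>f w\<bar> \<le> A * ?e * ?P"
    proof -
      have "\<bar>f w\<bar> \<le> A * ?e * 1" using b0[of w] by simp
      also have "\<dots> \<le> A * ?e * ?P" using A P1 by (intro mult_left_mono) auto
      finally show ?thesis .
    qed
    moreover have "\<bar>f1 w * u\<bar> \<le> A * ?e * ?P"
      unfolding abs_mult using b1[of w] A Pu by (intro mult_mono) auto
    moreover have "\<bar>f2 w * u\<^sup>2 / 2\<bar> \<le> A * ?e * ?P"
    proof -
      have "\<bar>f2 w * u\<^sup>2 / 2\<bar> \<le> \<bar>f2 w\<bar> * u\<^sup>2" by (simp add: abs_mult)
      also have "\<dots> \<le> A * ?e * ?P" using b2[of w] A P2 by (intro mult_mono) auto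
      finally show ?thesis .
    qed
    moreover have "0 \<le> A * ?e * ?d * ?P" "0 \<le> A * ?e * ?P" using A by auto
    moreover have "4 * A * exp (s * w) * (1 + exp (s * u)) * \<bar>u\<bar> powr p = 4 * (A * ?e * ?d * ?P) + 4 * (A * ?e * ?P)"
      by (simp add: algebra_simps)
    ultimately show ?thesis by linarith
  qed
qed

text \<open>Treating the exponential as one more test function makes \<open>trunc_expansion\<close>
  deliver moment generating functions too. \<open>(1 + s) ^ 3\<close> dominates 1, s, s^2 and s^3 at
  once.\<close>

lemma C3_exp_bounded_exp:
  assumes "s \<ge> 0"
  shows "C3_exp_bounded ((1 + s) ^ 3) s (\<lambda>v. exp (s * v)) (\<lambda>v. s * exp (s * v))
           (\<lambda>v. s\<^sup>2 * exp (s * v)) (\<lambda>v. s ^ 3 * exp (s * v))"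
proof -
  have "1 \<le> (1 + s) ^ 3" using assms by (intro one_le_power) auto
  moreover have "(1 + s) ^ 3 = 1 + 3 * s + 3 * s\<^sup>2 + s ^ 3"
    by (simp add: power3_eq_cube power2_eq_square algebra_simps)
  then have "s \<le> (1 + s) ^ 3" "s\<^sup>2 \<le> (1 + s) ^ 3" "s ^ 3 \<le> (1 + s) ^ 3"
    using assms zero_le_power[OF assms, of 3] zero_le_power[OF assms, of 2] by linarith+
  moreover have d: "((\<lambda>v. a * exp (s * v)) has_real_derivative a * s * exp (s * v)) (at v)" for a v
    by (auto intro!: derivative_eq_intros)
  ultimately show ?thesis using assms d[of 1] d[of s] d[of "s\<^sup>2"] unfolding C3_exp_bounded_def
    by (simp add: power2_eq_square power3_eq_cube)
qed

text \<open>Away from 0 the function is locally a power or 0. At 0 the difference quotient is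
  bounded by \<open>\<bar>v\<bar> ^ k\<close>, which vanishes in the limit because
  \<open>k \<ge> 1\<close>.\<close>

lemma has_derivative_pos_part_power:
  fixes r :: real
  assumes "k \<ge> 1"
  shows "((\<lambda>r. (max 0 r) ^ Suc k) has_real_derivative real (Suc k) * (max 0 r) ^ k) (at r)"
proof -
  consider "r > 0" | "r < 0" | "r = 0" by linarith
  then show ?thesis
  proof cases
    case 1
    have "((\<lambda>r. r ^ Suc k) has_real_derivative real (Suc k) * (max 0 r) ^ k) (at r)"
      using 1 DERIV_pow[of "Suc k" r] by simp
    moreover have "\<forall>\<^sub>F v in nhds r. v ^ Suc k = (max 0 v) ^ Suc k"
      using eventually_nhds_in_open[of "{0<..}" r] 1 by (auto elim!: eventually_mono)
    ultimately show ?thesis by (subst (asm) DERIV_cong_ev) auto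
  next
    case 2
    have "((\<lambda>r. 0) has_real_derivative real (Suc k) * (max 0 r) ^ k) (at r)"
      using 2 assms by (auto intro!: derivative_eq_intros)
    moreover have "\<forall>\<^sub>F v in nhds r. 0 = (max 0 v) ^ Suc k"
      using eventually_nhds_in_open[of "{..<0}" r] 2 by (auto elim!: eventually_mono)
    ultimately show ?thesis by (subst (asm) DERIV_cong_ev) auto
  next
    case 3
    have "((\<lambda>v::real. (max 0 v) ^ Suc k / v) \<longlongrightarrow> 0) (at 0)"
    proof (rule Lim_null_comparison)
      show "\<forall>\<^sub>F v in at 0. norm ((max 0 v) ^ Suc k / v) \<le> \<bar>v\<bar> ^ k"
        by (intro always_eventually) (auto simp: max_def power_abs)
      have "((\<lambda>v::real. \<bar>v\<bar> ^ k) \<longlongrightarrow> \<bar>0\<bar> ^ k) (at 0)" by (intro tendsto_intros)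
      moreover have "\<bar>0::real\<bar> ^ k = 0" using assms by simp
      ultimately show "((\<lambda>v::real. \<bar>v\<bar> ^ k) \<longlongrightarrow> 0) (at 0)" by metis
    qed
    then show ?thesis using 3 assms by (simp add: has_field_derivative_iff zero_power del: power_Suc)
  qed
qed

lemma smooth_step_exists:
  obtains G G1 G2 G3 :: "real \<Rightarrow> real" and C :: real where
    "\<And>r. (G has_real_derivative G1 r) (at r)"
    "\<And>r. (G1 has_real_derivative G2 r) (at r)"
    "\<And>r. (G2 has_real_derivative G3 r) (at r)"
    "\<And>r. 0 \<le> G r" "\<And>r. G r \<le> 1" "\<And>r. r \<le> 0 \<Longrightarrow> G r = 0" "\<And>r. 1 \<le> r \<Longrightarrow> G r = 1"
    "C \<ge> 1"
    "\<And>r. \<bar>G r\<bar> \<le> C" "\<And>r. \<bar>G1 r\<bar> \<le> C" "\<And>r. \<bar>G2 r\<bar> \<le> C" "\<And>r. \<bar>G3 r\<bar> \<le> C"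
    "\<And>r. r \<le> 0 \<Longrightarrow> G1 r = 0" "\<And>r. r \<le> 0 \<Longrightarrow> G2 r = 0" "\<And>r. r \<le> 0 \<Longrightarrow> G3 r = 0"
proof -
  \<comment> \<open>The step will be the normalised primitive of the bump \<open>m r ^ 3\<close>.
    The cube makes the bump twice differentiable across 0 and 1, with derivatives \<open>B2\<close>
    and \<open>B3\<close>, so the step has three bounded derivatives.\<close>
  define m :: "real \<Rightarrow> real" where "m r = max 0 (r * (1 - r))" for r
  define B1 where "B1 r = m r ^ 3" for r
  define B2 where "B2 r = 3 * m r ^ 2 * (1 - 2 * r)" for r
  define B3 where "B3 r = 6 * m r * (1 - 2 * r)\<^sup>2 - 6 * m r ^ 2" for r
  have [continuous_intros]: "isCont B1 r" for r unfolding B1_def m_def by (intro continuous_intros)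
  obtain F where F: "(F has_real_derivative B1 r) (at r)" for r
    using einterval_antiderivative[of "- \<infinity>" "\<infinity>" B1]
    by (auto simp: has_real_derivative_iff_has_vector_derivative continuous_intros)
  have dm: "((\<lambda>r. m r ^ Suc k) has_real_derivative real (Suc k) * m r ^ k * (1 - 2 * r)) (at r)"
    if "k \<ge> 1" for k r
  proof -
    have "((\<lambda>r::real. r * (1 - r)) has_real_derivative 1 - 2 * r) (at r)"
      by (auto intro!: derivative_eq_intros)
    from DERIV_chain2[OF has_derivative_pos_part_power[OF that] this]
    show ?thesis unfolding m_def .
  qed
  have d1: "(B1 has_real_derivative B2 r) (at r)" for r
    using dm[of 2 r] by (simp add: B1_def[abs_def] B2_def numeral_3_eq_3)
  have d2: "(B2 has_real_derivative B3 r) (at r)" for r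
    unfolding B2_def[abs_def]
  proof (rule DERIV_cong)
    have "((\<lambda>r::real. 1 - 2 * r) has_real_derivative - 2) (at r)" by (auto intro!: derivative_eq_intros)
    from DERIV_mult[OF DERIV_cmult[OF dm[of 1 r], of 3] this]
    show "((\<lambda>r. 3 * (m r)\<^sup>2 * (1 - 2 * r)) has_real_derivative
        3 * (real (Suc 1) * m r ^ 1 * (1 - 2 * r)) * (1 - 2 * r) + - 2 * (3 * m r ^ Suc 1)) (at r)"
      by (simp add: numeral_2_eq_2)
  qed (simp add: B3_def power2_eq_square algebra_simps)
  have m0: "m r = 0" if "r \<le> 0 \<or> 1 \<le> r" for r
    using that unfolding m_def by (auto simp: max_def mult_le_0_iff zero_le_mult_iff)
  have m_bd: "0 \<le> m r" "m r \<le> 1" for r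
  proof -
    have "r * (1 - r) \<le> 1" using sum_squares_ge_zero[of "r - 1/2" 0] by (simp add: algebra_simps power2_eq_square)
    then show "0 \<le> m r" "m r \<le> 1" unfolding m_def by auto
  qed
  have cases_r: "(m r = 0) \<or> \<bar>1 - 2 * r\<bar> \<le> 1" for r
    using m0[of r] by (cases "r \<le> 0 \<or> 1 \<le> r") auto
  have bB1: "\<bar>B1 r\<bar> \<le> 1" for r unfolding B1_def using m_bd[of r] by (simp add: power_le_one)
  have bB2: "\<bar>B2 r\<bar> \<le> 3" for r
    using cases_r[of r]
  proof
    assume *: "\<bar>1 - 2 * r\<bar> \<le> 1"
    have "m r ^ 2 * \<bar>1 - 2 * r\<bar> \<le> 1 * 1"
      using m_bd[of r] * by (intro mult_mono) (auto simp: power_le_one)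
    then show ?thesis unfolding B2_def by (simp add: abs_mult)
  qed (simp add: B2_def)
  have bB3: "\<bar>B3 r\<bar> \<le> 12" for r
    using cases_r[of r]
  proof
    assume *: "\<bar>1 - 2 * r\<bar> \<le> 1"
    have "m r * (1 - 2 * r)\<^sup>2 \<le> 1 * 1"
      using m_bd[of r] * by (intro mult_mono) (auto simp: abs_square_le_1)
    moreover have "0 \<le> m r * (1 - 2 * r)\<^sup>2" "0 \<le> m r ^ 2" "m r ^ 2 \<le> 1"
      using m_bd[of r] by (auto simp: power_le_one)
    ultimately show ?thesis unfolding B3_def abs_le_iff mult.assoc by linarith
  qed (simp add: B3_def)
  have mono: "F r \<le> F r'" if "r \<le> r'" for r r'
    by (rule DERIV_nonneg_imp_nondecreasing[OF that]) (use F m_bd in \<open>auto simp: B1_def intro!: exI\<close>)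
  have cl: "F r = F 0" if "r \<le> 0" for r
  proof (cases "r = 0")
    case False
    have "F 0 = F r"
    proof (rule DERIV_isconst2[of r 0 F 0])
      show "continuous_on {r..0} F" using F by (meson DERIV_isCont continuous_at_imp_continuous_on)
      show "DERIV F v :> 0" if "r < v" "v < 0" for v using F[of v] m0[of v] that by (simp add: B1_def)
    qed (use False that in auto)
    then show ?thesis ..
  qed simp
  have cr: "F r = F 1" if "1 \<le> r" for r
  proof (cases "r = 1")
    case False
    show ?thesis
    proof (rule DERIV_isconst2[of 1 r F r])
      show "continuous_on {1..r} F" using F by (meson DERIV_isCont continuous_at_imp_continuous_on)
      show "DERIV F v :> 0" if "1 < v" "v < r" for v using F[of v] m0[of v] that by (simp add: B1_def)
    qed (use False that in auto)
  qed simp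
  have lt: "F 0 < F 1"
  proof (rule DERIV_pos_imp_increasing_open[of 0 1 F])
    show "\<exists>y. DERIV F v :> y \<and> 0 < y" if "0 < v" "v < 1" for v
      using F[of v] that by (intro exI[of _ "B1 v"]) (auto simp: B1_def m_def)
    show "continuous_on {0..1} F" using F by (meson DERIV_isCont continuous_at_imp_continuous_on)
  qed simp
  \<comment> \<open>\<open>J\<close> is the total mass of the bump, the normalising constant. The 12
    in \<open>C\<close> is the largest of the bounds 1, 3, 12 for \<open>B1\<close>,
    \<open>B2\<close>, \<open>B3\<close>.\<close>
  define J where "J = F 1 - F 0"
  have J: "J > 0" using lt by (simp add: J_def)
  define C where "C = max 1 (12 / J)"
  have CJ: "y / J \<le> C" if "y \<le> 12" for y
    unfolding C_def using divide_right_mono[OF that, of J] J by simp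
  show thesis
  proof (rule that[of "\<lambda>r. (F r - F 0) / J" "\<lambda>r. B1 r / J" "\<lambda>r. B2 r / J" "\<lambda>r. B3 r / J" C])
    show "((\<lambda>r. (F r - F 0) / J) has_real_derivative B1 r / J) (at r)" for r
      using F[of r] J by (auto intro!: derivative_eq_intros)
    show "((\<lambda>r. B1 r / J) has_real_derivative B2 r / J) (at r)" for r
      using d1[of r] J by (auto intro!: derivative_eq_intros)
    show "((\<lambda>r. B2 r / J) has_real_derivative B3 r / J) (at r)" for r
      using d2[of r] J by (auto intro!: derivative_eq_intros)
    have "F 0 \<le> F r" for r using mono[of 0 r] cl[of r] by (cases "0 \<le> r") auto
    then show g0: "0 \<le> (F r - F 0) / J" for r using J by simp
    have "F r \<le> F 1" for r using mono[of r 1] cr[of r] by (cases "r \<le> 1") auto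
    then show g1: "(F r - F 0) / J \<le> 1" for r using J by (simp add: J_def)
    show "(F r - F 0) / J = 0" if "r \<le> 0" for r using cl[OF that] by simp
    show "(F r - F 0) / J = 1" if "1 \<le> r" for r using cr[OF that] J by (simp add: J_def)
    show "C \<ge> 1" unfolding C_def by simp
    show "\<bar>(F r - F 0) / J\<bar> \<le> C" for r using g0[of r] g1[of r] unfolding C_def by linarith
    show "\<bar>B1 r / J\<bar> \<le> C" "\<bar>B2 r / J\<bar> \<le> C" "\<bar>B3 r / J\<bar> \<le> C" for r
      using bB1[of r] bB2[of r] bB3[of r] J by (auto simp: abs_divide intro!: CJ)
    show "B1 r / J = 0" "B2 r / J = 0" "B3 r / J = 0" if "r \<le> 0" for r
      using m0[of r] that by (auto simp: B1_def B2_def B3_def)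
  qed
qed

text \<open>Vanishing to the left of z creates the weight: for v > z one has exp(s (v - z)) \<ge> 1,
  so a bounded function that is 0 up to z is dominated by its bound times exp(-s z) exp(s v).
  Rescaling the step to width \<delta> costs 1/\<delta> per derivative, hence the cube.
  \<open>C\<close> is fixed before z, \<delta> and s.\<close>

lemma smooth_indicator:
  obtains C :: real where "C \<ge> 1" and
    "\<And>z \<delta> s. 0 < \<delta> \<Longrightarrow> \<delta> \<le> 1 \<Longrightarrow> 0 \<le> s \<Longrightarrow> \<exists>f f1 f2 f3.
       C3_exp_bounded (C / \<delta> ^ 3 * exp (- (s * z))) s f f1 f2 f3 \<and>
       (\<forall>v. indicator {z + \<delta>..} v \<le> f v \<and> f v \<le> indicator {z..} v)"
proof (rule smooth_step_exists)
  fix G G1 G2 G3 :: "real \<Rightarrow> real" and C :: real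
  assume
    d: "\<And>r. (G has_real_derivative G1 r) (at r)"
    "\<And>r. (G1 has_real_derivative G2 r) (at r)"
    "\<And>r. (G2 has_real_derivative G3 r) (at r)"
    and G: "\<And>r. 0 \<le> G r" "\<And>r. G r \<le> 1" "\<And>r. r \<le> 0 \<Longrightarrow> G r = 0" "\<And>r. 1 \<le> r \<Longrightarrow> G r = 1"
    and C: "C \<ge> 1"
    and b: "\<And>r. \<bar>G r\<bar> \<le> C" "\<And>r. \<bar>G1 r\<bar> \<le> C" "\<And>r. \<bar>G2 r\<bar> \<le> C" "\<And>r. \<bar>G3 r\<bar> \<le> C"
    and z: "\<And>r. r \<le> 0 \<Longrightarrow> G1 r = 0" "\<And>r. r \<le> 0 \<Longrightarrow> G2 r = 0" "\<And>r. r \<le> 0 \<Longrightarrow> G3 r = 0"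
  show thesis
  proof (rule that[OF C])
    fix z \<delta> s :: real assume \<delta>: "0 < \<delta>" "\<delta> \<le> 1" and s: "0 \<le> s"
    have key: "\<bar>H ((v - z) / \<delta>) / \<delta> ^ k\<bar> \<le> C / \<delta> ^ 3 * exp (- (s * z)) * exp (s * v)"
      if H: "\<And>r. \<bar>H r\<bar> \<le> C" "\<And>r. r \<le> 0 \<Longrightarrow> H r = 0" and k: "k \<le> 3" for H v k
    proof (cases "v \<le> z")
      case True
      then have "(v - z) / \<delta> \<le> 0" using \<delta> by (simp add: divide_nonpos_pos)
      then show ?thesis using H(2) C \<delta> by simp
    next
      case False
      have "\<bar>H ((v - z) / \<delta>) / \<delta> ^ k\<bar> \<le> C / \<delta> ^ 3"
        using H(1)[of "(v - z) / \<delta>"] \<delta> k C unfolding abs_divide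
        by (intro frac_le) (auto simp: power_decreasing)
      also have "\<dots> = C / \<delta> ^ 3 * 1" by simp
      also have "\<dots> \<le> C / \<delta> ^ 3 * exp (s * (v - z))"
        using False s C \<delta> by (intro mult_left_mono) auto
      also have "\<dots> = C / \<delta> ^ 3 * exp (- (s * z)) * exp (s * v)"
        by (simp add: right_diff_distrib exp_diff exp_minus field_simps)
      finally show ?thesis .
    qed
    have dz: "((\<lambda>v. (v - z) / \<delta>) has_real_derivative 1 / \<delta>) (at v)" for v
      using \<delta> by (auto intro!: derivative_eq_intros)
    have "C3_exp_bounded (C / \<delta> ^ 3 * exp (- (s * z))) s (\<lambda>v. G ((v - z) / \<delta>))
      (\<lambda>v. G1 ((v - z) / \<delta>) / \<delta> ^ 1) (\<lambda>v. G2 ((v - z) / \<delta>) / \<delta> ^ 2) (\<lambda>v. G3 ((v - z) / \<delta>) / \<delta> ^ 3)"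
      unfolding C3_exp_bounded_def
    proof (intro conjI allI)
      fix v
      show "((\<lambda>v. G ((v - z) / \<delta>)) has_real_derivative G1 ((v - z) / \<delta>) / \<delta> ^ 1) (at v)"
        using DERIV_chain2[OF d(1) dz] by simp
      show "((\<lambda>v. G1 ((v - z) / \<delta>) / \<delta> ^ 1) has_real_derivative G2 ((v - z) / \<delta>) / \<delta> ^ 2) (at v)"
        using DERIV_cdivide[OF DERIV_chain2[OF d(2) dz], of \<delta>] \<delta> by (simp add: power2_eq_square)
      show "((\<lambda>v. G2 ((v - z) / \<delta>) / \<delta> ^ 2) has_real_derivative G3 ((v - z) / \<delta>) / \<delta> ^ 3) (at v)"
        using DERIV_cdivide[OF DERIV_chain2[OF d(3) dz], of "\<delta> ^ 2"] \<delta> by (simp add: power2_eq_square power3_eq_cube mult.assoc)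
      show "\<bar>G ((v - z) / \<delta>)\<bar> \<le> C / \<delta> ^ 3 * exp (- (s * z)) * exp (s * v)"
        using key[of G 0 v] b(1) G(3) by simp
    qed (rule key; use b z in simp)+
    moreover have "indicator {z + \<delta>..} v \<le> G ((v - z) / \<delta>) \<and> G ((v - z) / \<delta>) \<le> indicator {z..} v" for v
      using G(1,2)[of "(v - z) / \<delta>"] G(3)[of "(v - z) / \<delta>"] G(4)[of "(v - z) / \<delta>"] \<delta>
      by (auto simp: indicator_def field_simps)
    ultimately show "\<exists>f f1 f2 f3. C3_exp_bounded (C / \<delta> ^ 3 * exp (- (s * z))) s f f1 f2 f3 \<and>
       (\<forall>v. indicator {z + \<delta>..} v \<le> f v \<and> f v \<le> indicator {z..} v)" by blast
  qed
qed

section \<open>Lindeberg replacement with exponential weight\<close>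

text \<open>Both orders of integration are recorded: exchanging one summand integrates it innermost,
  while the induction hypothesis on the others is applied with that summand outermost.\<close>

lemma integral_convolution:
  fixes f :: "real \<Rightarrow> real"
  assumes "real_distribution P" "real_distribution Q"
    and f[measurable]: "f \<in> borel_measurable borel" and bd: "\<And>x. \<bar>f x\<bar> \<le> B"
  shows "(\<integral>x. f x \<partial>(P \<star> Q)) = (\<integral>x. \<integral>y. f (x + y) \<partial>Q \<partial>P)"
    and "(\<integral>x. f x \<partial>(P \<star> Q)) = (\<integral>y. \<integral>x. f (x + y) \<partial>P \<partial>Q)"
proof -
  interpret P: real_distribution P by fact
  interpret Q: real_distribution Q by fact
  interpret PQ: pair_prob_space P Q ..
  have [measurable_cong]: "sets P = sets borel" "sets Q = sets borel" by simp_all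
  have int: "integrable (P \<Otimes>\<^sub>M Q) (\<lambda>(x, y). f (x + y))"
    by (rule PQ.P.integrable_const_bound[where B = B]) (use bd in \<open>auto intro!: AE_I2\<close>)
  have "(\<integral>x. f x \<partial>(P \<star> Q)) = (\<integral>z. f (case z of (x, y) \<Rightarrow> x + y) \<partial>(P \<Otimes>\<^sub>M Q))"
    unfolding convolution_def by (subst integral_distr) auto
  also have "\<dots> = (\<integral>z. (case z of (x, y) \<Rightarrow> f (x + y)) \<partial>(P \<Otimes>\<^sub>M Q))"
    by (intro Bochner_Integration.integral_cong) auto
  finally have *: "(\<integral>x. f x \<partial>(P \<star> Q)) = (\<integral>z. (case z of (x, y) \<Rightarrow> f (x + y)) \<partial>(P \<Otimes>\<^sub>M Q))" .
  show "(\<integral>x. f x \<partial>(P \<star> Q)) = (\<integral>x. \<integral>y. f (x + y) \<partial>Q \<partial>P)"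
    unfolding * using PQ.integral_fst'[OF int] by simp
  show "(\<integral>x. f x \<partial>(P \<star> Q)) = (\<integral>y. \<integral>x. f (x + y) \<partial>P \<partial>Q)"
    unfolding * using PQ.integral_snd[OF int] by simp
qed

lemma abs_integral_le:
  fixes f g :: "'a \<Rightarrow> real"
  assumes "integrable M f" "integrable M g" "\<And>x. x \<in> space M \<Longrightarrow> \<bar>f x\<bar> \<le> g x"
  shows "\<bar>\<integral>x. f x \<partial>M\<bar> \<le> (\<integral>x. g x \<partial>M)"
proof -
  have "\<bar>\<integral>x. f x \<partial>M\<bar> \<le> (\<integral>x. \<bar>f x\<bar> \<partial>M)" by (rule integral_abs_bound)
  also have "\<dots> \<le> (\<integral>x. g x \<partial>M)" by (rule integral_mono) (use assms in auto)
  finally show ?thesis .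
qed

section \<open>Centered normal laws, their convolution and exponential moments\<close>

abbreviation gauss :: "real measure" where
  "gauss \<equiv> std_normal_distribution"

interpretation std_normal: real_distribution gauss
  by (rule real_dist_normal_dist)

text \<open>The parameter is the variance, so that convolution adds parameters. Defining the law as
  an image, not by a density, includes the point mass at v = 0, which the empty sum
  requires.\<close>

definition normal_law :: "real \<Rightarrow> real measure" where
  "normal_law v = distr gauss borel (\<lambda>z. sqrt v * z)"

lemma real_distribution_normal_law: "real_distribution (normal_law v)"
  unfolding normal_law_def by (rule std_normal.real_distribution_distr) simp

lemma integral_normal_law:
  assumes [measurable]: "f \<in> borel_measurable borel"
  shows "(\<integral>x. f x \<partial>normal_law v) = (\<integral>z. f (sqrt v * z) \<partial>gauss :: real)"
  unfolding normal_law_def by (subst integral_distr) auto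

lemma normal_law_density:
  assumes "v > 0"
  shows "normal_law v = density lborel (normal_density 0 (sqrt v))"
proof -
  have "distributed gauss lborel (\<lambda>x. x) std_normal_density"
    unfolding distributed_def by (auto simp: distr_id2 )
  then have "distributed gauss lborel (\<lambda>z. 0 + sqrt v * z) (normal_density (0 + sqrt v * 0) (\<bar>sqrt v\<bar> * 1))"
    by (rule std_normal.normal_density_affine) (use assms in auto)
  then have "distr gauss lborel (\<lambda>z. sqrt v * z) = density lborel (normal_density 0 (sqrt v))"
    using assms by (simp add: distributed_distr_eq_density)
  moreover have "normal_law v = distr gauss lborel (\<lambda>z. sqrt v * z)"
    unfolding normal_law_def by (rule distr_cong) auto
  ultimately show ?thesis by simp
qed

lemma convolution_normal_law:
  assumes "u > 0" "v > 0"
  shows "(normal_law u \<star> normal_law v) = normal_law (u + v)"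
proof -
  have fin: "finite_measure (density lborel (normal_density 0 (sqrt r)))" if "r > 0" for r
    using prob_space_normal_density[of "sqrt r" 0] that by (simp add: prob_space_def)
  have "(\<lambda>x. \<integral>\<^sup>+y. ennreal (normal_density 0 (sqrt u) (x - y)) * ennreal (normal_density 0 (sqrt v) y) \<partial>lborel)
      = normal_density 0 (sqrt ((sqrt u)\<^sup>2 + (sqrt v)\<^sup>2))"
    using assms by (subst conv_normal_density_zero_mean[symmetric])
      (auto simp: ennreal_mult'[symmetric] normal_density_nonneg)
  then show ?thesis using assms
    by (simp add: normal_law_density convolution_density fin)
qed

lemma integral_normal_law_add:
  fixes f :: "real \<Rightarrow> real"
  assumes "u > 0" "v \<ge> 0" and f[measurable]: "f \<in> borel_measurable borel" and bd: "\<And>x. \<bar>f x\<bar> \<le> B"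
  shows "(\<integral>x. f x \<partial>normal_law (u + v)) = (\<integral>x. \<integral>y. f (x + y) \<partial>normal_law v \<partial>normal_law u)"
proof (cases "v = 0")
  case True
  then show ?thesis by (simp add: integral_normal_law std_normal.prob_space[simplified])
next
  case False
  then show ?thesis using assms
    by (simp add: integral_convolution(1)[OF real_distribution_normal_law real_distribution_normal_law f bd]
        flip: convolution_normal_law)
qed

lemma has_bochner_integral_std_normal_exp:
  "has_bochner_integral gauss (\<lambda>z. exp (s * z)) (exp (s\<^sup>2 / 2))"
proof (rule has_bochner_integral_density)
  \<comment> \<open>Completing the square: tilting the standard normal density by exp(s z) moves its
    mean to s and releases exp(s^2/2).\<close>
  have eq: "std_normal_density z *\<^sub>R exp (s * z) = exp (s\<^sup>2 / 2) * normal_density s 1 z" for z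
    by (simp add: normal_density_def mult_exp_exp) (simp add: power2_eq_square field_simps)
  have "has_bochner_integral lborel (\<lambda>z. exp (s\<^sup>2 / 2) * normal_density s 1 z) (exp (s\<^sup>2 / 2) * 1)"
    by (intro has_bochner_integral_mult_right)
      (simp add: has_bochner_integral_iff integrable_normal_density)
  then show "has_bochner_integral lborel (\<lambda>z. std_normal_density z *\<^sub>R exp (s * z)) (exp (s\<^sup>2 / 2))"
    by (simp add: eq[simplified])
qed (auto simp: normal_density_nonneg)

lemma integrable_std_normal_exp: "integrable gauss (\<lambda>z. exp (s * z))"
  and integral_std_normal_exp: "(\<integral>z. exp (s * z) \<partial>gauss) = exp (s\<^sup>2 / 2)"
  using has_bochner_integral_std_normal_exp[of s] by (simp_all add: has_bochner_integral_iff)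

lemma (in prob_space) exp_sum_indep:
  fixes Y :: "'i \<Rightarrow> 'a \<Rightarrow> real"
  assumes "finite I" "indep_vars (\<lambda>_. borel) Y I" and int: "\<And>i. i \<in> I \<Longrightarrow> integrable M (\<lambda>\<omega>. exp (s * Y i \<omega>))"
  shows "integrable M (\<lambda>\<omega>. exp (s * (\<Sum>i\<in>I. Y i \<omega>)))"
    and "expectation (\<lambda>\<omega>. exp (s * (\<Sum>i\<in>I. Y i \<omega>))) = (\<Prod>i\<in>I. expectation (\<lambda>\<omega>. exp (s * Y i \<omega>)))"
proof -
  have ind: "indep_vars (\<lambda>_. borel) (\<lambda>i \<omega>. exp (s * Y i \<omega>)) I"
    by (rule indep_vars_compose2[OF assms(2)]) auto
  have eq: "exp (s * (\<Sum>i\<in>I. Y i \<omega>)) = (\<Prod>i\<in>I. exp (s * Y i \<omega>))" for \<omega>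
    using \<open>finite I\<close> by (simp add: sum_distrib_left exp_sum)
  show "integrable M (\<lambda>\<omega>. exp (s * (\<Sum>i\<in>I. Y i \<omega>)))"
    unfolding eq by (rule indep_vars_integrable[OF assms(1) ind int])
  show "expectation (\<lambda>\<omega>. exp (s * (\<Sum>i\<in>I. Y i \<omega>))) = (\<Prod>i\<in>I. expectation (\<lambda>\<omega>. exp (s * Y i \<omega>)))"
    unfolding eq by (rule indep_vars_lebesgue_integral[OF assms(1) ind int])
qed

text \<open>The hypothesis on single summands is invariant under translation of \<open>f\<close>, which only
  rescales the weight \<open>exp (s * w)\<close>; this is what makes the induction over \<open>I\<close> go through.\<close>

lemma (in prob_space) lindeberg_swap:
  fixes Y :: "'i \<Rightarrow> 'a \<Rightarrow> real" and f :: "real \<Rightarrow> real"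
  assumes "finite I" and "indep_vars (\<lambda>_. borel) Y I"
    and f[measurable]: "f \<in> borel_measurable borel" and bd: "\<And>x. \<bar>f x\<bar> \<le> B"
    and "\<And>i. i \<in> I \<Longrightarrow> v i > 0" and "\<And>i. i \<in> I \<Longrightarrow> e i \<ge> 0"
    and "\<And>i w. i \<in> I \<Longrightarrow> \<bar>expectation (\<lambda>\<omega>. f (w + Y i \<omega>)) - (\<integral>y. f (w + y) \<partial>normal_law (v i))\<bar> \<le> e i * exp (s * w)"
    and "\<And>i. i \<in> I \<Longrightarrow> integrable M (\<lambda>\<omega>. exp (s * Y i \<omega>))"
    and "\<And>i. i \<in> I \<Longrightarrow> expectation (\<lambda>\<omega>. exp (s * Y i \<omega>)) \<le> m i"
    and "\<And>i. i \<in> I \<Longrightarrow> exp (s\<^sup>2 * v i / 2) \<le> m i"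
  shows "\<bar>expectation (\<lambda>\<omega>. f (w + (\<Sum>i\<in>I. Y i \<omega>))) - (\<integral>y. f (w + y) \<partial>normal_law (\<Sum>i\<in>I. v i))\<bar>
           \<le> exp (s * w) * (\<Sum>i\<in>I. e i) * (\<Prod>i\<in>I. m i)"
  using assms(1,2,5-)
proof (induction I arbitrary: w rule: finite_induct)
  case empty
  then show ?case by (simp add: integral_normal_law std_normal.prob_space[simplified] prob_space)
next
  case (insert j I)
  define S where "S = (\<lambda>\<omega>. \<Sum>i\<in>I. Y i \<omega>)"
  define V where "V = (\<Sum>i\<in>I. v i)"
  define \<mu> where "\<mu> = distr M borel (Y j)"
  define P where "P = distr M borel S"
  have rv: "random_variable borel (Y i)" if "i \<in> insert j I" for i
    using insert.prems(1) that unfolding indep_vars_def by auto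
  have rvY[measurable]: "random_variable borel (Y j)" and rvS[measurable]: "random_variable borel S"
    unfolding S_def by (auto intro!: borel_measurable_sum rv)
  have \<mu>: "real_distribution \<mu>" and P: "real_distribution P"
    unfolding \<mu>_def P_def by (auto intro!: real_distribution_distr)
  interpret \<mu>: real_distribution \<mu> by fact
  interpret P: real_distribution P by fact
  interpret \<nu>: real_distribution "normal_law r" for r by (rule real_distribution_normal_law)
  have V: "V \<ge> 0" unfolding V_def using insert.prems(2) by (intro sum_nonneg) (auto intro: less_imp_le)
  have vj: "v j > 0" using insert.prems(2) by simp
  have indI: "indep_vars (\<lambda>_. borel) Y I"
    by (rule indep_vars_subset[OF insert.prems(1)]) auto
  have law: "distr M borel (\<lambda>\<omega>. Y j \<omega> + S \<omega>) = (\<mu> \<star> P)"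
    unfolding \<mu>_def P_def
  proof (rule sum_indep_random_variable)
    show "indep_var borel (Y j) borel S"
      unfolding S_def by (rule indep_vars_sum[OF insert.hyps insert.prems(1)])
  qed (fact rvY rvS)+
  have mI: "0 \<le> m i" if "i \<in> insert j I" for i
    by (rule order_trans[OF exp_ge_zero insert.prems(7)[OF that]])
  have intbd: "integrable N g" if "prob_space N" "g \<in> borel_measurable N" "\<And>x. \<bar>g x\<bar> \<le> B'"
    for N :: "real measure" and g :: "real \<Rightarrow> real" and B'
  proof -
    interpret N: prob_space N by fact
    show ?thesis by (rule N.integrable_const_bound[where B = B']) (use that in auto)
  qed
  have B0: "B \<ge> 0" using bd[of 0] by linarith
  \<comment> \<open>A non-integrable \<open>g\<close> has Bochner integral 0 by convention;
    \<open>B0\<close> covers this default.\<close>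
  have bound_int: "\<bar>\<integral>x. g x \<partial>N\<bar> \<le> B" if "prob_space N" "\<And>x. \<bar>g x\<bar> \<le> B" for N :: "real measure" and g
  proof -
    interpret N: prob_space N by fact
    show ?thesis
    proof (cases "integrable N g")
      case True
      have "\<bar>\<integral>x. g x \<partial>N\<bar> \<le> (\<integral>x. B \<partial>N)" by (rule abs_integral_le) (use True that in auto)
      then show ?thesis by (simp add: N.prob_space)
    qed (simp add: not_integrable_integral_eq B0)
  qed
  have e_mgf: "expectation (\<lambda>\<omega>. exp (s * S \<omega>)) \<le> (\<Prod>i\<in>I. m i)" and int_mgf: "integrable M (\<lambda>\<omega>. exp (s * S \<omega>))"
  proof -
    show "integrable M (\<lambda>\<omega>. exp (s * S \<omega>))" unfolding S_def
      by (rule exp_sum_indep(1)[OF insert.hyps(1) indI]) (use insert.prems(5) in auto)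
    have "expectation (\<lambda>\<omega>. exp (s * S \<omega>)) = (\<Prod>i\<in>I. expectation (\<lambda>\<omega>. exp (s * Y i \<omega>)))" unfolding S_def
      by (rule exp_sum_indep(2)[OF insert.hyps(1) indI]) (use insert.prems(5) in auto)
    also have "\<dots> \<le> (\<Prod>i\<in>I. m i)" by (intro prod_mono) (use insert.prems(6) in auto)
    finally show "expectation (\<lambda>\<omega>. exp (s * S \<omega>)) \<le> (\<Prod>i\<in>I. m i)" .
  qed
  \<comment> \<open>\<open>A1\<close> has the true summand \<open>j\<close> and the true rest
    \<open>S\<close>, \<open>A2\<close> a normal summand with the true rest, \<open>A3\<close>
    normal laws throughout. The first exchange costs \<open>e j\<close>, weighted by the generating
    function of \<open>S\<close>; the second is the induction hypothesis, weighted by the generating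
    function of the normal summand.\<close>
  define A1 where "A1 = (\<integral>y. \<integral>x. f (w + (x + y)) \<partial>\<mu> \<partial>P)"
  define A2 where "A2 = (\<integral>y. \<integral>x. f (w + (x + y)) \<partial>normal_law (v j) \<partial>P)"
  define A3 where "A3 = (\<integral>x. \<integral>y. f (w + (x + y)) \<partial>normal_law V \<partial>normal_law (v j))"
  have fw: "(\<lambda>x. f (w + x)) \<in> borel_measurable borel" by measurable
  have "expectation (\<lambda>\<omega>. f (w + (\<Sum>i\<in>insert j I. Y i \<omega>))) = (\<integral>x. f (w + x) \<partial>distr M borel (\<lambda>\<omega>. Y j \<omega> + S \<omega>))"
  proof (subst integral_distr)
    show "(\<lambda>\<omega>. Y j \<omega> + S \<omega>) \<in> borel_measurable M" by measurable
  qed (use insert.hyps in \<open>auto simp: S_def\<close>)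
  also have "\<dots> = A1" unfolding law A1_def
    by (rule integral_convolution(2)[OF \<mu> P fw bd])
  finally have E1: "expectation (\<lambda>\<omega>. f (w + (\<Sum>i\<in>insert j I. Y i \<omega>))) = A1" .
  have E3: "(\<integral>y. f (w + y) \<partial>normal_law (\<Sum>i\<in>insert j I. v i)) = A3"
    unfolding A3_def using insert.hyps
    by (simp add: integral_normal_law_add[OF vj V fw bd] flip: V_def)
  have A2': "A2 = (\<integral>x. \<integral>y. f (w + (x + y)) \<partial>P \<partial>normal_law (v j))"
    unfolding A2_def integral_convolution(2)[OF real_distribution_normal_law P fw bd, symmetric]
    by (rule integral_convolution(1)[OF real_distribution_normal_law P fw bd])
  have d12: "\<bar>A1 - A2\<bar> \<le> e j * exp (s * w) * (\<Prod>i\<in>I. m i)"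
  proof -
    define g where "g = (\<lambda>y. (\<integral>x. f (w + (x + y)) \<partial>\<mu>) - (\<integral>x. f (w + (x + y)) \<partial>normal_law (v j)))"
    have gm: "g \<in> borel_measurable borel" unfolding g_def by measurable
    have g_le: "\<bar>g y\<bar> \<le> e j * exp (s * w) * exp (s * y)" for y
    proof -
      have "(\<integral>x. f (w + (x + y)) \<partial>\<mu>) = expectation (\<lambda>\<omega>. f ((w + y) + Y j \<omega>))"
        unfolding \<mu>_def by (subst integral_distr) (auto simp: ac_simps)
      then have "\<bar>g y\<bar> \<le> e j * exp (s * (w + y))"
        using insert.prems(4)[of j "w + y"] unfolding g_def by (simp add: ac_simps)
      then show ?thesis by (simp add: distrib_left exp_add mult.assoc)
    qed
    have "A1 - A2 = (\<integral>y. g y \<partial>P)"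
      unfolding A1_def A2_def g_def
      by (rule Bochner_Integration.integral_diff[symmetric])
        (intro intbd[of _ _ B] P.prob_space_axioms bound_int \<mu>.prob_space_axioms \<nu>.prob_space_axioms bd; measurable)+
    also have "\<dots> = expectation (\<lambda>\<omega>. g (S \<omega>))"
      unfolding P_def using gm by (subst integral_distr) auto
    finally have "\<bar>A1 - A2\<bar> = \<bar>expectation (\<lambda>\<omega>. g (S \<omega>))\<bar>" by simp
    also have "\<dots> \<le> expectation (\<lambda>\<omega>. e j * exp (s * w) * exp (s * S \<omega>))"
    proof (rule abs_integral_le)
      show ie: "integrable M (\<lambda>\<omega>. e j * exp (s * w) * exp (s * S \<omega>))" using int_mgf by simp
      show "integrable M (\<lambda>\<omega>. g (S \<omega>))"
        by (rule Bochner_Integration.integrable_bound[OF ie]) (use gm g_le in \<open>auto intro!: AE_I2 order_trans[OF g_le abs_ge_self]\<close>)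
    qed (rule g_le)
    also have "\<dots> = e j * exp (s * w) * expectation (\<lambda>\<omega>. exp (s * S \<omega>))" by simp
    also have "\<dots> \<le> e j * exp (s * w) * (\<Prod>i\<in>I. m i)"
      using e_mgf insert.prems(3)[of j] by (intro mult_left_mono) auto
    finally show ?thesis .
  qed
  have d23: "\<bar>A2 - A3\<bar> \<le> exp (s * w) * (\<Sum>i\<in>I. e i) * (\<Prod>i\<in>I. m i) * m j"
  proof -
    define K where "K = (\<Sum>i\<in>I. e i) * (\<Prod>i\<in>I. m i)"
    have K: "K \<ge> 0" unfolding K_def using insert.prems(3) mI by (auto intro!: mult_nonneg_nonneg sum_nonneg prod_nonneg)
    define g where "g = (\<lambda>x. (\<integral>y. f (w + (x + y)) \<partial>P) - (\<integral>y. f (w + (x + y)) \<partial>normal_law V))"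
    have gm: "g \<in> borel_measurable borel" unfolding g_def by measurable
    have g_le: "\<bar>g x\<bar> \<le> exp (s * w) * K * exp (s * x)" for x
    proof -
      have "(\<integral>y. f (w + (x + y)) \<partial>P) = expectation (\<lambda>\<omega>. f ((w + x) + S \<omega>))"
        unfolding P_def by (subst integral_distr) (auto simp: ac_simps)
      then have "\<bar>g x\<bar> \<le> exp (s * (w + x)) * (\<Sum>i\<in>I. e i) * (\<Prod>i\<in>I. m i)"
        using insert.IH[OF indI, of "w + x"] insert.prems unfolding g_def S_def V_def by (simp add: ac_simps)
      then show ?thesis by (simp add: K_def distrib_left exp_add mult_ac)
    qed
    have "A2 - A3 = (\<integral>x. g x \<partial>normal_law (v j))"
      unfolding A2' A3_def g_def
      by (rule Bochner_Integration.integral_diff[symmetric])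
        (intro intbd[of _ _ B] \<nu>.prob_space_axioms bound_int P.prob_space_axioms bd; measurable)+
    also have "\<dots> = (\<integral>z. g (sqrt (v j) * z) \<partial>gauss)"
      by (rule integral_normal_law[OF gm])
    finally have "\<bar>A2 - A3\<bar> = \<bar>\<integral>z. g (sqrt (v j) * z) \<partial>gauss\<bar>" by simp
    also have "\<dots> \<le> (\<integral>z. exp (s * w) * K * exp (s * sqrt (v j) * z) \<partial>gauss)"
    proof (rule abs_integral_le)
      show ie: "integrable gauss (\<lambda>z. exp (s * w) * K * exp (s * sqrt (v j) * z))"
        using integrable_std_normal_exp[of "s * sqrt (v j)"] by simp
      have *: "\<bar>g (sqrt (v j) * z)\<bar> \<le> exp (s * w) * K * exp (s * sqrt (v j) * z)" for z
        using g_le[of "sqrt (v j) * z"] by (simp add: mult.assoc)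
      then show "\<bar>g (sqrt (v j) * z)\<bar> \<le> exp (s * w) * K * exp (s * sqrt (v j) * z)" for z .
      show "integrable gauss (\<lambda>z. g (sqrt (v j) * z))"
        by (rule Bochner_Integration.integrable_bound[OF ie])
          (use gm * in \<open>auto intro!: AE_I2 order_trans[OF * abs_ge_self]\<close>)
    qed
    also have "\<dots> = exp (s * w) * K * exp ((s * sqrt (v j))\<^sup>2 / 2)"
      by (simp add: integral_std_normal_exp)
    also have "\<dots> = exp (s * w) * K * exp (s\<^sup>2 * v j / 2)"
      using vj by (simp add: power_mult_distrib)
    also have "\<dots> \<le> exp (s * w) * K * m j"
      using insert.prems(7)[of j] K by (intro mult_left_mono) auto
    finally show ?thesis by (simp add: K_def mult.assoc)
  qed
  \<comment> \<open>The first error carries the product over \<open>I\<close> only; a factor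
    \<open>m j \<ge> 1\<close> extends it to \<open>insert j I\<close>.\<close>
  have "1 \<le> m j"
    using insert.prems(7)[of j] vj by (smt (verit) insertI1 one_le_exp_iff divide_nonneg_nonneg mult_nonneg_nonneg zero_le_power2)
  then have "e j * exp (s * w) * (\<Prod>i\<in>I. m i) * 1 \<le> e j * exp (s * w) * (\<Prod>i\<in>I. m i) * m j"
    using insert.prems(3)[of j] mI by (intro mult_left_mono mult_nonneg_nonneg prod_nonneg) auto
  then have "\<bar>A1 - A3\<bar> \<le> e j * exp (s * w) * (\<Prod>i\<in>I. m i) * m j + exp (s * w) * (\<Sum>i\<in>I. e i) * (\<Prod>i\<in>I. m i) * m j"
    using d12 d23 by linarith
  also have "\<dots> = exp (s * w) * (\<Sum>i\<in>insert j I. e i) * (\<Prod>i\<in>insert j I. m i)"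
    using insert.hyps by (simp add: algebra_simps)
  finally show ?case unfolding E1 E3 .
qed

section \<open>Normal tails and truncated summands\<close>

abbreviation normal_tail :: "real \<Rightarrow> real" where
  "normal_tail x \<equiv> 1 - cdf gauss x"

lemma (in prob_space) Chernoff_bound:
  assumes "random_variable borel X" "integrable M (\<lambda>\<omega>. exp (s * X \<omega>))" "s \<ge> 0"
  shows "\<P>(\<omega> in M. X \<omega> \<ge> x) \<le> exp (- (s * x)) * expectation (\<lambda>\<omega>. exp (s * X \<omega>))"
proof -
  have [measurable]: "random_variable borel X" by fact
  have "\<P>(\<omega> in M. X \<omega> \<ge> x) \<le> \<P>(\<omega> in M. exp (s * X \<omega>) \<ge> exp (s * x))"
    using \<open>s \<ge> 0\<close> by (intro finite_measure_mono) (auto intro: mult_left_mono)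
  also have "\<dots> \<le> expectation (\<lambda>\<omega>. exp (s * X \<omega>)) / exp (s * x)"
    by (rule integral_Markov_inequality_measure[OF assms(2), where A = "{}"]) auto
  finally show ?thesis by (simp add: exp_minus field_simps)
qed

lemma std_normal_measure_Icc:
  fixes l u :: real
  assumes "l \<le> u"
  shows "(\<And>z. l \<le> z \<Longrightarrow> z \<le> u \<Longrightarrow> k \<le> std_normal_density z) \<Longrightarrow> 0 \<le> k \<Longrightarrow> k * (u - l) \<le> measure gauss {l..u}"
    and "(\<And>z. l \<le> z \<Longrightarrow> z \<le> u \<Longrightarrow> std_normal_density z \<le> k) \<Longrightarrow> measure gauss {l..u} \<le> k * (u - l)"
proof -
  have em: "emeasure gauss {l..u} = (\<integral>\<^sup>+z. ennreal (std_normal_density z) * indicator {l..u} z \<partial>lborel)"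
    by (subst emeasure_density) auto
  have kk: "(\<integral>\<^sup>+z. ennreal k * indicator {l..u} z \<partial>lborel) = ennreal (k * (u - l))" if "k \<ge> 0"
    using assms that by (simp add: nn_integral_cmult_indicator ennreal_mult)
  show "k * (u - l) \<le> measure gauss {l..u}"
    if "\<And>z. l \<le> z \<Longrightarrow> z \<le> u \<Longrightarrow> k \<le> std_normal_density z" "0 \<le> k"
  proof -
    have "ennreal (k * (u - l)) \<le> emeasure gauss {l..u}"
      unfolding em kk[OF that(2), symmetric]
      by (intro nn_integral_mono) (auto simp: indicator_def that ennreal_leI)
    then show ?thesis by (simp add: std_normal.emeasure_eq_measure)
  qed
  show "measure gauss {l..u} \<le> k * (u - l)"
    if "\<And>z. l \<le> z \<Longrightarrow> z \<le> u \<Longrightarrow> std_normal_density z \<le> k"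
  proof -
    have k: "k \<ge> 0" using that[of l] assms normal_density_nonneg[of 0 1 l] by linarith
    have "emeasure gauss {l..u} \<le> ennreal (k * (u - l))"
      unfolding em kk[OF k, symmetric]
      by (intro nn_integral_mono) (auto simp: indicator_def that ennreal_leI)
    then show ?thesis using k assms by (simp add: std_normal.emeasure_eq_measure ennreal_le_iff)
  qed
qed

text \<open>\<open>1 - cdf\<close> is the mass of the open half-line, whereas the events here are
  closed. The atom at x has mass 0 by the density bound on an interval of length 0.\<close>

lemma normal_tail_eq: "measure gauss {x..} = normal_tail x"
proof -
  have "measure gauss {x..x} \<le> std_normal_density x * (x - x)"
    by (rule std_normal_measure_Icc(2)) auto
  then have "measure gauss {x} = 0"
    by (simp add: measure_le_0_iff)
  moreover have "measure gauss ({x} \<union> {x<..}) = measure gauss {x} + measure gauss {x<..}"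
    by (rule std_normal.finite_measure_Union) auto
  moreover have "{x} \<union> {x<..} = {x..}" by auto
  moreover have "measure gauss (UNIV - {..x}) = 1 - measure gauss {..x}"
    using std_normal.prob_compl[of "{..x}"] by simp
  moreover have "UNIV - {..x} = {x<..}" by auto
  ultimately show ?thesis by (simp add: cdf_def)
qed

lemma normal_tail_antimono: "x \<le> y \<Longrightarrow> normal_tail y \<le> normal_tail x"
  using std_normal.cdf_nondecreasing by simp

text \<open>On [l, l + d] the density is at most exp(-l^2/2). This is the price of smoothing the
  indicator over a width d.\<close>

lemma normal_tail_diff_le:
  assumes "0 \<le> l" "0 \<le> d"
  shows "normal_tail l - normal_tail (l + d) \<le> d * exp (- l\<^sup>2 / 2)"
proof (cases "d = 0")
  case False
  have "normal_tail l - normal_tail (l + d) = measure gauss {l<..l + d}"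
    using std_normal.cdf_diff_eq[of l "l + d"] assms False by simp
  also have "\<dots> \<le> measure gauss {l..l + d}"
    by (intro std_normal.finite_measure_mono) auto
  also have "\<dots> \<le> exp (- l\<^sup>2 / 2) * (l + d - l)"
  proof (rule std_normal_measure_Icc(2))
    fix z assume "l \<le> z" "z \<le> l + d"
    have "sqrt (2 * pi) \<ge> 1" using pi_ge_two by (simp add: real_le_rsqrt)
    then have "std_normal_density z \<le> 1 * exp (- z\<^sup>2 / 2)"
      unfolding std_normal_density_def by (intro mult_right_mono) (auto simp: divide_le_eq_1)
    also have "\<dots> \<le> exp (- l\<^sup>2 / 2)"
      using \<open>l \<le> z\<close> assms by (simp add: power_mono)
    finally show "std_normal_density z \<le> exp (- l\<^sup>2 / 2)" .
  qed (use assms in auto)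
  finally show ?thesis by (simp add: mult.commute)
qed simp

text \<open>Lower half of Mills' ratio, obtained from [x, x + 1/x] alone: there z^2 is at most x^2 +
  2 + 1/x^2. It converts errors of order exp(-x^2/2) into relative errors at the cost of a factor
  x.\<close>

lemma normal_tail_lower:
  assumes "0 < a" "a \<le> x"
  shows "exp (- 1 - 1 / (2 * a\<^sup>2)) / sqrt (2 * pi) * exp (- x\<^sup>2 / 2) / x \<le> normal_tail x"
proof -
  have x: "x > 0" using assms by simp
  define k where "k = exp (- 1 - 1 / (2 * a\<^sup>2)) / sqrt (2 * pi) * exp (- x\<^sup>2 / 2)"
  have "k * (x + 1 / x - x) \<le> measure gauss {x..x + 1 / x}"
  proof (rule std_normal_measure_Icc(1))
    fix z assume z: "x \<le> z" "z \<le> x + 1 / x"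
    have "z\<^sup>2 \<le> (x + 1 / x)\<^sup>2" using z x by (intro power_mono) auto
    also have "\<dots> = x\<^sup>2 + 2 + 1 / x\<^sup>2" using x by (simp add: power2_eq_square field_simps)
    also have "1 / x\<^sup>2 \<le> 1 / a\<^sup>2" using assms by (intro divide_left_mono power_mono) auto
    finally have "- 1 - 1 / (2 * a\<^sup>2) - x\<^sup>2 / 2 \<le> - z\<^sup>2 / 2" by simp
    then have "exp (- 1 - 1 / (2 * a\<^sup>2)) * exp (- x\<^sup>2 / 2) \<le> exp (- z\<^sup>2 / 2)"
      by (simp add: mult_exp_exp)
    then show "k \<le> std_normal_density z"
      unfolding k_def std_normal_density_def by (simp add: divide_right_mono)
  qed (use x in \<open>auto simp: k_def\<close>)
  also have "\<dots> \<le> measure gauss {x..}"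
    by (intro std_normal.finite_measure_mono) auto
  finally show ?thesis unfolding normal_tail_eq k_def by simp
qed

lemma normal_tail_pos: "0 < normal_tail x"
proof -
  define y where "y = max 1 x"
  have "0 < exp (- 1 - 1 / (2 * 1\<^sup>2)) / sqrt (2 * pi) * exp (- y\<^sup>2 / 2) / y" by (simp add: y_def)
  also have "\<dots> \<le> normal_tail y" by (rule normal_tail_lower) (auto simp: y_def)
  also have "\<dots> \<le> normal_tail x" by (rule normal_tail_antimono) (simp add: y_def)
  finally show ?thesis .
qed

lemma normal_tail_upper:
  assumes "0 \<le> x"
  shows "normal_tail x \<le> exp (- x\<^sup>2 / 2)"
proof -
  have "normal_tail x = \<P>(z in gauss. z \<ge> x)"
    unfolding normal_tail_eq[symmetric] by (simp add: atLeast_def)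
  also have "\<dots> \<le> exp (- (x * x)) * (\<integral>z. exp (x * z) \<partial>gauss)"
    by (rule std_normal.Chernoff_bound) (use assms integrable_std_normal_exp in auto)
  also have "\<dots> = exp (- x\<^sup>2 / 2)"
    by (simp add: integral_std_normal_exp mult_exp_exp) (simp add: power2_eq_square)
  finally show ?thesis .
qed

section \<open>Second-order expansion of test functions under normal laws\<close>

lemma cube_le_exp:
  fixes z :: real
  assumes "z \<ge> 0"
  shows "z ^ 3 \<le> 27 * exp z"
proof -
  have "(z / 3) ^ 3 \<le> exp (z / 3) ^ 3"
  proof (rule power_mono)
    show "z / 3 \<le> exp (z / 3)" using exp_ge_add_one_self[of "z / 3"] by linarith
  qed (use assms in simp)
  also have "\<dots> = exp z" by (simp flip: exp_of_nat_mult)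
  finally show ?thesis by (simp add: power_divide)
qed

lemma integrable_std_normal_powr_exp:
  assumes "2 < p" "p \<le> 3"
  shows "integrable gauss (\<lambda>z. (1 + exp \<bar>z\<bar>) * \<bar>z\<bar> powr p)"
proof (rule Bochner_Integration.integrable_bound)
  show "integrable gauss (\<lambda>z. 56 * (exp (2 * z) + exp ((- 2) * z)))"
    by (intro Bochner_Integration.integrable_mult_right Bochner_Integration.integrable_add integrable_std_normal_exp)
  show "AE z in gauss. norm ((1 + exp \<bar>z\<bar>) * \<bar>z\<bar> powr p) \<le> norm (56 * (exp (2 * z) + exp ((- 2) * z)))"
  proof (intro AE_I2)
    fix z :: real
    have "\<bar>z\<bar> powr p \<le> 28 * exp \<bar>z\<bar>"
    proof (cases "\<bar>z\<bar> \<le> 1")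
      case True
      then have "\<bar>z\<bar> powr p \<le> 1" using assms by (intro powr_le1) auto
      also have "\<dots> \<le> exp \<bar>z\<bar>" by simp
      finally show ?thesis using exp_ge_zero[of "\<bar>z\<bar>"] by linarith
    next
      case False
      then have "\<bar>z\<bar> powr p \<le> \<bar>z\<bar> powr 3" using assms by (intro powr_mono) auto
      also have "\<dots> = \<bar>z\<bar> ^ 3" by (simp add: powr_numeral)
      also have "\<dots> \<le> 27 * exp \<bar>z\<bar>" by (rule cube_le_exp) simp
      also have "\<dots> \<le> 28 * exp \<bar>z\<bar>" by simp
      finally show ?thesis .
    qed
    then have "(1 + exp \<bar>z\<bar>) * \<bar>z\<bar> powr p \<le> (2 * exp \<bar>z\<bar>) * (28 * exp \<bar>z\<bar>)"
      by (intro mult_mono) auto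
    also have "\<dots> = 56 * exp (2 * \<bar>z\<bar>)" by (simp add: mult_exp_exp)
    also have "\<dots> \<le> 56 * (exp (2 * z) + exp ((- 2) * z))"
      by (cases "z \<ge> 0") auto
    finally show "norm ((1 + exp \<bar>z\<bar>) * \<bar>z\<bar> powr p) \<le> norm (56 * (exp (2 * z) + exp ((- 2) * z)))"
      by simp
  qed
qed auto

lemma C3_exp_bounded_measurable:
  assumes "C3_exp_bounded A s f f1 f2 f3"
  shows "f \<in> borel_measurable borel"
proof (rule borel_measurable_continuous_onI)
  show "continuous_on UNIV f"
    using assms unfolding C3_exp_bounded_def by (meson DERIV_isCont continuous_at_imp_continuous_on)
qed

text \<open>The 4 is that of \<open>Taylor2_exp_bound\<close>; exp |z| replaces the weight exp(s
  sqrt(v) z) when s sqrt(v) is at most 1.\<close>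

definition normal_const :: "real \<Rightarrow> real" where
  "normal_const p = 4 * (\<integral>z. (1 + exp \<bar>z\<bar>) * \<bar>z\<bar> powr p \<partial>gauss)"

lemma normal_const_nonneg: "normal_const p \<ge> 0"
  unfolding normal_const_def by (intro mult_nonneg_nonneg integral_nonneg_AE) auto

text \<open>The first moment vanishes and the second is v, so only the Taylor remainder survives.
  The terms kept are those of \<open>trunc_expansion\<close>, so that they cancel once the variances
  agree.\<close>

lemma normal_law_expansion:
  assumes f: "C3_exp_bounded A s f f1 f2 f3" and s: "s \<ge> 0" and p: "2 < p" "p \<le> 3"
    and v: "v > 0" "s * sqrt v \<le> 1"
  shows "\<bar>(\<integral>y. f (w + y) \<partial>normal_law v) - f w - f2 w * v / 2\<bar>
           \<le> A * exp (s * w) * v powr (p / 2) * normal_const p"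
proof -
  note A = C3_exp_bounded_nonneg[OF f]
  note fm[measurable] = C3_exp_bounded_measurable[OF f]
  define g where "g = (\<lambda>z. f (w + sqrt v * z) - f w - f1 w * (sqrt v * z) - f2 w * (sqrt v * z)\<^sup>2 / 2)"
  have m1: "integrable gauss (\<lambda>z. z)" "(\<integral>z. z \<partial>gauss) = 0"
    using integrable_std_normal_distribution_moment[of 1] integral_std_normal_distribution_moment_odd[of 1] by auto
  have m2: "integrable gauss (\<lambda>z. z\<^sup>2)" "(\<integral>z. z\<^sup>2 \<partial>gauss) = 1"
    using integrable_std_normal_distribution_moment[of 2] std_normal_distribution_even_moments(1)[of 1]
    by (auto simp: fact_2)
  have g_le: "\<bar>g z\<bar> \<le> 4 * A * exp (s * w) * v powr (p / 2) * ((1 + exp \<bar>z\<bar>) * \<bar>z\<bar> powr p)" for z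
  proof -
    have "\<bar>g z\<bar> \<le> 4 * A * exp (s * w) * (1 + exp (s * (sqrt v * z))) * \<bar>sqrt v * z\<bar> powr p"
      unfolding g_def by (rule Taylor2_exp_bound[OF f s p])
    also have "\<bar>sqrt v * z\<bar> powr p = v powr (p / 2) * \<bar>z\<bar> powr p"
      using v by (simp add: abs_mult powr_mult powr_half_sqrt[symmetric] powr_powr)
    also have "4 * A * exp (s * w) * (1 + exp (s * (sqrt v * z))) * (v powr (p / 2) * \<bar>z\<bar> powr p)
        \<le> 4 * A * exp (s * w) * (1 + exp \<bar>z\<bar>) * (v powr (p / 2) * \<bar>z\<bar> powr p)"
    proof -
      have "s * (sqrt v * z) \<le> (s * sqrt v) * \<bar>z\<bar>"
        using s v by (simp add: mult.assoc mult_left_mono)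
      also have "\<dots> \<le> 1 * \<bar>z\<bar>" using v by (intro mult_right_mono) auto
      finally show ?thesis using A by (intro mult_right_mono mult_left_mono) auto
    qed
    finally show ?thesis by (simp add: mult_ac)
  qed
  have ig: "integrable gauss (\<lambda>z. 4 * A * exp (s * w) * v powr (p / 2) * ((1 + exp \<bar>z\<bar>) * \<bar>z\<bar> powr p))"
    using integrable_std_normal_powr_exp[OF p] by simp
  have int_f: "integrable gauss (\<lambda>z. f (w + sqrt v * z))"
  proof (rule Bochner_Integration.integrable_bound)
    show "integrable gauss (\<lambda>z. A * exp (s * w) * exp ((s * sqrt v) * z))"
      using integrable_std_normal_exp by simp
    show "AE z in gauss. norm (f (w + sqrt v * z)) \<le> norm (A * exp (s * w) * exp ((s * sqrt v) * z))"
    proof (intro AE_I2)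
      fix z
      have "\<bar>f (w + sqrt v * z)\<bar> \<le> A * exp (s * (w + sqrt v * z))"
        using f unfolding C3_exp_bounded_def by blast
      then show "norm (f (w + sqrt v * z)) \<le> norm (A * exp (s * w) * exp ((s * sqrt v) * z))"
        using A by (simp add: distrib_left exp_add mult_ac)
    qed
  qed simp
  have "(\<integral>y. f (w + y) \<partial>normal_law v) = (\<integral>z. f (w + sqrt v * z) \<partial>gauss)"
    by (subst integral_normal_law) auto
  also have "\<dots> = (\<integral>z. g z + f w + f1 w * sqrt v * z + f2 w * v / 2 * z\<^sup>2 \<partial>gauss)"
    using v by (intro Bochner_Integration.integral_cong) (auto simp: g_def power_mult_distrib)
  also have "\<dots> = (\<integral>z. g z \<partial>gauss) + f w + f2 w * v / 2"
  proof -
    have "integrable gauss g"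
      unfolding g_def power_mult_distrib using int_f m1(1) m2(1) by auto
    then show ?thesis using m1 m2 std_normal.prob_space by simp
  qed
  finally have "\<bar>(\<integral>y. f (w + y) \<partial>normal_law v) - f w - f2 w * v / 2\<bar> = \<bar>\<integral>z. g z \<partial>gauss\<bar>" by simp
  also have "\<dots> \<le> (\<integral>z. 4 * A * exp (s * w) * v powr (p / 2) * ((1 + exp \<bar>z\<bar>) * \<bar>z\<bar> powr p) \<partial>gauss)"
  proof (rule abs_integral_le[OF _ ig g_le])
    show "integrable gauss g"
      unfolding g_def power_mult_distrib using int_f m1(1) m2(1) by auto
  qed
  also have "\<dots> = A * exp (s * w) * v powr (p / 2) * normal_const p"
    unfolding normal_const_def by simp
  finally show ?thesis .
qed

text \<open>Truncation acts from above only: with s \<ge> 0 the left tail does no harm to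
  exponential moments. Large values become 0, not y, so that a jump disappears from the truncated
  sum altogether.\<close>

definition trunc :: "real \<Rightarrow> real \<Rightarrow> real" where
  "trunc y u = (if u \<le> y then u else 0)"

lemma trunc_measurable[measurable]: "trunc y \<in> borel_measurable borel"
  unfolding trunc_def[abs_def] by measurable

lemma trunc_le: "y \<ge> 0 \<Longrightarrow> trunc y u \<le> y" and abs_trunc_le: "\<bar>trunc y u\<bar> \<le> \<bar>u\<bar>"
  by (auto simp: trunc_def)

lemma powr_excess:
  assumes "0 < y" "y < u" "q \<le> (p::real)"
  shows "u powr q \<le> y powr (q - p) * u powr p"
proof -
  have "u powr q = u powr (q - p) * u powr p" using assms by (simp add: powr_add[symmetric])
  also have "\<dots> \<le> y powr (q - p) * u powr p"
    using assms by (intro mult_right_mono powr_mono2') auto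
  finally show ?thesis .
qed

text \<open>Truncation removes only positive values, so the mean can only drop; this sign is
  exploited in every upper bound for a generating function. The losses are integrals of X^q over X >
  y with q = 1, 2, and there X^q is at most y^(q-p) X^p.\<close>

lemma (in prob_space) trunc_moments:
  fixes X :: "'a \<Rightarrow> real"
  assumes X: "integrable M X" "expectation X = 0" and p: "2 < p"
    and Xp: "integrable M (\<lambda>\<omega>. \<bar>X \<omega>\<bar> powr p)" and y: "y > 0"
  shows "integrable M (\<lambda>\<omega>. (X \<omega>)\<^sup>2)"
    and "integrable M (\<lambda>\<omega>. trunc y (X \<omega>))" and "integrable M (\<lambda>\<omega>. (trunc y (X \<omega>))\<^sup>2)"
    and "expectation (\<lambda>\<omega>. trunc y (X \<omega>)) \<le> 0"
    and "\<bar>expectation (\<lambda>\<omega>. trunc y (X \<omega>))\<bar> \<le> y powr (1 - p) * expectation (\<lambda>\<omega>. \<bar>X \<omega>\<bar> powr p)"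
    and "expectation (\<lambda>\<omega>. (trunc y (X \<omega>))\<^sup>2) \<le> expectation (\<lambda>\<omega>. (X \<omega>)\<^sup>2)"
    and "\<bar>expectation (\<lambda>\<omega>. (trunc y (X \<omega>))\<^sup>2) - expectation (\<lambda>\<omega>. (X \<omega>)\<^sup>2)\<bar>
           \<le> y powr (2 - p) * expectation (\<lambda>\<omega>. \<bar>X \<omega>\<bar> powr p)"
proof -
  have [measurable]: "random_variable borel X" using X by simp
  show X2: "integrable M (\<lambda>\<omega>. (X \<omega>)\<^sup>2)"
  proof (rule Bochner_Integration.integrable_bound)
    show "integrable M (\<lambda>\<omega>. 1 + \<bar>X \<omega>\<bar> powr p)" using Xp by simp
    have "u\<^sup>2 \<le> 1 + \<bar>u\<bar> powr p" for u :: real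
    proof (cases "\<bar>u\<bar> \<le> 1")
      case True
      then show ?thesis by (simp add: abs_square_le_1 add_increasing2)
    next
      case False
      then show ?thesis using square_le_powr[of u p] p by simp
    qed
    then show "AE \<omega> in M. norm ((X \<omega>)\<^sup>2) \<le> norm (1 + \<bar>X \<omega>\<bar> powr p)"
      by (intro AE_I2) (simp add: add_nonneg_nonneg)
  qed simp
  show T1: "integrable M (\<lambda>\<omega>. trunc y (X \<omega>))"
    by (rule Bochner_Integration.integrable_bound[OF X(1)]) (auto simp: abs_trunc_le)
  have tr2: "(trunc y u)\<^sup>2 \<le> u\<^sup>2" for u by (auto simp: trunc_def)
  show T2: "integrable M (\<lambda>\<omega>. (trunc y (X \<omega>))\<^sup>2)"
    by (rule Bochner_Integration.integrable_bound[OF X2]) (auto simp: tr2)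
  have tr_le: "trunc y u \<le> u" for u using y by (auto simp: trunc_def)
  show E1: "expectation (\<lambda>\<omega>. trunc y (X \<omega>)) \<le> 0"
    using integral_mono[OF T1 X(1) tr_le] X(2) by simp
  have "- expectation (\<lambda>\<omega>. trunc y (X \<omega>)) = expectation (\<lambda>\<omega>. X \<omega> - trunc y (X \<omega>))"
    using X T1 by simp
  also have "\<dots> \<le> expectation (\<lambda>\<omega>. y powr (1 - p) * \<bar>X \<omega>\<bar> powr p)"
  proof (rule integral_mono)
    fix \<omega>
    show "X \<omega> - trunc y (X \<omega>) \<le> y powr (1 - p) * \<bar>X \<omega>\<bar> powr p"
      using powr_excess[of y "X \<omega>" 1 p] y p by (auto simp: trunc_def)
  qed (use X T1 Xp in auto)
  finally show "\<bar>expectation (\<lambda>\<omega>. trunc y (X \<omega>))\<bar> \<le> y powr (1 - p) * expectation (\<lambda>\<omega>. \<bar>X \<omega>\<bar> powr p)"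
    using E1 by simp
  show E2: "expectation (\<lambda>\<omega>. (trunc y (X \<omega>))\<^sup>2) \<le> expectation (\<lambda>\<omega>. (X \<omega>)\<^sup>2)"
    by (rule integral_mono[OF T2 X2 tr2])
  have "expectation (\<lambda>\<omega>. (X \<omega>)\<^sup>2) - expectation (\<lambda>\<omega>. (trunc y (X \<omega>))\<^sup>2) = expectation (\<lambda>\<omega>. (X \<omega>)\<^sup>2 - (trunc y (X \<omega>))\<^sup>2)"
    using X2 T2 by simp
  also have "\<dots> \<le> expectation (\<lambda>\<omega>. y powr (2 - p) * \<bar>X \<omega>\<bar> powr p)"
  proof (rule integral_mono)
    fix \<omega>
    show "(X \<omega>)\<^sup>2 - (trunc y (X \<omega>))\<^sup>2 \<le> y powr (2 - p) * \<bar>X \<omega>\<bar> powr p"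
      using powr_excess[of y "X \<omega>" 2 p] y p by (auto simp: trunc_def powr_numeral)
  qed (use X2 T2 Xp in auto)
  finally show "\<bar>expectation (\<lambda>\<omega>. (trunc y (X \<omega>))\<^sup>2) - expectation (\<lambda>\<omega>. (X \<omega>)\<^sup>2)\<bar>
           \<le> y powr (2 - p) * expectation (\<lambda>\<omega>. \<bar>X \<omega>\<bar> powr p)"
    using E2 by simp
qed

text \<open>Three sources of error: shifted mean, lost variance, and Taylor remainder, where 8 = 4 *
  2 comes from 1 + exp(s T) \<le> 2 exp(s y) for T \<le> y.\<close>

definition trunc_const :: "real \<Rightarrow> real \<Rightarrow> real" where
  "trunc_const p y = y powr (1 - p) + y powr (2 - p) + 8"

text \<open>The second claim keeps the truncated moments, so that their favourable signs remain
  usable for generating functions. The third inserts mean 0 and the full variance, as comparison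
  with the normal law requires.\<close>

lemma (in prob_space) trunc_expansion:
  fixes X :: "'a \<Rightarrow> real"
  assumes X: "integrable M X" "expectation X = 0" and p: "2 < p" "p \<le> 3"
    and Xp: "integrable M (\<lambda>\<omega>. \<bar>X \<omega>\<bar> powr p)" and y: "y > 0"
    and f: "C3_exp_bounded A s f f1 f2 f3" and s: "s \<ge> 0"
  defines "Q \<equiv> expectation (\<lambda>\<omega>. \<bar>X \<omega>\<bar> powr p)"
  shows "integrable M (\<lambda>\<omega>. f (w + trunc y (X \<omega>)))"
    and "\<bar>expectation (\<lambda>\<omega>. f (w + trunc y (X \<omega>))) - f w
           - f1 w * expectation (\<lambda>\<omega>. trunc y (X \<omega>)) - f2 w * expectation (\<lambda>\<omega>. (trunc y (X \<omega>))\<^sup>2) / 2\<bar>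
           \<le> A * exp (s * w) * (8 * exp (s * y) * Q)" (is ?B)
    and "\<bar>expectation (\<lambda>\<omega>. f (w + trunc y (X \<omega>))) - f w - f2 w * expectation (\<lambda>\<omega>. (X \<omega>)\<^sup>2) / 2\<bar>
           \<le> A * exp (s * w) * (Q * trunc_const p y * exp (s * y))"
proof -
  note A = C3_exp_bounded_nonneg[OF f]
  note fm[measurable] = C3_exp_bounded_measurable[OF f]
  have [measurable]: "random_variable borel X" using X by simp
  note tm = trunc_moments[OF X p(1) Xp y]
  let ?T = "\<lambda>\<omega>. trunc y (X \<omega>)"
  have Q0: "Q \<ge> 0" unfolding Q_def by (intro integral_nonneg_AE) auto
  show int_f: "integrable M (\<lambda>\<omega>. f (w + ?T \<omega>))"
  proof (rule integrable_const_bound[where B = "A * exp (s * (w + y))"])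
    show "AE \<omega> in M. norm (f (w + ?T \<omega>)) \<le> A * exp (s * (w + y))"
    proof (intro AE_I2)
      fix \<omega>
      have "\<bar>f (w + ?T \<omega>)\<bar> \<le> A * exp (s * (w + ?T \<omega>))" using f unfolding C3_exp_bounded_def by blast
      also have "\<dots> \<le> A * exp (s * (w + y))"
        using A s trunc_le[of y "X \<omega>"] y by (intro mult_left_mono) (auto intro: mult_left_mono)
      finally show "norm (f (w + ?T \<omega>)) \<le> A * exp (s * (w + y))" by simp
    qed
  qed simp
  define g where "g = (\<lambda>\<omega>. f (w + ?T \<omega>) - f w - f1 w * ?T \<omega> - f2 w * (?T \<omega>)\<^sup>2 / 2)"
  have g_le: "\<bar>g \<omega>\<bar> \<le> A * exp (s * w) * (8 * exp (s * y)) * \<bar>X \<omega>\<bar> powr p" for \<omega>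
  proof -
    have "\<bar>g \<omega>\<bar> \<le> 4 * A * exp (s * w) * (1 + exp (s * ?T \<omega>)) * \<bar>?T \<omega>\<bar> powr p"
      unfolding g_def by (rule Taylor2_exp_bound[OF f s p])
    also have "\<dots> \<le> 4 * A * exp (s * w) * (2 * exp (s * y)) * \<bar>X \<omega>\<bar> powr p"
    proof (intro mult_mono mult_left_mono)
      have "exp (s * ?T \<omega>) \<le> exp (s * y)" "1 \<le> exp (s * y)"
        using s y trunc_le[of y "X \<omega>"] by (auto intro: mult_left_mono)
      then show "1 + exp (s * ?T \<omega>) \<le> 2 * exp (s * y)" by linarith
      show "\<bar>?T \<omega>\<bar> powr p \<le> \<bar>X \<omega>\<bar> powr p"
        using abs_trunc_le[of y "X \<omega>"] p by (intro powr_mono2) auto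
    qed (use A in auto)
    finally show ?thesis by simp
  qed
  have ig: "integrable M g" unfolding g_def using int_f tm by simp
  have Eg: "expectation g = expectation (\<lambda>\<omega>. f (w + ?T \<omega>)) - f w - f1 w * expectation ?T - f2 w * expectation (\<lambda>\<omega>. (?T \<omega>)\<^sup>2) / 2"
    unfolding g_def using int_f tm by (simp add: prob_space)
  have "\<bar>expectation g\<bar> \<le> expectation (\<lambda>\<omega>. A * exp (s * w) * (8 * exp (s * y)) * \<bar>X \<omega>\<bar> powr p)"
    by (rule abs_integral_le[OF ig _ g_le]) (use Xp in simp)
  then show B: ?B unfolding Eg[symmetric] by (simp add: Q_def mult_ac)
  have f1: "\<bar>f1 w * expectation ?T\<bar> \<le> A * exp (s * w) * (y powr (1 - p) * Q)"
    unfolding abs_mult using f A tm(5) by (intro mult_mono) (auto simp: C3_exp_bounded_def Q_def)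
  have f2: "\<bar>f2 w * (expectation (\<lambda>\<omega>. (?T \<omega>)\<^sup>2) - expectation (\<lambda>\<omega>. (X \<omega>)\<^sup>2))\<bar> \<le> A * exp (s * w) * (y powr (2 - p) * Q)"
    unfolding abs_mult using f A tm(7) by (intro mult_mono) (auto simp: C3_exp_bounded_def Q_def)
  have "\<bar>expectation (\<lambda>\<omega>. f (w + ?T \<omega>)) - f w - f2 w * expectation (\<lambda>\<omega>. (X \<omega>)\<^sup>2) / 2\<bar>
      \<le> A * exp (s * w) * (8 * exp (s * y) * Q) + A * exp (s * w) * (y powr (1 - p) * Q) + A * exp (s * w) * (y powr (2 - p) * Q)"
    using B f1 f2 by (simp only: right_diff_distrib)
  also have "\<dots> \<le> A * exp (s * w) * (8 * exp (s * y) * Q) + A * exp (s * w) * (y powr (1 - p) * Q * exp (s * y)) + A * exp (s * w) * (y powr (2 - p) * Q * exp (s * y))"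
  proof -
    have "1 \<le> exp (s * y)" using s y by simp
    then have *: "r * Q \<le> r * Q * exp (s * y)" if "r \<ge> 0" for r
      using that Q0 mult_left_mono[of 1 "exp (s * y)" "r * Q"] by simp
    show ?thesis using A by (intro add_mono mult_left_mono *) auto
  qed
  also have "\<dots> = A * exp (s * w) * (Q * trunc_const p y * exp (s * y))"
    by (simp add: trunc_const_def algebra_simps)
  finally show "\<bar>expectation (\<lambda>\<omega>. f (w + ?T \<omega>)) - f w - f2 w * expectation (\<lambda>\<omega>. (X \<omega>)\<^sup>2) / 2\<bar>
           \<le> A * exp (s * w) * (Q * trunc_const p y * exp (s * y))" .
qed

text \<open>The expansion at w = 0 with the exponential as test function: the linear term is
  nonpositive, the truncated second moment at most the full one, and 1 + z \<le> exp z. The sharp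
  coefficient 1/2 of the variance is essential in the moderate regime.\<close>

lemma (in prob_space) exp_trunc_moderate:
  fixes X :: "'a \<Rightarrow> real"
  assumes X: "integrable M X" "expectation X = 0" and p: "2 < p" "p \<le> 3"
    and Xp: "integrable M (\<lambda>\<omega>. \<bar>X \<omega>\<bar> powr p)" and y: "y > 0" and s: "s \<ge> 0"
  shows "integrable M (\<lambda>\<omega>. exp (s * trunc y (X \<omega>)))"
    and "expectation (\<lambda>\<omega>. exp (s * trunc y (X \<omega>)))
           \<le> exp (s\<^sup>2 * expectation (\<lambda>\<omega>. (X \<omega>)\<^sup>2) / 2
                + (1 + s) ^ 3 * (8 * exp (s * y) * expectation (\<lambda>\<omega>. \<bar>X \<omega>\<bar> powr p)))"
proof -
  note tm = trunc_moments[OF X p(1) Xp y]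
  note te = trunc_expansion[OF X p Xp y C3_exp_bounded_exp[OF s] s, of 0]
  show "integrable M (\<lambda>\<omega>. exp (s * trunc y (X \<omega>)))" using te(1) by simp
  let ?r = "(1 + s) ^ 3 * (8 * exp (s * y) * expectation (\<lambda>\<omega>. \<bar>X \<omega>\<bar> powr p))"
  have "expectation (\<lambda>\<omega>. exp (s * trunc y (X \<omega>))) \<le> 1 + s * expectation (\<lambda>\<omega>. trunc y (X \<omega>))
      + s\<^sup>2 * expectation (\<lambda>\<omega>. (trunc y (X \<omega>))\<^sup>2) / 2 + ?r"
    using te(2) by simp
  also have "\<dots> \<le> 1 + s\<^sup>2 * expectation (\<lambda>\<omega>. (X \<omega>)\<^sup>2) / 2 + ?r"
    using mult_nonneg_nonpos[OF s tm(4)] mult_left_mono[OF tm(6), of "s\<^sup>2"] by simp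
  also have "\<dots> \<le> exp (s\<^sup>2 * expectation (\<lambda>\<omega>. (X \<omega>)\<^sup>2) / 2 + ?r)"
    using exp_ge_add_one_self[of "s\<^sup>2 * expectation (\<lambda>\<omega>. (X \<omega>)\<^sup>2) / 2 + ?r"] by (simp add: add.assoc)
  finally show "expectation (\<lambda>\<omega>. exp (s * trunc y (X \<omega>))) \<le> exp (s\<^sup>2 * expectation (\<lambda>\<omega>. (X \<omega>)\<^sup>2) / 2 + ?r)" .
qed

text \<open>The quotient exp u / u^p is nondecreasing for u \<ge> p, read off here from ln z \<le> z
  - 1 at z = U/u.\<close>

lemma exp_le_powr_scaled:
  fixes u U p :: real
  assumes "0 < p" "p \<le> u" "u \<le> U"
  shows "exp u \<le> u powr p * (exp U / U powr p)"
proof -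
  have u: "u > 0" "U > 0" using assms by auto
  have "ln (U / u) \<le> U / u - 1" using u by (intro ln_le_minus_one) auto
  also have "\<dots> = (U - u) / u" using u by (simp add: field_simps)
  also have "\<dots> \<le> (U - u) / p" using assms by (intro divide_left_mono) auto
  finally have "p * ln (U / u) \<le> U - u" using assms by (simp add: field_simps)
  then have "exp (p * ln (U / u)) \<le> exp (U - u)" by simp
  moreover have "exp (p * ln (U / u)) = U powr p / u powr p"
    using u by (simp add: powr_def ln_div right_diff_distrib exp_diff)
  ultimately show ?thesis using u by (simp add: exp_diff field_simps)
qed

lemma exp_quadratic_bound:
  fixes u p :: real
  assumes "p \<ge> 2" "u \<le> p"
  shows "exp u \<le> 1 + u + exp p * u\<^sup>2"
proof (cases "u = 0")
  case False
  obtain r where r: "\<bar>r\<bar> \<le> \<bar>u\<bar>" "exp u = (\<Sum>m<2. u ^ m / fact m) + exp r / fact 2 * u ^ 2"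
    using Maclaurin_exp_le[of u 2] by blast
  show ?thesis
  proof (cases "u > 0")
    case True
    then have "exp r \<le> exp p" using r(1) assms by simp
    then have "exp r / 2 * u\<^sup>2 \<le> exp p * u\<^sup>2"
      using exp_ge_zero[of r] by (intro mult_right_mono) (linarith, simp)
    then show ?thesis using r(2) by (simp add: eval_nat_numeral)
  next
    \<comment> \<open>The Maclaurin point \<open>r\<close> is only known to satisfy |r| \<le> |u|,
      so for very negative \<open>u\<close> it might be large and positive. Instead the lower bound
      1 + q + q^2/2 \<le> exp q at q = -u is inverted.\<close>
    case False
    have "exp u \<le> 1 + u + u\<^sup>2"
    proof -
      define q where "q = - u"
      have q: "q \<ge> 0" using False q_def by simp
      have "1 + q + q\<^sup>2 / 2 \<le> exp q" using q by (rule exp_lower_Taylor_quadratic)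
      then have "exp (- q) \<le> 1 / (1 + q + q\<^sup>2 / 2)"
        using q by (simp add: exp_minus inverse_eq_divide frac_le add_pos_nonneg)
      also have "\<dots> \<le> 1 - q + q\<^sup>2"
      proof -
        have "1 \<le> (1 - q + q\<^sup>2) * (1 + q + q\<^sup>2 / 2)"
        proof -
          have "(1 - q + q\<^sup>2) * (1 + q + q\<^sup>2 / 2) = 1 + q\<^sup>2 / 2 + q ^ 3 / 2 + q ^ 4 / 2"
            by (simp add: power2_eq_square power3_eq_cube power4_eq_xxxx field_simps)
          then show ?thesis using q by simp
        qed
        then show ?thesis using q by (simp add: divide_le_eq add_pos_nonneg)
      qed
      finally show ?thesis by (simp add: q_def)
    qed
    also have "u\<^sup>2 \<le> exp p * u\<^sup>2" using assms by (intro mult_le_cancel_right1[THEN iffD2]) auto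
    finally show ?thesis by simp
  qed
qed simp

text \<open>Let T be the truncated variable. Where s T \<le> p, the quadratic bound applies;
  elsewhere monotonicity of exp u / u^p bounds the exponential by a p-th power. The coefficient of
  s^2 is worse than in \<open>exp_trunc_moderate\<close>, but exp(s y) now comes divided by y^p,
  which admits much larger s.\<close>

lemma (in prob_space) exp_trunc_large:
  fixes X :: "'a \<Rightarrow> real"
  assumes X: "integrable M X" "expectation X = 0" and p: "2 < p"
    and Xp: "integrable M (\<lambda>\<omega>. \<bar>X \<omega>\<bar> powr p)" and y: "y > 0" and s: "s \<ge> 0" and sy: "p \<le> s * y"
  shows "expectation (\<lambda>\<omega>. exp (s * trunc y (X \<omega>)))
           \<le> exp (exp p * s\<^sup>2 * expectation (\<lambda>\<omega>. (X \<omega>)\<^sup>2)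
                + exp (s * y) / y powr p * expectation (\<lambda>\<omega>. \<bar>X \<omega>\<bar> powr p))"
proof -
  have [measurable]: "random_variable borel X" using X by simp
  note tm = trunc_moments[OF X p Xp y]
  let ?T = "\<lambda>\<omega>. trunc y (X \<omega>)"
  have spos: "s > 0" using sy p s by (cases "s = 0") auto
  have pt: "exp (s * ?T \<omega>) \<le> 1 + s * ?T \<omega> + exp p * s\<^sup>2 * (?T \<omega>)\<^sup>2 + exp (s * y) / y powr p * \<bar>X \<omega>\<bar> powr p" for \<omega>
  proof (cases "s * ?T \<omega> \<le> p")
    case True
    have "exp (s * ?T \<omega>) \<le> 1 + s * ?T \<omega> + exp p * (s * ?T \<omega>)\<^sup>2"
      by (rule exp_quadratic_bound) (use True p in auto)
    moreover have "0 \<le> exp (s * y) / y powr p * \<bar>X \<omega>\<bar> powr p" by simp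
    ultimately show ?thesis unfolding power_mult_distrib mult.assoc by linarith
  next
    case False
    then have T: "?T \<omega> > 0" using s p by (metis linorder_not_le mult_nonneg_nonpos order_trans zero_le_numeral less_imp_le)
    have "exp (s * ?T \<omega>) \<le> (s * ?T \<omega>) powr p * (exp (s * y) / (s * y) powr p)"
      by (rule exp_le_powr_scaled) (use False p trunc_le[of y "X \<omega>"] y s in \<open>auto intro: mult_left_mono\<close>)
    also have "\<dots> = exp (s * y) / y powr p * (?T \<omega>) powr p"
      using spos y T by (simp add: powr_mult)
    also have "\<dots> \<le> exp (s * y) / y powr p * \<bar>X \<omega>\<bar> powr p"
      using T abs_trunc_le[of y "X \<omega>"] p by (intro mult_left_mono powr_mono2) auto
    moreover have "0 \<le> s * ?T \<omega>" "0 \<le> exp p * s\<^sup>2 * (?T \<omega>)\<^sup>2" using s T by auto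
    ultimately show ?thesis by linarith
  qed
  have "expectation (\<lambda>\<omega>. exp (s * ?T \<omega>)) \<le> expectation (\<lambda>\<omega>. 1 + s * ?T \<omega> + exp p * s\<^sup>2 * (?T \<omega>)\<^sup>2 + exp (s * y) / y powr p * \<bar>X \<omega>\<bar> powr p)"
  proof (rule integral_mono)
    show "integrable M (\<lambda>\<omega>. exp (s * ?T \<omega>))"
      by (rule integrable_const_bound[where B = "exp (s * y)"])
        (use trunc_le y s in \<open>auto intro!: AE_I2 mult_left_mono\<close>)
    show "integrable M (\<lambda>\<omega>. 1 + s * ?T \<omega> + exp p * s\<^sup>2 * (?T \<omega>)\<^sup>2 + exp (s * y) / y powr p * \<bar>X \<omega>\<bar> powr p)"
      by (intro Bochner_Integration.integrable_add Bochner_Integration.integrable_mult_right integrable_const tm Xp)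
  qed (rule pt)
  also have "\<dots> = 1 + s * expectation ?T + exp p * s\<^sup>2 * expectation (\<lambda>\<omega>. (?T \<omega>)\<^sup>2) + exp (s * y) / y powr p * expectation (\<lambda>\<omega>. \<bar>X \<omega>\<bar> powr p)"
    using tm Xp by (simp add: prob_space)
  also have "\<dots> \<le> 1 + exp p * s\<^sup>2 * expectation (\<lambda>\<omega>. (X \<omega>)\<^sup>2) + exp (s * y) / y powr p * expectation (\<lambda>\<omega>. \<bar>X \<omega>\<bar> powr p)"
  proof -
    have "exp p * s\<^sup>2 * expectation (\<lambda>\<omega>. (?T \<omega>)\<^sup>2) \<le> exp p * s\<^sup>2 * expectation (\<lambda>\<omega>. (X \<omega>)\<^sup>2)"
      by (intro mult_left_mono tm) auto
    then show ?thesis using mult_nonneg_nonpos[OF s tm(4)] by linarith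
  qed
  also have "\<dots> \<le> exp (exp p * s\<^sup>2 * expectation (\<lambda>\<omega>. (X \<omega>)\<^sup>2) + exp (s * y) / y powr p * expectation (\<lambda>\<omega>. \<bar>X \<omega>\<bar> powr p))"
    using exp_ge_add_one_self[of "exp p * s\<^sup>2 * expectation (\<lambda>\<omega>. (X \<omega>)\<^sup>2) + exp (s * y) / y powr p * expectation (\<lambda>\<omega>. \<bar>X \<omega>\<bar> powr p)"]
    by (simp add: add.assoc)
  finally show ?thesis .
qed

section \<open>Sums of truncated summands\<close>

lemma trunc_const_antimono:
  assumes "2 < p" "0 < y0" "y0 \<le> y"
  shows "trunc_const p y \<le> trunc_const p y0"
  unfolding trunc_const_def using assms by (intro add_mono powr_mono2') auto

lemma abs_le_one_between_indicators:
  fixes r :: real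
  assumes "indicator A v \<le> r \<and> r \<le> indicator B v"
  shows "\<bar>r\<bar> \<le> 1"
  using assms by (cases "v \<in> A"; cases "v \<in> B") auto

lemma (in prob_space) expectation_between_indicators:
  fixes f :: "real \<Rightarrow> real" and X :: "'a \<Rightarrow> real"
  assumes f[measurable]: "f \<in> borel_measurable borel" and X[measurable]: "random_variable borel X"
    and fi: "\<And>v. indicator {l..} v \<le> f v \<and> f v \<le> indicator {z..} v"
  shows "\<P>(\<omega> in M. X \<omega> \<ge> l) \<le> expectation (\<lambda>\<omega>. f (X \<omega>))"
    and "expectation (\<lambda>\<omega>. f (X \<omega>)) \<le> \<P>(\<omega> in M. X \<omega> \<ge> z)"
proof -
  have fb: "\<bar>f v\<bar> \<le> 1" for v by (rule abs_le_one_between_indicators[OF fi])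
  have int_f: "integrable M (\<lambda>\<omega>. f (X \<omega>))"
    by (rule integrable_const_bound[where B = 1]) (auto simp: fb)
  have int_i: "integrable M (\<lambda>\<omega>. indicator {r..} (X \<omega>) :: real)" for r
    by (rule integrable_const_bound[where B = 1]) (auto simp: indicator_def)
  have pi: "\<P>(\<omega> in M. X \<omega> \<ge> r) = expectation (\<lambda>\<omega>. indicator {r..} (X \<omega>))" for r
  proof -
    have "\<P>(\<omega> in M. X \<omega> \<ge> r) = expectation (indicator {\<omega> \<in> space M. X \<omega> \<ge> r})"
    proof -
      have "{\<omega> \<in> space M. r \<le> X \<omega>} \<inter> space M = {\<omega> \<in> space M. r \<le> X \<omega>}" by blast
      then show ?thesis by simp
    qed
    also have "\<dots> = expectation (\<lambda>\<omega>. indicator {r..} (X \<omega>))"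
      by (intro Bochner_Integration.integral_cong) (auto simp: indicator_def)
    finally show ?thesis .
  qed
  show "\<P>(\<omega> in M. X \<omega> \<ge> l) \<le> expectation (\<lambda>\<omega>. f (X \<omega>))"
    unfolding pi by (rule integral_mono[OF int_i int_f]) (use fi in blast)
  show "expectation (\<lambda>\<omega>. f (X \<omega>)) \<le> \<P>(\<omega> in M. X \<omega> \<ge> z)"
    unfolding pi by (rule integral_mono[OF int_f int_i]) (use fi in blast)
qed

locale iid_array = prob_space M for M :: "'a measure" +
  fixes \<xi> :: "'i \<Rightarrow> 'a \<Rightarrow> real" and D :: "real measure" and p :: real
  assumes indep: "indep_vars (\<lambda>_. borel) \<xi> UNIV"
    and law: "\<And>i. distr M borel (\<xi> i) = D"
    and p: "2 < p" "p \<le> 3"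
    and int1: "integrable D (\<lambda>u. u)" and mean: "(\<integral>u. u \<partial>D) = 0"
    and intp: "integrable D (\<lambda>u. \<bar>u\<bar> powr p)"
    and var_pos: "0 < (\<integral>u. u\<^sup>2 \<partial>D)"
begin

definition var where "var = (\<integral>u. u\<^sup>2 \<partial>D)"
definition mom where "mom = (\<integral>u. \<bar>u\<bar> powr p \<partial>D)"

lemma var_gt_0: "0 < var"
  unfolding var_def by (rule var_pos)

lemma mom_nonneg: "0 \<le> mom"
  unfolding mom_def by (intro integral_nonneg_AE) auto

lemma rv[measurable]: "random_variable borel (\<xi> i)"
  using indep unfolding indep_vars_def by auto

lemma integral_law:
  fixes g :: "real \<Rightarrow> real"
  assumes [measurable]: "g \<in> borel_measurable borel"
  shows "expectation (\<lambda>\<omega>. g (\<xi> i \<omega>)) = (\<integral>u. g u \<partial>D)"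
    and "integrable M (\<lambda>\<omega>. g (\<xi> i \<omega>)) \<longleftrightarrow> integrable D g"
  unfolding law[of i, symmetric] by (simp_all add: integral_distr integrable_distr_eq)

lemma prob_law:
  assumes [measurable]: "Measurable.pred borel P"
  shows "\<P>(\<omega> in M. P (\<xi> i \<omega>)) = measure D {u. P u}"
  unfolding law[of i, symmetric] by (subst measure_distr) (auto intro!: arg_cong[where f = prob])

lemma scaled:
  assumes b: "b > 0"
  shows "integrable M (\<lambda>\<omega>. b * \<xi> i \<omega>)" and "expectation (\<lambda>\<omega>. b * \<xi> i \<omega>) = 0"
    and "integrable M (\<lambda>\<omega>. \<bar>b * \<xi> i \<omega>\<bar> powr p)"
    and "expectation (\<lambda>\<omega>. \<bar>b * \<xi> i \<omega>\<bar> powr p) = b powr p * mom"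
    and "expectation (\<lambda>\<omega>. (b * \<xi> i \<omega>)\<^sup>2) = b\<^sup>2 * var"
    and "integrable M (\<lambda>\<omega>. (b * \<xi> i \<omega>)\<^sup>2)"
proof -
  have e: "\<bar>b * u\<bar> powr p = b powr p * \<bar>u\<bar> powr p" for u
    using b by (simp add: abs_mult powr_mult)
  have i1: "integrable M (\<xi> i)" by (rule integral_law(2)[THEN iffD2, OF _ int1]) simp
  have e1: "expectation (\<xi> i) = 0" by (rule integral_law(1)[THEN trans, OF _ mean]) simp
  have ip: "integrable M (\<lambda>\<omega>. \<bar>\<xi> i \<omega>\<bar> powr p)" by (rule integral_law(2)[THEN iffD2, OF _ intp]) simp
  have ep: "expectation (\<lambda>\<omega>. \<bar>\<xi> i \<omega>\<bar> powr p) = mom"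
    unfolding mom_def by (rule integral_law(1)) simp
  have e2: "expectation (\<lambda>\<omega>. (\<xi> i \<omega>)\<^sup>2) = var"
    unfolding var_def by (rule integral_law(1)) simp
  show 1: "integrable M (\<lambda>\<omega>. b * \<xi> i \<omega>)" using i1 by (rule integrable_mult_right)
  show 2: "expectation (\<lambda>\<omega>. b * \<xi> i \<omega>) = 0" using e1 by simp
  show 3: "integrable M (\<lambda>\<omega>. \<bar>b * \<xi> i \<omega>\<bar> powr p)"
    unfolding e using ip by (rule integrable_mult_right)
  show "expectation (\<lambda>\<omega>. \<bar>b * \<xi> i \<omega>\<bar> powr p) = b powr p * mom"
    unfolding e using ep by simp
  show "expectation (\<lambda>\<omega>. (b * \<xi> i \<omega>)\<^sup>2) = b\<^sup>2 * var"
    unfolding power_mult_distrib using e2 by simp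
  show "integrable M (\<lambda>\<omega>. (b * \<xi> i \<omega>)\<^sup>2)"
    by (rule trunc_moments(1)[OF 1 2 p(1) 3]) (rule zero_less_one)
qed

definition tsum :: "('i \<Rightarrow> real) \<Rightarrow> real \<Rightarrow> 'i set \<Rightarrow> 'a \<Rightarrow> real" where
  "tsum b y J \<omega> = (\<Sum>i\<in>J. trunc y (b i * \<xi> i \<omega>))"

abbreviation tsum_tail :: "('i \<Rightarrow> real) \<Rightarrow> real \<Rightarrow> 'i set \<Rightarrow> real \<Rightarrow> real" where
  "tsum_tail b y J x \<equiv> \<P>(\<omega> in M. tsum b y J \<omega> \<ge> x)"

abbreviation scaled_tail :: "('i \<Rightarrow> real) \<Rightarrow> 'i \<Rightarrow> real \<Rightarrow> real" where
  "scaled_tail b i x \<equiv> \<P>(\<omega> in M. b i * \<xi> i \<omega> \<ge> x)"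

text \<open>The weight of the smoothed indicator contributes at most exp(-x^2 + x \<delta>), the
  generating functions at s = x contribute exp(x^2/2) and the cubic correction. \<open>C\<close>
  serves both as prefactor and inside the exponent; \<open>\<theta>\<close> stands for a bound on
  the Lyapunov sum times exp(x y).\<close>

abbreviation swap_error :: "real \<Rightarrow> real \<Rightarrow> real \<Rightarrow> real \<Rightarrow> real" where
  "swap_error C \<delta> \<theta> x \<equiv> C / \<delta> ^ 3 * \<theta> * exp (- x\<^sup>2 / 2 + x * \<delta> + (1 + x) ^ 3 * (C * \<theta>))"

lemma tsum_measurable[measurable]: "random_variable borel (tsum b y J)"
  unfolding tsum_def[abs_def] by measurable

lemma indep_trunc: "indep_vars (\<lambda>_. borel) (\<lambda>i \<omega>. trunc y (b i * \<xi> i \<omega>)) J"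
  by (rule indep_vars_compose2[OF indep_vars_subset[OF indep]]) auto

lemma indep_scaled: "indep_vars (\<lambda>_. borel) (\<lambda>i \<omega>. b i * \<xi> i \<omega>) J"
  by (rule indep_vars_compose2[OF indep_vars_subset[OF indep]]) auto

lemma mgf_tsum_moderate:
  assumes J: "finite J" "\<And>i. i \<in> J \<Longrightarrow> b i > 0" and y: "y > 0" and s: "s \<ge> 0"
  shows "integrable M (\<lambda>\<omega>. exp (s * tsum b y J \<omega>))"
    and "expectation (\<lambda>\<omega>. exp (s * tsum b y J \<omega>))
       \<le> exp (s\<^sup>2 / 2 * (var * (\<Sum>i\<in>J. (b i)\<^sup>2)) + (1 + s) ^ 3 * (8 * mom * ((\<Sum>i\<in>J. b i powr p) * exp (s * y))))"
proof -
  note em = exp_trunc_moderate[OF scaled(1,2) p scaled(3) y s]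
  show "integrable M (\<lambda>\<omega>. exp (s * tsum b y J \<omega>))"
    unfolding tsum_def by (rule exp_sum_indep(1)[OF J(1) indep_trunc]) (use em(1) J in auto)
  have "expectation (\<lambda>\<omega>. exp (s * tsum b y J \<omega>)) = (\<Prod>i\<in>J. expectation (\<lambda>\<omega>. exp (s * trunc y (b i * \<xi> i \<omega>))))"
    unfolding tsum_def by (rule exp_sum_indep(2)[OF J(1) indep_trunc]) (use em(1) J in auto)
  also have "\<dots> \<le> (\<Prod>i\<in>J. exp (s\<^sup>2 * ((b i)\<^sup>2 * var) / 2 + (1 + s) ^ 3 * (8 * exp (s * y) * (b i powr p * mom))))"
    using em(2) J scaled(4,5) by (intro prod_mono conjI integral_nonneg_AE) (auto simp: )
  also have "\<dots> = exp (s\<^sup>2 / 2 * (var * (\<Sum>i\<in>J. (b i)\<^sup>2)) + (1 + s) ^ 3 * (8 * mom * ((\<Sum>i\<in>J. b i powr p) * exp (s * y))))"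
    by (simp add: exp_sum[OF J(1), symmetric] sum.distrib sum_distrib_left sum_distrib_right mult_ac)
  finally show "expectation (\<lambda>\<omega>. exp (s * tsum b y J \<omega>))
       \<le> exp (s\<^sup>2 / 2 * (var * (\<Sum>i\<in>J. (b i)\<^sup>2)) + (1 + s) ^ 3 * (8 * mom * ((\<Sum>i\<in>J. b i powr p) * exp (s * y))))" .
qed

lemma mgf_tsum_large:
  assumes J: "finite J" "\<And>i. i \<in> J \<Longrightarrow> b i > 0" and y: "y > 0" and s: "s \<ge> 0" and sy: "p \<le> s * y"
  shows "expectation (\<lambda>\<omega>. exp (s * tsum b y J \<omega>))
       \<le> exp (exp p * s\<^sup>2 * (var * (\<Sum>i\<in>J. (b i)\<^sup>2)) + exp (s * y) / y powr p * (mom * (\<Sum>i\<in>J. b i powr p)))"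
proof -
  have "expectation (\<lambda>\<omega>. exp (s * tsum b y J \<omega>)) = (\<Prod>i\<in>J. expectation (\<lambda>\<omega>. exp (s * trunc y (b i * \<xi> i \<omega>))))"
    unfolding tsum_def by (rule exp_sum_indep(2)[OF J(1) indep_trunc])
      (use exp_trunc_moderate(1)[OF scaled(1,2) p scaled(3) y s] J in auto)
  also have "\<dots> \<le> (\<Prod>i\<in>J. exp (exp p * s\<^sup>2 * ((b i)\<^sup>2 * var) + exp (s * y) / y powr p * (b i powr p * mom)))"
    using exp_trunc_large[OF scaled(1,2) p(1) scaled(3) y s sy] J scaled(4,5)
    by (intro prod_mono conjI integral_nonneg_AE) auto
  also have "\<dots> = exp (exp p * s\<^sup>2 * (var * (\<Sum>i\<in>J. (b i)\<^sup>2)) + exp (s * y) / y powr p * (mom * (\<Sum>i\<in>J. b i powr p)))"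
    by (simp add: exp_sum[OF J(1), symmetric] sum.distrib sum_distrib_left sum_distrib_right mult_ac)
  finally show ?thesis .
qed

text \<open>Each summand is exchanged for a normal law with its full variance, not its truncated
  one; the mismatch is contained in \<open>trunc_const\<close>. Terms of order zero and two then
  cancel between \<open>trunc_expansion\<close> and \<open>normal_law_expansion\<close>, leaving
  errors of order \<open>b i powr p\<close>.\<close>

lemma tsum_Lindeberg:
  assumes I: "finite I" "\<And>i. i \<in> I \<Longrightarrow> b i > 0" and var1: "var * (\<Sum>i\<in>I. (b i)\<^sup>2) = 1"
    and y: "0 < y0" "y0 \<le> y" and s: "s \<ge> 0" "\<And>i. i \<in> I \<Longrightarrow> s * (b i * sqrt var) \<le> 1"
    and f: "C3_exp_bounded A s f f1 f2 f3" "\<And>v. \<bar>f v\<bar> \<le> 1"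
  defines "\<theta> \<equiv> (\<Sum>i\<in>I. b i powr p) * exp (s * y)"
  shows "\<bar>expectation (\<lambda>\<omega>. f (tsum b y I \<omega>)) - (\<integral>z. f z \<partial>gauss)\<bar>
     \<le> A * (mom * trunc_const p y0 + var powr (p / 2) * normal_const p) * \<theta>
         * exp (s\<^sup>2 / 2 + (1 + s) ^ 3 * (8 * mom * \<theta>))"
proof -
  note A = C3_exp_bounded_nonneg[OF f(1)]
  note [measurable] = C3_exp_bounded_measurable[OF f(1)]
  have y': "y > 0" using y by simp
  define C1 where "C1 = mom * trunc_const p y0 + var powr (p / 2) * normal_const p"
  have tc0: "trunc_const p y0 \<ge> 0" unfolding trunc_const_def by (simp add: add_nonneg_nonneg)
  define v where "v = (\<lambda>i. (b i)\<^sup>2 * var)"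
  define e where "e = (\<lambda>i. A * C1 * exp (s * y) * b i powr p)"
  \<comment> \<open>\<open>m i\<close> has to dominate two generating functions: that of the
    truncated summand and that of the normal law replacing it.\<close>
  define m where "m = (\<lambda>i. exp (s\<^sup>2 * v i / 2 + (1 + s) ^ 3 * (8 * exp (s * y) * (b i powr p * mom))))"
  have C1: "C1 \<ge> 0" unfolding C1_def using mom_nonneg tc0 normal_const_nonneg by simp
  note em = exp_trunc_moderate[OF scaled(1,2) p scaled(3) y' s(1)]
  have vpos: "v i > 0" if "i \<in> I" for i using I(2)[OF that] var_gt_0 by (simp add: v_def)
  have single: "\<bar>expectation (\<lambda>\<omega>. f (w + trunc y (b i * \<xi> i \<omega>))) - (\<integral>y. f (w + y) \<partial>normal_law (v i))\<bar> \<le> e i * exp (s * w)"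
    if i: "i \<in> I" for i w
  proof -
    note bi = I(2)[OF i]
    have sv: "sqrt (v i) = b i * sqrt var" using bi by (simp add: v_def real_sqrt_mult)
    have vp: "v i powr (p / 2) = b i powr p * var powr (p / 2)"
      using bi var_gt_0 by (simp add: v_def powr_mult powr_powr flip: powr_numeral)
    have 1: "\<bar>expectation (\<lambda>\<omega>. f (w + trunc y (b i * \<xi> i \<omega>))) - f w - f2 w * v i / 2\<bar>
        \<le> A * exp (s * w) * (b i powr p * mom * trunc_const p y * exp (s * y))"
      using trunc_expansion(3)[OF scaled(1,2)[OF bi] p scaled(3)[OF bi] y' f(1) s(1), of w i] scaled(4,5)[OF bi]
      by (simp add: v_def)
    have 2: "\<bar>(\<integral>y. f (w + y) \<partial>normal_law (v i)) - f w - f2 w * v i / 2\<bar> \<le> A * exp (s * w) * v i powr (p / 2) * normal_const p"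
      by (rule normal_law_expansion[OF f(1) s(1) p vpos[OF i]]) (use s(2)[OF i] sv in simp)
    have 3: "A * exp (s * w) * (b i powr p * mom * trunc_const p y * exp (s * y))
        \<le> A * exp (s * w) * (b i powr p * mom * trunc_const p y0 * exp (s * y))"
      using A mom_nonneg trunc_const_antimono[OF p(1) y] by (intro mult_left_mono mult_right_mono) auto
    have 4: "A * exp (s * w) * v i powr (p / 2) * normal_const p * 1 \<le> A * exp (s * w) * v i powr (p / 2) * normal_const p * exp (s * y)"
      using A normal_const_nonneg s y' by (intro mult_left_mono) auto
    have "\<bar>expectation (\<lambda>\<omega>. f (w + trunc y (b i * \<xi> i \<omega>))) - (\<integral>y. f (w + y) \<partial>normal_law (v i))\<bar>
       \<le> A * exp (s * w) * (b i powr p * mom * trunc_const p y0 * exp (s * y)) + A * exp (s * w) * v i powr (p / 2) * normal_const p * exp (s * y)"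
      using 1 2 3 4 by linarith
    also have "\<dots> = e i * exp (s * w)"
      unfolding vp e_def C1_def by (simp add: algebra_simps)
    finally show ?thesis .
  qed
  have "\<bar>expectation (\<lambda>\<omega>. f (0 + (\<Sum>i\<in>I. trunc y (b i * \<xi> i \<omega>)))) - (\<integral>y. f (0 + y) \<partial>normal_law (\<Sum>i\<in>I. v i))\<bar>
           \<le> exp (s * 0) * (\<Sum>i\<in>I. e i) * (\<Prod>i\<in>I. m i)"
  proof (rule lindeberg_swap[OF I(1) indep_trunc])
    show "expectation (\<lambda>\<omega>. exp (s * trunc y (b i * \<xi> i \<omega>))) \<le> m i" if "i \<in> I" for i
      using em(2)[of "b i" i] I(2)[OF that] scaled(4,5)[OF I(2)[OF that], of i] by (simp add: m_def v_def)
    show "exp (s\<^sup>2 * v i / 2) \<le> m i" for i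
      using s mom_nonneg by (simp add: m_def)
  qed (use single vpos f em(1) I A C1 in \<open>auto simp: e_def\<close>)
  moreover have "(\<Sum>i\<in>I. v i) = 1" using var1 by (simp add: v_def sum_distrib_left mult.commute)
  moreover have "(\<Sum>i\<in>I. e i) = A * C1 * \<theta>"
    unfolding e_def \<theta>_def by (simp add: sum_distrib_left mult_ac)
  moreover have "(\<Prod>i\<in>I. m i) = exp (s\<^sup>2 / 2 + (1 + s) ^ 3 * (8 * mom * \<theta>))"
  proof -
    have "(\<Prod>i\<in>I. m i) = exp (s\<^sup>2 / 2 * (var * (\<Sum>i\<in>I. (b i)\<^sup>2)) + (1 + s) ^ 3 * (8 * mom * \<theta>))"
      unfolding m_def v_def \<theta>_def
      by (simp add: exp_sum[OF I(1), symmetric] sum.distrib sum_distrib_left sum_distrib_right mult_ac)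
    then show ?thesis using var1 by simp
  qed
  ultimately show ?thesis
    by (simp add: tsum_def integral_normal_law C1_def)
qed

text \<open>As a predicate in \<open>C\<close> this makes explicit that \<open>C\<close> is chosen
  before row, truncation level and x. \<open>\<theta>\<close> is any upper bound, so that a pure
  power of B can be inserted later.\<close>

definition swap_bound :: "real \<Rightarrow> real \<Rightarrow> bool" where
  "swap_bound y0 C \<longleftrightarrow> (\<forall>I b y x \<delta> \<theta>. finite I \<longrightarrow> (\<forall>i\<in>I. b i > 0) \<longrightarrow> var * (\<Sum>i\<in>I. (b i)\<^sup>2) = 1 \<longrightarrow>
     y0 \<le> y \<longrightarrow> 0 \<le> x \<longrightarrow> (\<forall>i\<in>I. x * (b i * sqrt var) \<le> 1) \<longrightarrow> 0 < \<delta> \<longrightarrow> \<delta> \<le> 1 \<longrightarrow>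
     (\<Sum>i\<in>I. b i powr p) * exp (x * y) \<le> \<theta> \<longrightarrow>
     tsum_tail b y I x \<le> normal_tail (x - \<delta>) + swap_error C \<delta> \<theta> x \<and>
     normal_tail (x + \<delta>) - swap_error C \<delta> \<theta> x \<le> tsum_tail b y I x)"

text \<open>The tilt is s = x, which minimises exp(-s x + s^2/2).\<close>

lemma tsum_tail_normal:
  assumes y0: "0 < y0"
  obtains C where "C > 0" "swap_bound y0 C"
proof (rule smooth_indicator)
  fix C0 :: real
  assume C0: "C0 \<ge> 1" and ind: "\<And>z \<delta> s. 0 < \<delta> \<Longrightarrow> \<delta> \<le> 1 \<Longrightarrow> 0 \<le> s \<Longrightarrow> \<exists>f f1 f2 f3.
       C3_exp_bounded (C0 / \<delta> ^ 3 * exp (- (s * z))) s f f1 f2 f3 \<and>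
       (\<forall>v. indicator {z + \<delta>..} v \<le> f v \<and> f v \<le> indicator {z..} v)"
  define C1 where "C1 = mom * trunc_const p y0 + var powr (p / 2) * normal_const p"
  have C1: "C1 \<ge> 0" unfolding C1_def trunc_const_def using mom_nonneg normal_const_nonneg by simp
  \<comment> \<open>\<open>C0 * C1\<close> is needed in front of the exponential,
    \<open>8 * mom\<close> inside it.\<close>
  define C where "C = max 1 (max (C0 * C1) (8 * mom))"
  show thesis
  proof (rule that[of C])
    show "C > 0" by (simp add: C_def)
    show "swap_bound y0 C" unfolding swap_bound_def
    proof (intro allI impI)
      fix I :: "'i set" and b and y x \<delta> \<theta> :: real
      assume "finite I" "\<forall>i\<in>I. b i > 0" "var * (\<Sum>i\<in>I. (b i)\<^sup>2) = 1" and y: "y0 \<le> y"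
        and "0 \<le> x" "\<forall>i\<in>I. x * (b i * sqrt var) \<le> 1" and \<delta>: "0 < \<delta>" "\<delta> \<le> 1"
        and \<theta>: "(\<Sum>i\<in>I. b i powr p) * exp (x * y) \<le> \<theta>"
      then have I: "finite I" "\<And>i. i \<in> I \<Longrightarrow> b i > 0" "var * (\<Sum>i\<in>I. (b i)\<^sup>2) = 1"
        and x: "0 \<le> x" "\<And>i. i \<in> I \<Longrightarrow> x * (b i * sqrt var) \<le> 1" by auto
      define err where "err = swap_error C \<delta> \<theta> x"
      have \<theta>0: "0 \<le> (\<Sum>i\<in>I. b i powr p) * exp (x * y)" by (intro mult_nonneg_nonneg sum_nonneg) auto
      \<comment> \<open>\<open>z = x - \<delta>\<close> will give a test function above the
        indicator of [x, \<infinity>), and \<open>z = x\<close> one below it.\<close>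
      have key: "\<exists>f. f \<in> borel_measurable borel \<and> (\<forall>v. indicator {z + \<delta>..} v \<le> f v \<and> f v \<le> indicator {z..} v) \<and>
          \<bar>expectation (\<lambda>\<omega>. f (tsum b y I \<omega>)) - (\<integral>z. f z \<partial>gauss)\<bar> \<le> err"
        if z: "x - \<delta> \<le> z" for z
      proof -
        obtain f f1 f2 f3 where f: "C3_exp_bounded (C0 / \<delta> ^ 3 * exp (- (x * z))) x f f1 f2 f3"
          and fi: "\<And>v. indicator {z + \<delta>..} v \<le> f v \<and> f v \<le> indicator {z..} v"
          using ind[OF \<delta> x(1), of z] by blast
        have f1: "\<bar>f v\<bar> \<le> 1" for v
          by (rule abs_le_one_between_indicators[OF fi])
        let ?\<theta> = "(\<Sum>i\<in>I. b i powr p) * exp (x * y)"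
        have "\<bar>expectation (\<lambda>\<omega>. f (tsum b y I \<omega>)) - (\<integral>z. f z \<partial>gauss)\<bar>
            \<le> C0 / \<delta> ^ 3 * exp (- (x * z)) * C1 * ?\<theta> * exp (x\<^sup>2 / 2 + (1 + x) ^ 3 * (8 * mom * ?\<theta>))"
          unfolding C1_def by (rule tsum_Lindeberg[OF I y0 y x f f1])
        also have "\<dots> \<le> C0 / \<delta> ^ 3 * exp (- x\<^sup>2 + x * \<delta>) * C1 * \<theta> * exp (x\<^sup>2 / 2 + (1 + x) ^ 3 * (C * \<theta>))"
        proof (intro mult_mono mult_nonneg_nonneg)
          have "x * (x - \<delta>) \<le> x * z" using z x by (intro mult_left_mono) auto
          then show "exp (- (x * z)) \<le> exp (- x\<^sup>2 + x * \<delta>)" by (simp add: power2_eq_square right_diff_distrib)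
          have "8 * mom * ?\<theta> \<le> C * \<theta>" using \<theta> \<theta>0 mom_nonneg by (intro mult_mono) (auto simp: C_def)
          then have "(1 + x) ^ 3 * (8 * mom * ?\<theta>) \<le> (1 + x) ^ 3 * (C * \<theta>)"
            using x by (intro mult_left_mono) auto
          then show "exp (x\<^sup>2 / 2 + (1 + x) ^ 3 * (8 * mom * ?\<theta>)) \<le> exp (x\<^sup>2 / 2 + (1 + x) ^ 3 * (C * \<theta>))" by simp
        qed (use C0 C1 \<delta> \<theta> \<theta>0 in \<open>auto intro!: sum_nonneg\<close>)
        also have "\<dots> = (C0 * C1) / \<delta> ^ 3 * \<theta> * exp (- x\<^sup>2 / 2 + x * \<delta> + (1 + x) ^ 3 * (C * \<theta>))"
        proof -
          have eq: "exp (- x\<^sup>2 + x * \<delta>) * exp (x\<^sup>2 / 2 + (1 + x) ^ 3 * (C * \<theta>)) = exp (- x\<^sup>2 / 2 + x * \<delta> + (1 + x) ^ 3 * (C * \<theta>))"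
            unfolding mult_exp_exp by (rule arg_cong[where f = exp]) simp
          have "C0 / \<delta> ^ 3 * E1 * C1 * \<theta> * E2 = (C0 * C1) / \<delta> ^ 3 * \<theta> * (E1 * E2)" for E1 E2 :: real by simp
          from this[of "exp (- x\<^sup>2 + x * \<delta>)"] show ?thesis unfolding eq[symmetric] .
        qed
        also have "\<dots> \<le> err"
          unfolding err_def using \<theta> \<theta>0 \<delta> by (intro mult_right_mono divide_right_mono) (auto simp: C_def)
        finally show ?thesis using C3_exp_bounded_measurable[OF f] fi by blast
      qed

      have Nt: "measure gauss {z \<in> space gauss. z \<ge> r} = normal_tail r" for r
        unfolding normal_tail_eq[symmetric] by (simp add: atLeast_def)
      obtain f where f: "f \<in> borel_measurable borel" "\<And>v. indicator {x - \<delta> + \<delta>..} v \<le> f v \<and> f v \<le> indicator {x - \<delta>..} v"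
          "\<bar>expectation (\<lambda>\<omega>. f (tsum b y I \<omega>)) - (\<integral>z. f z \<partial>gauss)\<bar> \<le> err"
        using key[of "x - \<delta>"] by blast
      have "tsum_tail b y I x \<le> expectation (\<lambda>\<omega>. f (tsum b y I \<omega>))"
        using expectation_between_indicators(1)[OF f(1) tsum_measurable f(2)] by simp
      also have "\<dots> \<le> (\<integral>z. f z \<partial>gauss) + err" using f(3) by linarith
      also have "(\<integral>z. f z \<partial>gauss) \<le> normal_tail (x - \<delta>)"
        using std_normal.expectation_between_indicators(2)[OF f(1) _ f(2), of "\<lambda>z. z"] unfolding Nt by simp
      finally have up: "tsum_tail b y I x \<le> normal_tail (x - \<delta>) + err" by simp
      obtain f where f: "f \<in> borel_measurable borel" "\<And>v. indicator {x + \<delta>..} v \<le> f v \<and> f v \<le> indicator {x..} v"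
          "\<bar>expectation (\<lambda>\<omega>. f (tsum b y I \<omega>)) - (\<integral>z. f z \<partial>gauss)\<bar> \<le> err"
        using key[of x] \<delta> by auto
      have "normal_tail (x + \<delta>) \<le> (\<integral>z. f z \<partial>gauss)"
        using std_normal.expectation_between_indicators(1)[OF f(1) _ f(2), of "\<lambda>z. z"] unfolding Nt by simp
      also have "\<dots> \<le> expectation (\<lambda>\<omega>. f (tsum b y I \<omega>)) + err" using f(3) by linarith
      also have "expectation (\<lambda>\<omega>. f (tsum b y I \<omega>)) \<le> tsum_tail b y I x"
        using expectation_between_indicators(2)[OF f(1) tsum_measurable f(2)] by simp
      finally have "normal_tail (x + \<delta>) - err \<le> tsum_tail b y I x" by simp
      with up show "tsum_tail b y I x \<le> normal_tail (x - \<delta>) + swap_error C \<delta> \<theta> x \<and>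
         normal_tail (x + \<delta>) - swap_error C \<delta> \<theta> x \<le> tsum_tail b y I x"
        unfolding err_def by (rule conjI)
    qed
  qed
qed

end

section \<open>Moderate and large deviations of truncated sums\<close>

context iid_array
begin

text \<open>The normalised weights \<open>b i = c n i / \<sigma> n\<close> of one row; \<open>B\<close> bounds the largest of them.\<close>

definition array :: "'i set \<Rightarrow> ('i \<Rightarrow> real) \<Rightarrow> real \<Rightarrow> bool" where
  "array I b B \<longleftrightarrow> finite I \<and> (\<forall>i\<in>I. 0 < b i \<and> b i \<le> B) \<and> var * (\<Sum>i\<in>I. (b i)\<^sup>2) = 1"

text \<open>Splitting off \<open>b i powr (p - 2)\<close> leaves the normalised sum of squares. This
  turns small B into a small Lyapunov sum.\<close>

lemma array_sum_powr:
  assumes "array I b B"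
  shows "(\<Sum>i\<in>I. b i powr p) \<le> B powr (p - 2) / var"
proof -
  have "(\<Sum>i\<in>I. b i powr p) \<le> (\<Sum>i\<in>I. B powr (p - 2) * (b i)\<^sup>2)"
  proof (rule sum_mono)
    fix i assume "i \<in> I"
    then have bi: "0 < b i" "b i \<le> B" using assms unfolding array_def by auto
    have "b i powr p = b i powr (p - 2) * (b i)\<^sup>2"
      using powr_add[of "b i" "p - 2" 2] bi by (simp add: powr_numeral)
    also have "\<dots> \<le> B powr (p - 2) * (b i)\<^sup>2"
      using bi p by (intro mult_right_mono powr_mono2) auto
    finally show "b i powr p \<le> B powr (p - 2) * (b i)\<^sup>2" .
  qed
  also have "\<dots> = B powr (p - 2) * (\<Sum>i\<in>I. (b i)\<^sup>2)" by (simp add: sum_distrib_left)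
  also have "(\<Sum>i\<in>I. (b i)\<^sup>2) = 1 / var"
    using assms var_gt_0 unfolding array_def by (simp add: field_simps)
  finally show ?thesis by simp
qed

lemma prob_scaled_ge_le:
  assumes b: "b > 0" and y: "y > 0"
  shows "\<P>(\<omega> in M. b * \<xi> i \<omega> \<ge> y) \<le> b powr p * mom / y powr p"
proof -
  have "\<P>(\<omega> in M. b * \<xi> i \<omega> \<ge> y) \<le> \<P>(\<omega> in M. \<bar>b * \<xi> i \<omega>\<bar> powr p \<ge> y powr p)"
  proof (intro finite_measure_mono)
    show "{\<omega> \<in> space M. y \<le> b * \<xi> i \<omega>} \<subseteq> {\<omega> \<in> space M. y powr p \<le> \<bar>b * \<xi> i \<omega>\<bar> powr p}"
      using y p by (auto intro!: powr_mono2)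
  qed measurable
  also have "\<dots> \<le> expectation (\<lambda>\<omega>. \<bar>b * \<xi> i \<omega>\<bar> powr p) / y powr p"
    by (rule integral_Markov_inequality_measure[OF scaled(3)[OF b], where A = "{}"]) (use y in auto)
  finally show ?thesis unfolding scaled(4)[OF b] .
qed

text \<open>Count powers of B in units of q = (p - 2)/4: the Lyapunov sum has B^(4q), and \<eta> K =
  q gives exp(x y) \<le> B^(-q), so \<theta> is of order B^(3q). With width \<delta> = B^(q/2) the
  replacement error \<theta>/\<delta>^3 is of order B^(3q/2), which beats the logarithmic factor
  from Mills' ratio. The second claim bounds the event that a summand jumps although the truncated
  rest already reaches x; \<open>one_jump_lower\<close> subtracts it.\<close>

lemma moderate_regime:
  assumes a: "a > 0" and K: "K > 0" and \<epsilon>: "\<epsilon> > 0"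
  defines "\<eta> \<equiv> (p - 2) / (4 * K)"
  shows "\<forall>\<^sub>F B in at_right 0. \<forall>I b x. array I b B \<longrightarrow> a \<le> x \<longrightarrow> x\<^sup>2 \<le> K * ln (1 / B) \<longrightarrow>
     \<bar>tsum_tail b (\<eta> * x) I x - normal_tail x\<bar> \<le> \<epsilon> * normal_tail x \<and>
     (\<Sum>i\<in>I. scaled_tail b i (\<eta> * x) * tsum_tail b (\<eta> * x) (I - {i}) x) \<le> \<epsilon> * normal_tail x"
proof -
  define y0 where "y0 = \<eta> * a"
  have \<eta>: "\<eta> > 0" using p K by (simp add: \<eta>_def)
  have y0: "y0 > 0" using \<eta> a by (simp add: y0_def)
  define q where "q = (p - 2) / 4"
  have q: "q > 0" and q4: "p - 2 = 4 * q" using p by (simp_all add: q_def)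
  have \<eta>K: "\<eta> * K = q" using K by (simp add: \<eta>_def q_def)
  define c0 where "c0 = exp (- 1 - 1 / (2 * a\<^sup>2)) / sqrt (2 * pi)"
  have c0: "c0 > 0" by (simp add: c0_def)
  \<comment> \<open>\<open>mom\<close> is only known to be nonnegative; the limits below are taken
    with a strictly positive constant.\<close>
  define m1 where "m1 = mom + 1"
  have m1: "m1 > 0" using mom_nonneg by (simp add: m1_def)
  define Y where "Y = y0 powr p"
  have Y: "Y > 0" using y0 by (simp add: Y_def)
  define w where "w = sqrt var"
  have w: "w > 0" using var_gt_0 by (simp add: w_def)
  define r where "r = var"
  have r: "r > 0" using var_gt_0 by (simp add: r_def)
  obtain C where C: "C > 0" and main: "swap_bound y0 C"
    by (rule tsum_tail_normal[OF y0])
  \<comment> \<open>In the limits that follow x is replaced by its largest value sqrt(K ln(1/B)). In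
    order they provide: \<open>x * (b i * sqrt var) \<le> 1\<close>; a width \<open>\<delta>\<close>
    below 1 and \<open>a\<close>; \<open>x * \<delta> \<le> 1\<close>; a bounded correction in the
    exponent of \<open>swap_error\<close>; the relative error of the first claim; a bounded
    correction for the sum with one summand removed; the second claim.\<close>
  have ev: "\<forall>\<^sub>F B in at_right 0. f B \<le> e" if "(f \<longlongrightarrow> 0) (at_right 0)" "e > 0" for f :: "real \<Rightarrow> real" and e
    using order_tendstoD(2)[OF that] by (rule eventually_mono) simp
  have "\<forall>\<^sub>F B in at_right 0. B < (1::real)" "\<forall>\<^sub>F B in at_right 0. (0::real) < B"
    by (auto simp: eventually_at_right_less eventually_at_right_field intro: exI[of _ 1])
  moreover have "\<forall>\<^sub>F B in at_right 0. sqrt (K * ln (1 / B)) * (B * w) \<le> 1"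
    by (rule ev) (use K w in real_asymp, simp)
  moreover have "\<forall>\<^sub>F B in at_right 0. B powr (q / 2) \<le> min 1 a"
    by (rule ev) (use q in real_asymp, use a in simp)
  moreover have "\<forall>\<^sub>F B in at_right 0. sqrt (K * ln (1 / B)) * B powr (q / 2) \<le> 1"
    by (rule ev) (use q K in real_asymp, simp)
  moreover have "\<forall>\<^sub>F B in at_right 0. (1 + sqrt (K * ln (1 / B))) ^ 3 * (C * (B powr (3 * q) / r)) \<le> 1"
    by (rule ev) (use q K C r in real_asymp, simp)
  moreover have "\<forall>\<^sub>F B in at_right 0. sqrt (K * ln (1 / B)) / c0 * (B powr (q / 2) * exp 1
      + C / (B powr (q / 2)) ^ 3 * (B powr (3 * q) / r) * exp 2) \<le> \<epsilon>"
    by (rule ev) (use q K C r c0 in real_asymp, rule \<epsilon>)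
  moreover have "\<forall>\<^sub>F B in at_right 0. (1 + sqrt (K * ln (1 / B))) ^ 3 * (8 * m1 * (B powr (3 * q) / r)) \<le> 1"
    by (rule ev) (use q K m1 r in real_asymp, simp)
  moreover have "\<forall>\<^sub>F B in at_right 0. sqrt (K * ln (1 / B)) / c0 * (m1 / Y * (B powr (4 * q) / r) * exp 1) \<le> \<epsilon>"
    by (rule ev) (use q K m1 r c0 Y in real_asymp, rule \<epsilon>)
  ultimately show ?thesis
  proof eventually_elim
    case (elim B)
    define \<delta> where "\<delta> = B powr (q / 2)"
    define \<theta> where "\<theta> = B powr (3 * q) / r"
    define X where "X = sqrt (K * ln (1 / B))"
    note e1 = elim(1,2) and e3 = elim(3)[folded X_def] and e4 = elim(4)[folded \<delta>_def]
      and e5 = elim(5)[folded X_def \<delta>_def] and e6 = elim(6)[folded X_def \<theta>_def]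
      and e7 = elim(7)[folded X_def \<delta>_def \<theta>_def] and e8 = elim(8)[folded X_def \<theta>_def]
      and e9 = elim(9)[folded X_def]
    have \<delta>: "\<delta> > 0" "\<delta> \<le> 1" "\<delta> \<le> a" using e1 e4 by (auto simp: \<delta>_def)
    have \<theta>: "\<theta> > 0" using e1 r by (simp add: \<theta>_def)
    show ?case
    proof (intro allI impI)
      fix I b x
      assume arr: "array I b B" and ax: "a \<le> x" and xK: "x\<^sup>2 \<le> K * ln (1 / B)"
      have x: "x > 0" using a ax by simp
      have xX: "x \<le> X" using xK x unfolding X_def by (simp add: real_le_rsqrt)
      have I: "finite I" "\<And>i. i \<in> I \<Longrightarrow> b i > 0" "\<And>i. i \<in> I \<Longrightarrow> b i \<le> B" "var * (\<Sum>i\<in>I. (b i)\<^sup>2) = 1"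
        using arr unfolding array_def by auto
      have y: "y0 \<le> \<eta> * x" using ax \<eta> by (simp add: y0_def)
      have L: "(\<Sum>i\<in>I. b i powr p) \<le> B powr (4 * q) / r"
        using array_sum_powr[OF arr] q4 by (simp add: r_def)
      have "exp (x * (\<eta> * x)) \<le> B powr (- q)"
      proof -
        have "\<eta> * x\<^sup>2 \<le> \<eta> * (K * ln (1 / B))" using xK \<eta> by (intro mult_left_mono) auto
        also have "\<dots> = - q * ln B" using e1 by (simp add: ln_div mult.assoc[symmetric] \<eta>K)
        finally show ?thesis using e1 by (simp add: powr_def power2_eq_square mult_ac)
      qed
      then have "(\<Sum>i\<in>I. b i powr p) * exp (x * (\<eta> * x)) \<le> (B powr (4 * q) / r) * B powr (- q)"
        using L r by (intro mult_mono sum_nonneg) auto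
      also have "\<dots> = \<theta>" using e1 by (simp add: \<theta>_def powr_add[symmetric])
      finally have th: "(\<Sum>i\<in>I. b i powr p) * exp (x * (\<eta> * x)) \<le> \<theta>" .
      have xb: "x * (b i * sqrt var) \<le> 1" if "i \<in> I" for i
      proof -
        have "x * (b i * sqrt var) \<le> X * (B * w)"
          unfolding w_def[symmetric] using I(2,3)[OF that] xX x w by (intro mult_mono) auto
        then show ?thesis using e3 by simp
      qed
      \<comment> \<open>Passage to relative errors: the factor \<open>X / c0\<close> is only
        logarithmic in 1/B.\<close>
      have lo: "exp (- x\<^sup>2 / 2) \<le> normal_tail x * (X / c0)"
      proof -
        have "c0 * exp (- x\<^sup>2 / 2) / x \<le> normal_tail x"
          unfolding c0_def by (rule normal_tail_lower[OF a ax])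
        then have "exp (- x\<^sup>2 / 2) \<le> normal_tail x * (x / c0)" using x c0 by (simp add: field_simps)
        also have "\<dots> \<le> normal_tail x * (X / c0)"
          using xX c0 normal_tail_pos[of x] by (intro mult_left_mono divide_right_mono) auto
        finally show ?thesis .
      qed
      have xd: "x * \<delta> \<le> 1" using mult_right_mono[OF xX, of \<delta>] \<delta> e5 by linarith
      have xc: "(1 + x) ^ 3 * u \<le> (1 + X) ^ 3 * u" if "u \<ge> 0" for u
        using xX x that by (intro mult_right_mono power_mono) auto
      define err where "err = swap_error C \<delta> \<theta> x"
      have err: "err \<le> exp (- x\<^sup>2 / 2) * (C / \<delta> ^ 3 * \<theta> * exp 2)"
      proof -
        have "exp (- x\<^sup>2 / 2 + x * \<delta> + (1 + x) ^ 3 * (C * \<theta>)) \<le> exp (- x\<^sup>2 / 2) * exp 2"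
        proof -
          have "(1 + x) ^ 3 * (C * \<theta>) \<le> 1"
            by (rule order_trans[OF xc e6]) (use C \<theta> in simp)
          then show ?thesis using xd unfolding mult_exp_exp exp_le_cancel_iff by linarith
        qed
        then have "err \<le> C / \<delta> ^ 3 * \<theta> * (exp (- x\<^sup>2 / 2) * exp 2)"
          unfolding err_def using C \<theta> \<delta> by (intro mult_left_mono) auto
        then show ?thesis by (simp only: mult_ac)
      qed
      have up: "tsum_tail b (\<eta> * x) I x \<le> normal_tail (x - \<delta>) + err"
        and down: "normal_tail (x + \<delta>) - err \<le> tsum_tail b (\<eta> * x) I x"
        unfolding err_def using main[unfolded swap_bound_def, rule_format, OF I(1,2,4) y less_imp_le[OF x] xb \<delta>(1,2) th]
          by simp_all
      have "normal_tail (x - \<delta>) - normal_tail (x - \<delta> + \<delta>) \<le> \<delta> * exp (- (x - \<delta>)\<^sup>2 / 2)"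
        using \<delta> ax by (intro normal_tail_diff_le) auto
      also have "\<dots> \<le> \<delta> * (exp (- x\<^sup>2 / 2) * exp 1)"
      proof -
        have "(x - \<delta>)\<^sup>2 = x\<^sup>2 - 2 * (x * \<delta>) + \<delta>\<^sup>2" by (simp add: power2_eq_square algebra_simps)
        then have "- (x - \<delta>)\<^sup>2 / 2 \<le> - x\<^sup>2 / 2 + 1"
          using xd zero_le_power2[of \<delta>] by linarith
        then have "exp (- (x - \<delta>)\<^sup>2 / 2) \<le> exp (- x\<^sup>2 / 2) * exp 1" by (simp add: exp_add[symmetric])
        then show ?thesis using \<delta> by (intro mult_left_mono) auto
      qed
      finally have t1: "normal_tail (x - \<delta>) \<le> normal_tail x + exp (- x\<^sup>2 / 2) * (\<delta> * exp 1)" by (simp add: mult_ac)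
      have "normal_tail x - normal_tail (x + \<delta>) \<le> \<delta> * exp (- x\<^sup>2 / 2)"
        using \<delta> x by (intro normal_tail_diff_le) auto
      also have "\<dots> \<le> \<delta> * (exp (- x\<^sup>2 / 2) * exp 1)"
        using \<delta> by (intro mult_left_mono) auto
      finally have t2: "normal_tail x - exp (- x\<^sup>2 / 2) * (\<delta> * exp 1) \<le> normal_tail (x + \<delta>)" by (simp add: mult_ac)
      define G where "G = \<delta> * exp 1 + C / \<delta> ^ 3 * \<theta> * exp 2"
      have G0: "G \<ge> 0" unfolding G_def using \<delta> C \<theta> by simp
      have "\<bar>tsum_tail b (\<eta> * x) I x - normal_tail x\<bar> \<le> exp (- x\<^sup>2 / 2) * G"
        using up down err t1 t2 unfolding G_def distrib_left by linarith
      also have "\<dots> \<le> normal_tail x * (X / c0) * G" using lo G0 by (intro mult_right_mono)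
      also have "\<dots> = normal_tail x * (X / c0 * G)" by simp
      also have "\<dots> \<le> normal_tail x * \<epsilon>"
        using e7 normal_tail_pos[of x] unfolding G_def by (intro mult_left_mono) auto
      finally have part1: "\<bar>tsum_tail b (\<eta> * x) I x - normal_tail x\<bar> \<le> \<epsilon> * normal_tail x"
        by (simp add: mult.commute)
      have yp: "\<eta> * x > 0" using \<eta> x by simp
      \<comment> \<open>The sum without \<open>i\<close> no longer has variance 1, so a Chernoff
        bound at s = x replaces the normal comparison. It loses about a factor x, which is
        affordable since the jump probability supplies B^(4q).\<close>
      have rest: "tsum_tail b (\<eta> * x) (I - {i}) x \<le> exp (- x\<^sup>2 / 2) * exp 1" for i
      proof -
        let ?J = "I - {i}"
        have J: "finite ?J" "\<And>j. j \<in> ?J \<Longrightarrow> b j > 0" using I by auto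
        have x0: "0 \<le> x" using x by simp
        note mg = mgf_tsum_moderate[OF J yp x0]
        have s1: "var * (\<Sum>j\<in>?J. (b j)\<^sup>2) \<le> 1"
          unfolding I(4)[symmetric] using I(1) var_gt_0 by (intro mult_left_mono sum_mono2) auto
        have "(\<Sum>j\<in>?J. b j powr p) * exp (x * (\<eta> * x)) \<le> (\<Sum>j\<in>I. b j powr p) * exp (x * (\<eta> * x))"
          using I(1) by (intro mult_right_mono sum_mono2) auto
        then have s2: "(\<Sum>j\<in>?J. b j powr p) * exp (x * (\<eta> * x)) \<le> \<theta>" using th by (rule order_trans)
        have "8 * mom * ((\<Sum>j\<in>?J. b j powr p) * exp (x * (\<eta> * x))) \<le> 8 * m1 * \<theta>"
          using s2 mom_nonneg by (intro mult_mono mult_nonneg_nonneg sum_nonneg) (auto simp: m1_def)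
        then have "(1 + x) ^ 3 * (8 * mom * ((\<Sum>j\<in>?J. b j powr p) * exp (x * (\<eta> * x)))) \<le> (1 + x) ^ 3 * (8 * m1 * \<theta>)"
          using x by (intro mult_left_mono) auto
        also have "\<dots> \<le> 1" by (rule order_trans[OF xc e8]) (use m1 \<theta> in simp)
        finally have s3: "(1 + x) ^ 3 * (8 * mom * ((\<Sum>j\<in>?J. b j powr p) * exp (x * (\<eta> * x)))) \<le> 1" .
        have s4: "x\<^sup>2 / 2 * (var * (\<Sum>j\<in>?J. (b j)\<^sup>2)) \<le> x\<^sup>2 / 2 * 1"
          using s1 by (intro mult_left_mono) auto
        have "tsum_tail b (\<eta> * x) ?J x \<le> exp (- (x * x)) * expectation (\<lambda>\<omega>. exp (x * tsum b (\<eta> * x) ?J \<omega>))"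
          by (rule Chernoff_bound[OF tsum_measurable mg(1) x0])
        also have "\<dots> \<le> exp (- (x * x)) * exp (x\<^sup>2 / 2 + 1)"
        proof (rule mult_left_mono[OF order_trans[OF mg(2)]])
          show "exp (x\<^sup>2 / 2 * (var * (\<Sum>j\<in>?J. (b j)\<^sup>2)) + (1 + x) ^ 3 * (8 * mom * ((\<Sum>j\<in>?J. b j powr p) * exp (x * (\<eta> * x)))))
              \<le> exp (x\<^sup>2 / 2 + 1)"
            using s3 s4 unfolding exp_le_cancel_iff by linarith
        qed auto
        also have "\<dots> = exp (- x\<^sup>2 / 2) * exp 1"
          unfolding mult_exp_exp by (rule arg_cong[where f = exp]) (simp add: power2_eq_square)
        finally show ?thesis .
      qed
      have "(\<Sum>i\<in>I. scaled_tail b i (\<eta> * x) * tsum_tail b (\<eta> * x) (I - {i}) x)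
          \<le> (\<Sum>i\<in>I. (b i powr p * (m1 / Y)) * (exp (- x\<^sup>2 / 2) * exp 1))"
      proof (intro sum_mono mult_mono rest)
        fix i assume "i \<in> I"
        have "scaled_tail b i (\<eta> * x) \<le> b i powr p * mom / (\<eta> * x) powr p"
          by (rule prob_scaled_ge_le[OF I(2)[OF \<open>i \<in> I\<close>] yp])
        also have "\<dots> \<le> b i powr p * m1 / Y"
          unfolding Y_def using mom_nonneg y y0 p
          by (intro frac_le mult_left_mono powr_mono2) (auto simp: m1_def)
        finally show "scaled_tail b i (\<eta> * x) \<le> b i powr p * (m1 / Y)" by simp
      qed (use m1 Y in auto)
      also have "\<dots> = (\<Sum>i\<in>I. b i powr p) * (m1 / Y * exp 1 * exp (- x\<^sup>2 / 2))"
        unfolding sum_distrib_right by (intro sum.cong) auto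
      also have "\<dots> \<le> (B powr (4 * q) / r) * (m1 / Y * exp 1 * (normal_tail x * (X / c0)))"
        using L lo m1 Y r normal_tail_pos[of x] by (intro mult_mono mult_nonneg_nonneg) auto
      also have "\<dots> = normal_tail x * (X / c0 * (m1 / Y * (B powr (4 * q) / r) * exp 1))" by (simp add: mult_ac)
      also have "\<dots> \<le> normal_tail x * \<epsilon>"
        using e9 normal_tail_pos[of x] by (intro mult_left_mono) auto
      finally have part2: "(\<Sum>i\<in>I. scaled_tail b i (\<eta> * x) * tsum_tail b (\<eta> * x) (I - {i}) x) \<le> \<epsilon> * normal_tail x"
        by (simp add: mult.commute)
      from part1 part2 show "\<bar>tsum_tail b (\<eta> * x) I x - normal_tail x\<bar> \<le> \<epsilon> * normal_tail x \<and>
        (\<Sum>i\<in>I. scaled_tail b i (\<eta> * x) * tsum_tail b (\<eta> * x) (I - {i}) x) \<le> \<epsilon> * normal_tail x"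
        by (rule conjI)
    qed
  qed
qed

text \<open>With s y = U and y = \<eta> x, half of the Chernoff exponent, s x / 2, equals (T + 1) U
  / (p - 2) by the choice of \<eta>; as U = p ln x + (p - 2) ln(1/B), this yields (B/x)^(T+1). The
  other half pays for the quadratic term.\<close>

lemma large_regime:
  assumes T: "T > 0"
  defines "\<eta> \<equiv> (p - 2) / (2 * (T + 1))"
  obtains K C where "K > 0" "C > 0"
    "\<forall>\<^sub>F B in at_right 0. \<forall>I b x. array I b B \<longrightarrow> 0 < x \<longrightarrow> K * ln (1 / B) \<le> x\<^sup>2 \<longrightarrow>
       1 \<le> x \<and> tsum_tail b (\<eta> * x) I x \<le> C * (B / x) powr (T + 1) \<and>
       normal_tail x \<le> C * (B / x) powr (T + 1)"
proof -
  have \<eta>: "\<eta> > 0" using p T by (simp add: \<eta>_def)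
  define E where "E = exp p"
  have E: "E > 0" by (simp add: E_def)
  \<comment> \<open>The first bound on \<open>K\<close> gives \<open>exp p * s \<le> x / 2\<close> for the exponent \<open>s\<close> below, the second one
    makes the normal tail negligible.\<close>
  define K where "K = max (4 * E * (p - 2) / \<eta>) (4 * (T + 1))"
  have K: "K > 0" using T by (simp add: K_def)
  \<comment> \<open>For the exponent \<open>s\<close> chosen below, the moment term of the
    generating function bound reduces to the constant
    \<open>mom / var / \<eta> powr p\<close>.\<close>
  define C where "C = max 1 (exp (mom / var / \<eta> powr p))"
  have "\<forall>\<^sub>F x in at_top. 2 * E * p * ln x \<le> \<eta> / 2 * x\<^sup>2"
    using E p \<eta> by real_asymp
  moreover have "\<forall>\<^sub>F x in at_top. (T + 1) * ln x \<le> x\<^sup>2 / 4"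
    using T by real_asymp
  moreover have "\<forall>\<^sub>F x::real in at_top. exp 1 \<le> x" by (rule eventually_ge_at_top)
  ultimately have "\<forall>\<^sub>F x in at_top. 2 * E * p * ln x \<le> \<eta> / 2 * x\<^sup>2 \<and> (T + 1) * ln x \<le> x\<^sup>2 / 4 \<and> exp 1 \<le> x"
    by eventually_elim auto
  then obtain X1 where X1: "\<And>x. x \<ge> X1 \<Longrightarrow> 2 * E * p * ln x \<le> \<eta> / 2 * x\<^sup>2 \<and> (T + 1) * ln x \<le> x\<^sup>2 / 4 \<and> exp 1 \<le> x"
    unfolding eventually_at_top_linorder by blast
  define X2 where "X2 = max X1 0"
  \<comment> \<open>Since x^2 \<ge> K ln(1/B), small B forces x beyond the threshold
    \<open>X1\<close>.\<close>
  have "filterlim (\<lambda>B. K * ln (1 / B)) at_top (at_right 0)" using K by real_asymp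
  then have ev3: "\<forall>\<^sub>F B in at_right 0. X2\<^sup>2 \<le> K * ln (1 / B)" by (simp add: filterlim_at_top)
  have ev12: "\<forall>\<^sub>F B in at_right 0. B < (1::real)" "\<forall>\<^sub>F B in at_right 0. (0::real) < B"
    by (auto simp: eventually_at_right_less eventually_at_right_field intro: exI[of _ 1])
  show thesis
  proof (rule that[OF K, of C])
    show C: "C > 0" by (simp add: C_def)
    show "\<forall>\<^sub>F B in at_right 0. \<forall>I b x. array I b B \<longrightarrow> 0 < x \<longrightarrow> K * ln (1 / B) \<le> x\<^sup>2 \<longrightarrow>
       1 \<le> x \<and> tsum_tail b (\<eta> * x) I x \<le> C * (B / x) powr (T + 1) \<and>
       normal_tail x \<le> C * (B / x) powr (T + 1)"
      using ev12 ev3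
    proof eventually_elim
      case (elim B)
      note B = elim(1,2)
      show ?case
      proof (intro allI impI)
        fix I b x
        assume arr: "array I b B" and x: "0 < x" and xK: "K * ln (1 / B) \<le> x\<^sup>2"
        have I: "finite I" "\<And>i. i \<in> I \<Longrightarrow> b i > 0" "var * (\<Sum>i\<in>I. (b i)\<^sup>2) = 1"
          using arr unfolding array_def by auto
        have "X2\<^sup>2 \<le> x\<^sup>2" using elim(3) xK by (rule order_trans)
        then have "X2 \<le> x" by (rule power2_le_imp_le) (use x in simp)
        then have "X1 \<le> x" by (simp add: X2_def)
        from X1[OF this] have xe: "2 * E * p * ln x \<le> \<eta> / 2 * x\<^sup>2" "(T + 1) * ln x \<le> x\<^sup>2 / 4" "exp 1 \<le> x" by auto
        have x1: "1 \<le> x" using xe(3) exp_ge_add_one_self[of "1::real"] by linarith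
        have lnx: "1 \<le> ln x" using xe(3) x ln_le_cancel_iff[of "exp 1" x] by simp
        define l where "l = ln (1 / B)"
        have l: "l > 0" "ln B = - l" using B by (simp_all add: l_def ln_div)
        \<comment> \<open>\<open>s\<close> balances the two terms of the exponential bound: \<open>exp (s * y) = x powr p / B powr (p - 2)\<close>.\<close>
        define U where "U = p * ln x + (p - 2) * l"
        have Up: "U \<ge> p"
        proof -
          have "p * 1 \<le> p * ln x" using lnx p by (intro mult_left_mono) auto
          moreover have "0 \<le> (p - 2) * l" using p l by simp
          ultimately show ?thesis unfolding U_def by linarith
        qed
        have expU: "exp U = x powr p * B powr (- (p - 2))"
          using x B l by (simp add: U_def powr_def mult_exp_exp algebra_simps)
        define y where "y = \<eta> * x"
        have y: "y > 0" using \<eta> x by (simp add: y_def)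
        define s where "s = U / y"
        have s: "s \<ge> 0" using Up p y by (simp add: s_def)
        have sy: "s * y = U" using y by (simp add: s_def)
        have sx: "E * s \<le> x / 2"
        proof -
          have "2 * E * (p - 2) * l * 2 \<le> \<eta> * (K * l)"
          proof -
            have "4 * E * (p - 2) / \<eta> \<le> K" by (simp add: K_def)
            then have "4 * E * (p - 2) \<le> \<eta> * K" using \<eta> by (simp add: field_simps)
            then have "4 * E * (p - 2) * l \<le> \<eta> * K * l" using l by (intro mult_right_mono) auto
            then show ?thesis by (simp add: mult_ac)
          qed
          also have "\<dots> \<le> \<eta> * x\<^sup>2" using xK \<eta> by (intro mult_left_mono) (auto simp: l_def)
          finally have "2 * E * U \<le> \<eta> * x\<^sup>2"
            using xe(1) unfolding U_def by (simp add: algebra_simps)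
          then show ?thesis using x \<eta> by (simp add: s_def y_def field_simps power2_eq_square)
        qed
        have "tsum_tail b y I x \<le> exp (- (s * x)) * expectation (\<lambda>\<omega>. exp (s * tsum b y I \<omega>))"
          by (rule Chernoff_bound[OF tsum_measurable mgf_tsum_moderate(1)[OF I(1,2) y s] s])
        also have "\<dots> \<le> exp (- (s * x)) * exp (E * s\<^sup>2 * 1 + exp U / y powr p * (mom * (B powr (p - 2) / var)))"
        proof (intro mult_left_mono order_trans[OF mgf_tsum_large[OF I(1,2) y s]])
          show "p \<le> s * y" using Up sy by simp
          show "exp (exp p * s\<^sup>2 * (var * (\<Sum>i\<in>I. (b i)\<^sup>2)) + exp (s * y) / y powr p * (mom * (\<Sum>i\<in>I. b i powr p)))
            \<le> exp (E * s\<^sup>2 * 1 + exp U / y powr p * (mom * (B powr (p - 2) / var)))"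
            unfolding I(3) sy E_def exp_le_cancel_iff
            using array_sum_powr[OF arr] mom_nonneg by (intro add_left_mono mult_left_mono) auto
        qed auto
        also have "exp U / y powr p * (mom * (B powr (p - 2) / var)) = mom / var / \<eta> powr p"
        proof -
          have "B powr (p - 2) * B powr (2 - p) = 1" using B by (simp flip: powr_add)
          then show ?thesis using x \<eta> B by (simp add: expU y_def powr_mult field_simps)
        qed
        also have "exp (- (s * x)) * exp (E * s\<^sup>2 * 1 + mom / var / \<eta> powr p)
            = exp (- (s * x) + E * s\<^sup>2) * exp (mom / var / \<eta> powr p)"
          by (simp add: mult_exp_exp)
        also have "\<dots> \<le> exp (- (s * x) / 2) * C"
        proof (intro mult_mono)
          have "E * s\<^sup>2 = (E * s) * s" by (simp add: power2_eq_square)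
          also have "\<dots> \<le> x / 2 * s" using sx s by (intro mult_right_mono)
          finally show "exp (- (s * x) + E * s\<^sup>2) \<le> exp (- (s * x) / 2)" by (simp add: mult_ac)
        qed (auto simp: C_def)
        also have "exp (- (s * x) / 2) \<le> (B / x) powr (T + 1)"
        proof -
          have "s * x / 2 = (T + 1) / (p - 2) * U"
            using x \<eta> p T by (simp add: s_def y_def \<eta>_def field_simps)
          also have "\<dots> = (T + 1) / (p - 2) * p * ln x + (T + 1) * l"
            using p by (simp add: U_def field_simps)
          also have "\<dots> \<ge> (T + 1) * 1 * ln x + (T + 1) * l"
          proof -
            have "1 \<le> p / (p - 2)" using p by simp
            then have "(T + 1) * 1 * ln x \<le> (T + 1) * (p / (p - 2)) * ln x"
              using T lnx by (intro mult_right_mono mult_left_mono) auto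
            then show ?thesis by simp
          qed
          finally have "- (s * x) / 2 \<le> (T + 1) * (ln B - ln x)"
            using l by (simp add: algebra_simps)
          then show ?thesis using B x by (simp add: powr_def ln_div)
        qed
        then have "exp (- (s * x) / 2) * C \<le> C * (B / x) powr (T + 1)"
          using C by (simp add: mult.commute)
        finally have 1: "tsum_tail b (\<eta> * x) I x \<le> C * (B / x) powr (T + 1)" by (simp add: y_def)
        have "normal_tail x \<le> exp (- x\<^sup>2 / 2)" using x by (intro normal_tail_upper) simp
        also have "\<dots> \<le> (B / x) powr (T + 1)"
        proof -
          have "4 * (T + 1) * l \<le> K * l" using l by (intro mult_right_mono) (auto simp: K_def)
          also have "\<dots> \<le> x\<^sup>2" using xK by (simp add: l_def)
          finally have "- x\<^sup>2 / 2 \<le> (T + 1) * (ln B - ln x)"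
            using xe(2) l by (simp add: algebra_simps)
          then show ?thesis using B x by (simp add: powr_def ln_div)
        qed
        also have "\<dots> \<le> C * (B / x) powr (T + 1)" by (simp add: C_def mult_le_cancel_right1)
        finally have 2: "normal_tail x \<le> C * (B / x) powr (T + 1)" .
        from x1 1 2 show "1 \<le> x \<and> tsum_tail b (\<eta> * x) I x \<le> C * (B / x) powr (T + 1) \<and>
          normal_tail x \<le> C * (B / x) powr (T + 1)" by simp
      qed
    qed
  qed
qed

end

section \<open>The one-jump principle\<close>

text \<open>A Bonferroni inequality in which the sum over pairs is enlarged to a full square: adding
  \<open>j\<close> costs g j times the sum of the others, half of the new cross term.\<close>

lemma (in prob_space) prob_UN_ge:
  fixes g :: "'i \<Rightarrow> real"
  assumes "finite I" and "\<And>i. i \<in> I \<Longrightarrow> E i \<in> events" and "\<And>i. i \<in> I \<Longrightarrow> 0 \<le> g i"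
    and "\<And>i j. i \<in> I \<Longrightarrow> j \<in> I \<Longrightarrow> i \<noteq> j \<Longrightarrow> prob (E i \<inter> E j) \<le> g i * g j"
  shows "(\<Sum>i\<in>I. prob (E i)) - (\<Sum>i\<in>I. g i)\<^sup>2 \<le> prob (\<Union>i\<in>I. E i)"
  using assms
proof (induction I rule: finite_induct)
  case (insert j I)
  let ?U = "\<Union>i\<in>I. E i" and ?G = "\<Sum>i\<in>I. g i"
  have ev: "?U \<in> events" "E j \<in> events" using insert by auto
  have eq: "E j \<inter> ?U = (\<Union>i\<in>I. E j \<inter> E i)" by blast
  have "prob (E j \<inter> ?U) \<le> (\<Sum>i\<in>I. prob (E j \<inter> E i))"
    unfolding eq using insert.hyps(1) insert.prems(1) by (intro finite_measure_subadditive_finite) auto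
  also have "\<dots> \<le> (\<Sum>i\<in>I. g j * g i)"
    using insert.prems(3) insert.hyps by (intro sum_mono) auto
  also have "\<dots> = g j * ?G" by (simp add: sum_distrib_left)
  finally have 1: "prob (E j \<inter> ?U) \<le> g j * ?G" .
  have 2: "prob (E j \<union> ?U) = prob (E j) + prob ?U - prob (E j \<inter> ?U)"
    using finite_measure_Union'[OF ev(2,1)] finite_measure_Diff'[OF ev] by (simp add: Int_commute)
  have 3: "(\<Sum>i\<in>I. prob (E i)) - ?G\<^sup>2 \<le> prob ?U" by (rule insert.IH) (use insert.prems in auto)
  have 4: "0 \<le> g j * ?G" "0 \<le> (g j)\<^sup>2" using insert.prems(2) by (auto intro!: mult_nonneg_nonneg sum_nonneg)
  have "(g j + ?G)\<^sup>2 = (g j)\<^sup>2 + 2 * (g j * ?G) + ?G\<^sup>2" by (simp add: power2_eq_square algebra_simps)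
  moreover have "(\<Sum>i\<in>insert j I. prob (E i)) = prob (E j) + (\<Sum>i\<in>I. prob (E i))"
    "(\<Sum>i\<in>insert j I. g i) = g j + ?G" "(\<Union>i\<in>insert j I. E i) = E j \<union> ?U"
    using insert.hyps by auto
  ultimately show ?case using 1 2 3 4 by (simp only:)
qed simp

context iid_array
begin

lemma indep_sum:
  assumes J: "finite J" "i \<notin> J" and g: "\<And>j. g j \<in> borel_measurable borel"
  shows "indep_var borel (\<xi> i) borel (\<lambda>\<omega>. \<Sum>j\<in>J. (g j (\<xi> j \<omega>) :: real))"
proof -
  \<comment> \<open>The identity at \<open>i\<close> and the maps \<open>g j\<close> elsewhere form
    one family, so a single composition with \<open>indep\<close> covers both variables.\<close>
  define h where "h = (\<lambda>j. if j = i then (\<lambda>u. u) else g j)"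
  have "indep_vars (\<lambda>_. borel) (\<lambda>j \<omega>. h j (\<xi> j \<omega>)) (insert i J)"
    by (rule indep_vars_compose2[OF indep_vars_subset[OF indep]]) (auto simp: h_def g)
  from indep_vars_sum[OF J this]
  have "indep_var borel (\<xi> i) borel (\<lambda>\<omega>. \<Sum>j\<in>J. h j (\<xi> j \<omega>))" by (simp add: h_def)
  moreover have "(\<Sum>j\<in>J. h j (\<xi> j \<omega>)) = (\<Sum>j\<in>J. g j (\<xi> j \<omega>))" for \<omega>
    using J by (intro sum.cong) (auto simp: h_def)
  ultimately show ?thesis by simp
qed

lemma prob_indep_sum:
  assumes J: "finite J" "i \<notin> J" and g: "\<And>j. g j \<in> borel_measurable borel"
    and A: "A \<in> sets borel" and B: "B \<in> sets borel"
  shows "\<P>(\<omega> in M. \<xi> i \<omega> \<in> A \<and> (\<Sum>j\<in>J. (g j (\<xi> j \<omega>) :: real)) \<in> B)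
       = \<P>(\<omega> in M. \<xi> i \<omega> \<in> A) * \<P>(\<omega> in M. (\<Sum>j\<in>J. g j (\<xi> j \<omega>)) \<in> B)"
proof -
  have "prob ((\<lambda>\<omega>. (\<xi> i \<omega>, \<Sum>j\<in>J. g j (\<xi> j \<omega>))) -` (A \<times> B) \<inter> space M)
      = prob (\<xi> i -` A \<inter> space M) * prob ((\<lambda>\<omega>. \<Sum>j\<in>J. g j (\<xi> j \<omega>)) -` B \<inter> space M)"
    by (rule indep_varD[OF indep_sum[OF J g] A B])
  moreover have "(\<lambda>\<omega>. (\<xi> i \<omega>, \<Sum>j\<in>J. g j (\<xi> j \<omega>))) -` (A \<times> B) \<inter> space M
      = {\<omega> \<in> space M. \<xi> i \<omega> \<in> A \<and> (\<Sum>j\<in>J. g j (\<xi> j \<omega>)) \<in> B}" by auto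
  moreover have "\<xi> i -` A \<inter> space M = {\<omega> \<in> space M. \<xi> i \<omega> \<in> A}"
    "(\<lambda>\<omega>. \<Sum>j\<in>J. g j (\<xi> j \<omega>)) -` B \<inter> space M = {\<omega> \<in> space M. (\<Sum>j\<in>J. g j (\<xi> j \<omega>)) \<in> B}" by auto
  ultimately show ?thesis by simp
qed

definition wsum :: "('i \<Rightarrow> real) \<Rightarrow> 'i set \<Rightarrow> 'a \<Rightarrow> real" where
  "wsum b J \<omega> = (\<Sum>i\<in>J. b i * \<xi> i \<omega>)"

lemma wsum_measurable[measurable]: "random_variable borel (wsum b J)"
  unfolding wsum_def[abs_def] by measurable

lemma wsum_second_moment:
  assumes "finite J" "\<And>i. i \<in> J \<Longrightarrow> b i > 0"
  shows "integrable M (\<lambda>\<omega>. (wsum b J \<omega>)\<^sup>2) \<and> integrable M (wsum b J) \<and> expectation (wsum b J) = 0 \<and>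
    expectation (\<lambda>\<omega>. (wsum b J \<omega>)\<^sup>2) = var * (\<Sum>i\<in>J. (b i)\<^sup>2)"
  using assms
proof (induction J rule: finite_induct)
  case empty
  then show ?case by (simp add: wsum_def[abs_def])
next
  case (insert j J)
  let ?X = "\<lambda>\<omega>. b j * \<xi> j \<omega>"
  have bj: "b j > 0" using insert.prems by simp
  note X = scaled[OF bj, of j]
  have IH: "integrable M (\<lambda>\<omega>. (wsum b J \<omega>)\<^sup>2)" "integrable M (wsum b J)" "expectation (wsum b J) = 0"
    "expectation (\<lambda>\<omega>. (wsum b J \<omega>)\<^sup>2) = var * (\<Sum>i\<in>J. (b i)\<^sup>2)"
    using insert.IH insert.prems by auto
  have "indep_var borel ?X borel (\<lambda>\<omega>. \<Sum>i\<in>J. b i * \<xi> i \<omega>)"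
    by (rule indep_vars_sum[OF insert.hyps indep_scaled])
  then have ind: "indep_var borel ?X borel (wsum b J)" by (simp add: wsum_def[abs_def])
  note cross = indep_var_integrable[OF ind X(1) IH(2)] indep_var_lebesgue_integral[OF ind X(1) IH(2)]
  have w: "wsum b (insert j J) = (\<lambda>\<omega>. ?X \<omega> + wsum b J \<omega>)"
    using insert.hyps by (simp add: wsum_def[abs_def])
  have sq: "(?X \<omega> + wsum b J \<omega>)\<^sup>2 = (?X \<omega>)\<^sup>2 + 2 * (?X \<omega> * wsum b J \<omega>) + (wsum b J \<omega>)\<^sup>2" for \<omega>
    by (simp add: power2_eq_square algebra_simps)
  have i1: "integrable M (\<lambda>\<omega>. (?X \<omega>)\<^sup>2 + 2 * (?X \<omega> * wsum b J \<omega>))"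
    by (intro Bochner_Integration.integrable_add integrable_mult_right X(6) cross(1))
  have e1: "expectation (\<lambda>\<omega>. (?X \<omega>)\<^sup>2 + 2 * (?X \<omega> * wsum b J \<omega>) + (wsum b J \<omega>)\<^sup>2)
      = (b j)\<^sup>2 * var + 2 * 0 + var * (\<Sum>i\<in>J. (b i)\<^sup>2)"
    unfolding Bochner_Integration.integral_add[OF i1 IH(1)]
      Bochner_Integration.integral_add[OF X(6) integrable_mult_right[OF cross(1)]]
      integral_mult_right_zero cross(2) X(2,5) IH(3,4) by simp
  have "(\<Sum>i\<in>insert j J. (b i)\<^sup>2) = (b j)\<^sup>2 + (\<Sum>i\<in>J. (b i)\<^sup>2)"
    using insert.hyps by simp
  then have e2: "expectation (\<lambda>\<omega>. (wsum b (insert j J) \<omega>)\<^sup>2) = var * (\<Sum>i\<in>insert j J. (b i)\<^sup>2)"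
    unfolding w sq e1 by (simp add: algebra_simps)
  have i2: "integrable M (\<lambda>\<omega>. (wsum b (insert j J) \<omega>)\<^sup>2)"
    unfolding w sq by (rule Bochner_Integration.integrable_add[OF i1 IH(1)])
  have i3: "integrable M (wsum b (insert j J))"
    unfolding w by (rule Bochner_Integration.integrable_add[OF X(1) IH(2)])
  have "expectation (wsum b (insert j J)) = 0"
    unfolding w Bochner_Integration.integral_add[OF X(1) IH(2)] X(2) IH(3) by simp
  with e2 i2 i3 show ?case by blast
qed

text \<open>A variance of at most 1 is allowed for rows from which the jumping summand has been
  removed.\<close>

lemma wsum_Chebyshev:
  assumes "finite J" "\<And>i. i \<in> J \<Longrightarrow> b i > 0" and "var * (\<Sum>i\<in>J. (b i)\<^sup>2) \<le> 1" and "r > 0"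
  shows "\<P>(\<omega> in M. \<bar>wsum b J \<omega>\<bar> \<ge> r) \<le> 1 / r\<^sup>2"
proof -
  note sm = wsum_second_moment[OF assms(1,2)]
  have "\<P>(\<omega> in M. \<bar>wsum b J \<omega>\<bar> \<ge> r) \<le> expectation (\<lambda>\<omega>. (wsum b J \<omega>)\<^sup>2) / r\<^sup>2"
    by (rule second_moment_method[OF wsum_measurable _ assms(4)]) (use sm in auto)
  also have "\<dots> \<le> 1 / r\<^sup>2" using sm assms(3) by (intro divide_right_mono) auto
  finally show ?thesis .
qed

text \<open>This is A(x) of the overview. Using the copy \<open>\<xi> i\<close> in the term
  \<open>i\<close> makes the terms literally the jump probabilities of the summands.\<close>

definition tails :: "('i \<Rightarrow> real) \<Rightarrow> 'i set \<Rightarrow> real \<Rightarrow> real" where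
  "tails b I x = (\<Sum>i\<in>I. \<P>(\<omega> in M. b i * \<xi> i \<omega> \<ge> x))"

text \<open>Either the jumping summand itself reaches (1 - e) x, or it exceeds \<eta> x and the
  independent rest contributes e x, which has probability at most 1/(e x)^2.\<close>

abbreviation jump_upper_term :: "('i \<Rightarrow> real) \<Rightarrow> 'i set \<Rightarrow> real \<Rightarrow> real \<Rightarrow> real \<Rightarrow> real" where
  "jump_upper_term b I e \<eta> x \<equiv> tails b I ((1 - e) * x) + tails b I (\<eta> * x) / (e * x)\<^sup>2"

text \<open>A jump past (1 + e) x with the rest above -e x; the square is the loss from several
  simultaneous jumps.\<close>

abbreviation jump_lower_term :: "('i \<Rightarrow> real) \<Rightarrow> 'i set \<Rightarrow> real \<Rightarrow> real \<Rightarrow> real" where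
  "jump_lower_term b I e x \<equiv> tails b I ((1 + e) * x) * (1 - 1 / (e * x)\<^sup>2) - (tails b I ((1 + e) * x))\<^sup>2"

abbreviation wsum_tail :: "('i \<Rightarrow> real) \<Rightarrow> 'i set \<Rightarrow> real \<Rightarrow> real" where
  "wsum_tail b I x \<equiv> \<P>(\<omega> in M. wsum b I \<omega> \<ge> x)"

lemma tails_nonneg: "tails b I x \<ge> 0"
  unfolding tails_def by (intro sum_nonneg) auto

lemma one_jump_upper:
  assumes arr: "array I b B" and x: "x > 0" and e: "0 < e" and \<eta>: "\<eta> > 0"
  shows "wsum_tail b I x \<le> tsum_tail b (\<eta> * x) I x
     + (jump_upper_term b I e \<eta> x)"
proof -
  have I: "finite I" "\<And>i. i \<in> I \<Longrightarrow> b i > 0" "var * (\<Sum>i\<in>I. (b i)\<^sup>2) = 1"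
    using arr unfolding array_def by auto
  define A where "A = {\<omega> \<in> space M. tsum b (\<eta> * x) I \<omega> \<ge> x}"
  define P where "P = (\<lambda>i. {\<omega> \<in> space M. b i * \<xi> i \<omega> \<ge> (1 - e) * x})"
  define Q where "Q = (\<lambda>i. {\<omega> \<in> space M. b i * \<xi> i \<omega> \<ge> \<eta> * x \<and> wsum b (I - {i}) \<omega> \<ge> e * x})"
  have meas: "A \<in> events" "P i \<in> events" "Q i \<in> events" for i
    unfolding A_def P_def Q_def by measurable
  have UN: "(\<Union>i\<in>I. P i) \<in> events" "(\<Union>i\<in>I. Q i) \<in> events"
    by (intro sets.finite_UN I(1) meas)+
  have sub: "{\<omega> \<in> space M. wsum b I \<omega> \<ge> x} \<subseteq> A \<union> ((\<Union>i\<in>I. P i) \<union> (\<Union>i\<in>I. Q i))"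
  proof
    fix \<omega> assume w: "\<omega> \<in> {\<omega> \<in> space M. wsum b I \<omega> \<ge> x}"
    show "\<omega> \<in> A \<union> ((\<Union>i\<in>I. P i) \<union> (\<Union>i\<in>I. Q i))"
    proof (cases "\<exists>i\<in>I. b i * \<xi> i \<omega> > \<eta> * x")
      case True
      then obtain i where i: "i \<in> I" "b i * \<xi> i \<omega> > \<eta> * x" by blast
      have "wsum b I \<omega> = b i * \<xi> i \<omega> + wsum b (I - {i}) \<omega>"
        unfolding wsum_def using I(1) i(1) by (rule sum.remove)
      then have "b i * \<xi> i \<omega> \<ge> (1 - e) * x \<or> wsum b (I - {i}) \<omega> \<ge> e * x"
        using w by (auto simp: algebra_simps)
      then show ?thesis using i w by (auto simp: P_def Q_def)
    next
      case False
      then have "tsum b (\<eta> * x) I \<omega> = wsum b I \<omega>"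
        unfolding tsum_def wsum_def by (intro sum.cong) (auto simp: trunc_def)
      then show ?thesis using w by (simp add: A_def)
    qed
  qed
  have Q: "prob (Q i) \<le> scaled_tail b i (\<eta> * x) * (1 / (e * x)\<^sup>2)" if "i \<in> I" for i
  proof -
    have "prob (Q i) = \<P>(\<omega> in M. \<xi> i \<omega> \<in> {u. b i * u \<ge> \<eta> * x} \<and> (\<Sum>j\<in>I - {i}. b j * \<xi> j \<omega>) \<in> {e * x..})"
      unfolding Q_def wsum_def by (rule arg_cong[where f = prob]) auto
    also have "\<dots> = \<P>(\<omega> in M. \<xi> i \<omega> \<in> {u. b i * u \<ge> \<eta> * x}) * \<P>(\<omega> in M. (\<Sum>j\<in>I - {i}. b j * \<xi> j \<omega>) \<in> {e * x..})"
      by (rule prob_indep_sum) (use I in auto)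
    also have "\<dots> \<le> scaled_tail b i (\<eta> * x) * (1 / (e * x)\<^sup>2)"
    proof (intro mult_mono)
      have "\<P>(\<omega> in M. (\<Sum>j\<in>I - {i}. b j * \<xi> j \<omega>) \<in> {e * x..}) \<le> \<P>(\<omega> in M. \<bar>wsum b (I - {i}) \<omega>\<bar> \<ge> e * x)"
      proof (intro finite_measure_mono)
        show "{\<omega> \<in> space M. (\<Sum>j\<in>I - {i}. b j * \<xi> j \<omega>) \<in> {e * x..}} \<subseteq> {\<omega> \<in> space M. e * x \<le> \<bar>wsum b (I - {i}) \<omega>\<bar>}"
          by (auto simp: wsum_def)
      qed measurable
      also have "\<dots> \<le> 1 / (e * x)\<^sup>2"
      proof (rule wsum_Chebyshev)
        show "var * (\<Sum>i\<in>I - {i}. (b i)\<^sup>2) \<le> 1"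
          unfolding I(3)[symmetric] using I(1) var_gt_0 by (intro mult_left_mono sum_mono2) auto
      qed (use I e x in auto)
      finally show "\<P>(\<omega> in M. (\<Sum>j\<in>I - {i}. b j * \<xi> j \<omega>) \<in> {e * x..}) \<le> 1 / (e * x)\<^sup>2" .
    qed auto
    finally show ?thesis .
  qed
  have "wsum_tail b I x \<le> prob (A \<union> ((\<Union>i\<in>I. P i) \<union> (\<Union>i\<in>I. Q i)))"
    by (intro finite_measure_mono sub sets.Un meas UN)
  also have "\<dots> \<le> prob A + prob ((\<Union>i\<in>I. P i) \<union> (\<Union>i\<in>I. Q i))"
    by (intro measure_Un_le sets.Un meas UN)
  also have "\<dots> \<le> prob A + (prob (\<Union>i\<in>I. P i) + prob (\<Union>i\<in>I. Q i))"
    by (intro add_left_mono measure_Un_le UN)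
  also have "prob (\<Union>i\<in>I. P i) \<le> (\<Sum>i\<in>I. prob (P i))"
    using meas I(1) by (intro finite_measure_subadditive_finite) auto
  also have "prob (\<Union>i\<in>I. Q i) \<le> (\<Sum>i\<in>I. prob (Q i))"
    using meas I(1) by (intro finite_measure_subadditive_finite) auto
  also have "\<dots> \<le> (\<Sum>i\<in>I. scaled_tail b i (\<eta> * x) * (1 / (e * x)\<^sup>2))"
    by (intro sum_mono Q)
  also have "\<dots> = tails b I (\<eta> * x) / (e * x)\<^sup>2" by (simp add: tails_def sum_distrib_right sum_divide_distrib)
  finally show ?thesis by (simp add: A_def P_def tails_def)
qed

text \<open>Two disjoint ways to reach x: no summand above \<eta> x, or one of size at least (1 + e)
  x > \<eta> x with a rest that does not cancel it. Disjointness lets the probabilities add. Each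
  \<open>max 0\<close> allows its part to be discarded where its estimate is useless.\<close>

lemma one_jump_lower:
  assumes arr: "array I b B" and x: "x > 0" and e: "0 < e" and \<eta>: "0 < \<eta>" "\<eta> \<le> 1"
  defines "R \<equiv> tails b I ((1 + e) * x)"
  shows "max 0 (tsum_tail b (\<eta> * x) I x
       - (\<Sum>i\<in>I. scaled_tail b i (\<eta> * x) * tsum_tail b (\<eta> * x) (I - {i}) x))
     + max 0 (R * (1 - 1 / (e * x)\<^sup>2) - R\<^sup>2) \<le> wsum_tail b I x"
proof -
  have I: "finite I" "\<And>i. i \<in> I \<Longrightarrow> b i > 0" "var * (\<Sum>i\<in>I. (b i)\<^sup>2) = 1"
    using arr unfolding array_def by auto
  let ?y = "\<eta> * x"
  define A where "A = {\<omega> \<in> space M. tsum b ?y I \<omega> \<ge> x}"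
  define A0 where "A0 = {\<omega> \<in> space M. tsum b ?y I \<omega> \<ge> x \<and> (\<forall>i\<in>I. b i * \<xi> i \<omega> \<le> ?y)}"
  define P where "P = (\<lambda>i. {\<omega> \<in> space M. b i * \<xi> i \<omega> \<ge> ?y \<and> tsum b ?y (I - {i}) \<omega> \<ge> x})"
  define Q where "Q = (\<lambda>i. {\<omega> \<in> space M. b i * \<xi> i \<omega> \<ge> (1 + e) * x \<and> wsum b (I - {i}) \<omega> \<ge> - (e * x)})"
  have meas: "A \<in> events" "A0 \<in> events" "P i \<in> events" "Q i \<in> events" for i
    unfolding A_def A0_def P_def Q_def using I(1) by measurable
  have UN: "(\<Union>i\<in>I. P i) \<in> events" "(\<Union>i\<in>I. Q i) \<in> events"
    by (intro sets.finite_UN I(1) meas)+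
  have split_w: "wsum b I \<omega> = b i * \<xi> i \<omega> + wsum b (I - {i}) \<omega>" if "i \<in> I" for i \<omega>
    unfolding wsum_def using I(1) that by (rule sum.remove)
  have subA0: "A0 \<subseteq> {\<omega> \<in> space M. wsum b I \<omega> \<ge> x}"
  proof
    fix \<omega> assume w: "\<omega> \<in> A0"
    then have "tsum b ?y I \<omega> = wsum b I \<omega>"
      unfolding tsum_def wsum_def by (intro sum.cong) (auto simp: trunc_def A0_def)
    then show "\<omega> \<in> {\<omega> \<in> space M. wsum b I \<omega> \<ge> x}" using w by (simp add: A0_def)
  qed
  have subQ: "(\<Union>i\<in>I. Q i) \<subseteq> {\<omega> \<in> space M. wsum b I \<omega> \<ge> x}"
    using split_w by (fastforce simp: Q_def algebra_simps)
  have disj: "A0 \<inter> (\<Union>i\<in>I. Q i) = {}"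
  proof -
    have "?y < (1 + e) * x" using x e \<eta> by (intro mult_strict_right_mono) auto
    then show ?thesis by (fastforce simp: A0_def Q_def)
  qed
  have "prob A0 + prob (\<Union>i\<in>I. Q i) = prob (A0 \<union> (\<Union>i\<in>I. Q i))"
    by (intro finite_measure_Union[symmetric] disj meas UN)
  also have "\<dots> \<le> wsum_tail b I x"
    using subA0 subQ by (intro finite_measure_mono) auto
  finally have 0: "prob A0 + prob (\<Union>i\<in>I. Q i) \<le> wsum_tail b I x" .
  have "A \<subseteq> A0 \<union> (\<Union>i\<in>I. P i)"
  proof
    fix \<omega> assume w: "\<omega> \<in> A"
    show "\<omega> \<in> A0 \<union> (\<Union>i\<in>I. P i)"
    proof (cases "\<exists>i\<in>I. b i * \<xi> i \<omega> > ?y")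
      case True
      then obtain i where i: "i \<in> I" "b i * \<xi> i \<omega> > ?y" by blast
      have "tsum b ?y I \<omega> = trunc ?y (b i * \<xi> i \<omega>) + tsum b ?y (I - {i}) \<omega>"
        unfolding tsum_def using I(1) i(1) by (rule sum.remove)
      \<comment> \<open>A jump is truncated to 0, so deleting its index leaves the truncated sum
        unchanged.\<close>
      then have "tsum b ?y (I - {i}) \<omega> = tsum b ?y I \<omega>" using i by (simp add: trunc_def)
      then have "\<omega> \<in> P i" using i w by (simp add: P_def A_def)
      then show ?thesis using i by blast
    next
      case False
      then show ?thesis using w by (auto simp: A_def A0_def not_less)
    qed
  qed
  then have "prob A \<le> prob (A0 \<union> (\<Union>i\<in>I. P i))" by (intro finite_measure_mono sets.Un meas UN)
  also have "\<dots> \<le> prob A0 + prob (\<Union>i\<in>I. P i)" by (intro measure_Un_le meas UN)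
  also have "prob (\<Union>i\<in>I. P i) \<le> (\<Sum>i\<in>I. prob (P i))"
    using meas I(1) by (intro finite_measure_subadditive_finite) auto
  also have "\<dots> = (\<Sum>i\<in>I. scaled_tail b i ?y * tsum_tail b ?y (I - {i}) x)"
  proof (rule sum.cong[OF refl])
    fix i
    have "prob (P i) = \<P>(\<omega> in M. \<xi> i \<omega> \<in> {u. b i * u \<ge> ?y} \<and> (\<Sum>j\<in>I - {i}. trunc ?y (b j * \<xi> j \<omega>)) \<in> {x..})"
      unfolding P_def tsum_def by (rule arg_cong[where f = prob]) auto
    also have "\<dots> = \<P>(\<omega> in M. \<xi> i \<omega> \<in> {u. b i * u \<ge> ?y}) * \<P>(\<omega> in M. (\<Sum>j\<in>I - {i}. trunc ?y (b j * \<xi> j \<omega>)) \<in> {x..})"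
      by (rule prob_indep_sum) (use I in auto)
    finally show "prob (P i) = scaled_tail b i ?y * tsum_tail b ?y (I - {i}) x"
      by (simp add: tsum_def)
  qed
  finally have 1: "max 0 (tsum_tail b (\<eta> * x) I x
       - (\<Sum>i\<in>I. scaled_tail b i (\<eta> * x) * tsum_tail b (\<eta> * x) (I - {i}) x)) \<le> prob A0"
    by (simp add: A_def)
  define g where "g = (\<lambda>i. scaled_tail b i ((1 + e) * x))"
  have gR: "(\<Sum>i\<in>I. g i) = R" by (simp add: g_def R_def tails_def)
  have Qi: "prob (Q i) \<ge> g i * (1 - 1 / (e * x)\<^sup>2)" if "i \<in> I" for i
  proof -
    have "prob (Q i) = \<P>(\<omega> in M. \<xi> i \<omega> \<in> {u. b i * u \<ge> (1 + e) * x} \<and> (\<Sum>j\<in>I - {i}. b j * \<xi> j \<omega>) \<in> {- (e * x)..})"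
      unfolding Q_def wsum_def by (rule arg_cong[where f = prob]) auto
    also have "\<dots> = \<P>(\<omega> in M. \<xi> i \<omega> \<in> {u. b i * u \<ge> (1 + e) * x}) * \<P>(\<omega> in M. (\<Sum>j\<in>I - {i}. b j * \<xi> j \<omega>) \<in> {- (e * x)..})"
      by (rule prob_indep_sum) (use I in auto)
    also have "\<dots> \<ge> g i * (1 - 1 / (e * x)\<^sup>2)"
    proof -
      have "\<P>(\<omega> in M. \<bar>wsum b (I - {i}) \<omega>\<bar> \<ge> e * x) \<le> 1 / (e * x)\<^sup>2"
      proof (rule wsum_Chebyshev)
        show "var * (\<Sum>i\<in>I - {i}. (b i)\<^sup>2) \<le> 1"
          unfolding I(3)[symmetric] using I(1) var_gt_0 by (intro mult_left_mono sum_mono2) auto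
      qed (use I e x in auto)
      moreover have "prob (space M - {\<omega> \<in> space M. \<bar>wsum b (I - {i}) \<omega>\<bar> \<ge> e * x}) = 1 - \<P>(\<omega> in M. \<bar>wsum b (I - {i}) \<omega>\<bar> \<ge> e * x)"
        by (rule prob_compl) measurable
      moreover have "prob (space M - {\<omega> \<in> space M. \<bar>wsum b (I - {i}) \<omega>\<bar> \<ge> e * x}) \<le> \<P>(\<omega> in M. (\<Sum>j\<in>I - {i}. b j * \<xi> j \<omega>) \<in> {- (e * x)..})"
      proof (intro finite_measure_mono)
        show "{\<omega> \<in> space M. (\<Sum>j\<in>I - {i}. b j * \<xi> j \<omega>) \<in> {- (e * x)..}} \<in> events" by measurable
      qed (auto simp: wsum_def)
      ultimately have "1 - 1 / (e * x)\<^sup>2 \<le> \<P>(\<omega> in M. (\<Sum>j\<in>I - {i}. b j * \<xi> j \<omega>) \<in> {- (e * x)..})" by linarith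
      then show ?thesis unfolding g_def by (simp add: mult_left_mono)
    qed
    finally show ?thesis .
  qed
  have "(\<Sum>i\<in>I. g i * (1 - 1 / (e * x)\<^sup>2)) \<le> (\<Sum>i\<in>I. prob (Q i))"
    by (intro sum_mono Qi)
  then have "R * (1 - 1 / (e * x)\<^sup>2) - R\<^sup>2 \<le> (\<Sum>i\<in>I. prob (Q i)) - (\<Sum>i\<in>I. g i)\<^sup>2"
    unfolding sum_distrib_right[symmetric] gR by simp
  also have "\<dots> \<le> prob (\<Union>i\<in>I. Q i)"
  proof (rule prob_UN_ge)
    fix i j assume ij: "i \<in> I" "j \<in> I" "i \<noteq> j"
    have "prob (Q i \<inter> Q j) \<le> \<P>(\<omega> in M. \<xi> i \<omega> \<in> {u. b i * u \<ge> (1 + e) * x} \<and> (\<Sum>j\<in>{j}. b j * \<xi> j \<omega>) \<in> {(1 + e) * x..})"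
    proof (intro finite_measure_mono)
      show "{\<omega> \<in> space M. \<xi> i \<omega> \<in> {u. b i * u \<ge> (1 + e) * x} \<and> (\<Sum>j\<in>{j}. b j * \<xi> j \<omega>) \<in> {(1 + e) * x..}} \<in> events"
        by measurable
    qed (auto simp: Q_def)
    also have "\<dots> = \<P>(\<omega> in M. \<xi> i \<omega> \<in> {u. b i * u \<ge> (1 + e) * x}) * \<P>(\<omega> in M. (\<Sum>j\<in>{j}. b j * \<xi> j \<omega>) \<in> {(1 + e) * x..})"
      by (rule prob_indep_sum) (use ij in auto)
    finally show "prob (Q i \<inter> Q j) \<le> g i * g j" by (simp add: g_def)
  qed (use I meas in \<open>auto simp: g_def\<close>)
  finally have "max 0 (R * (1 - 1 / (e * x)\<^sup>2) - R\<^sup>2) \<le> prob (\<Union>i\<in>I. Q i)" by simp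
  with 0 1 show ?thesis by linarith
qed

end

section \<open>Regularly varying tails\<close>

text \<open>The slowly varying function has been eliminated: what enters is regular variation of the
  right tail with index -t.\<close>

locale heavy_tailed_array = iid_array +
  fixes t :: real
  assumes t_pos: "t > 0"
    and tail_pos: "\<forall>\<^sub>F u in at_top. 0 < measure D {u..}"
    and tail_rv: "\<And>r. r > 0 \<Longrightarrow> ((\<lambda>u. measure D {r * u..} / measure D {u..}) \<longlongrightarrow> r powr - t) at_top"
begin

abbreviation F :: "real \<Rightarrow> real" where
  "F u \<equiv> measure D {u..}"

lemma real_distribution_law: "real_distribution D"
  unfolding law[of undefined, symmetric] by (intro real_distribution_distr rv)

lemma F_antimono: "u \<le> v \<Longrightarrow> F v \<le> F u"
proof -
  interpret D: real_distribution D by (rule real_distribution_law)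
  show "u \<le> v \<Longrightarrow> F v \<le> F u" by (intro D.finite_measure_mono) auto
qed

lemma prob_scaled_eq_F:
  assumes "b > 0"
  shows "\<P>(\<omega> in M. b * \<xi> i \<omega> \<ge> x) = F (x / b)"
proof -
  have "{u. b * u \<ge> x} = {x / b..}" using assms by (auto simp: field_simps)
  then show ?thesis using prob_law[of "\<lambda>u. b * u \<ge> x" i] by simp
qed

text \<open>A crude Potter bound. As 2^-(t+1) < 2^-t, doubling the argument eventually costs at most
  the factor 2^-(t+1); iterating over dyadic scales gives the power, and monotonicity starts the
  induction.\<close>

lemma F_lower:
  obtains c u0 where "c > 0" "u0 > 0" "\<And>u. u \<ge> u0 \<Longrightarrow> c * u powr - (t + 1) \<le> F u"
proof -
  define T where "T = t + 1"
  have T: "T > 0" using t_pos by (simp add: T_def)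
  have "2 powr - T < 2 powr - t" by (simp add: T_def)
  then have "\<forall>\<^sub>F u in at_top. 2 powr - T < F (2 * u) / F u"
    by (intro order_tendstoD(1)[OF tail_rv]) auto
  with tail_pos have "\<forall>\<^sub>F u in at_top. 2 powr - T * F u \<le> F (2 * u) \<and> 0 < F u"
    by eventually_elim (simp add: field_simps)
  then obtain u1 where u1: "\<And>u. u \<ge> u1 \<Longrightarrow> 2 powr - T * F u \<le> F (2 * u) \<and> 0 < F u"
    unfolding eventually_at_top_linorder by blast
  define u0 where "u0 = max 1 u1"
  have u0: "u0 \<ge> 1" "u0 \<ge> u1" by (auto simp: u0_def)
  \<comment> \<open>Calibrated on [u0, 2 u0]: there F u \<ge> F (2 u0), and u^-T is largest at
    u0.\<close>
  define c where "c = F (2 * u0) * u0 powr T"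
  have c: "c > 0" unfolding c_def using u1[of "2 * u0"] u0 by simp
  have base: "c * u powr - T \<le> F u" if "u0 \<le> u" "u \<le> 2 * u0" for u
  proof -
    have "c * u powr - T \<le> c * u0 powr - T"
      using c u0 that T by (intro mult_left_mono powr_mono2') auto
    also have "\<dots> = F (2 * u0)" using u0 by (simp add: c_def mult.assoc flip: powr_add)
    also have "\<dots> \<le> F u" by (rule F_antimono[OF that(2)])
    finally show ?thesis .
  qed
  have step: "\<forall>u. u0 \<le> u \<longrightarrow> u \<le> 2 ^ m * (2 * u0) \<longrightarrow> c * u powr - T \<le> F u" for m
  proof (induction m)
    case 0
    then show ?case using base by simp
  next
    case (Suc m)
    show ?case
    proof (intro allI impI)
      fix u assume u: "u0 \<le> u" "u \<le> 2 ^ Suc m * (2 * u0)"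
      show "c * u powr - T \<le> F u"
      proof (cases "u \<le> 2 * u0")
        case False
        have "c * (u / 2) powr - T \<le> F (u / 2)"
          using Suc.IH u False by auto
        then have "2 powr - T * (c * (u / 2) powr - T) \<le> 2 powr - T * F (u / 2)"
          by (intro mult_left_mono) auto
        also have "\<dots> \<le> F (2 * (u / 2))" using u1[of "u / 2"] False u0 by auto
        finally show ?thesis using u u0 by (simp add: powr_divide powr_minus field_simps)
      qed (use base u in simp)
    qed
  qed
  show thesis
  proof (rule that[OF c, of u0])
    show "u0 > 0" using u0 by simp
    fix u assume u: "u0 \<le> u"
    obtain m where "u / (2 * u0) < 2 ^ m" using real_arch_pow[of 2 "u / (2 * u0)"] by auto
    then have "u \<le> 2 ^ m * (2 * u0)" using u0 by (simp add: field_simps)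
    then show "c * u powr - (t + 1) \<le> F u" using step[of m] u by (simp add: T_def)
  qed
qed

text \<open>Small B pushes all arguments x / b i beyond a threshold at once, so that asymptotics of
  \<open>F\<close> apply to all summands uniformly.\<close>

lemma ratio_ge:
  assumes "array I b B" "i \<in> I" "0 < a" "a \<le> x" "0 < B" "0 < u0" "B \<le> a / u0"
  shows "u0 \<le> x / b i"
proof -
  have bi: "0 < b i" "b i \<le> B" using assms(1,2) unfolding array_def by auto
  have "u0 * b i \<le> u0 * (a / u0)" using bi assms by (intro mult_left_mono) auto
  also have "\<dots> \<le> x" using assms by simp
  finally show ?thesis using bi by (simp add: field_simps)
qed

lemma eventually_le_at_right:
  assumes "\<kappa> > (0::real)"
  shows "\<forall>\<^sub>F B in at_right 0. 0 < B \<and> B \<le> \<kappa>"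
  unfolding eventually_at_right_field using assms by (intro exI[of _ \<kappa>]) auto

lemma tails_scale:
  assumes a: "a > 0" and r: "r > 0" and \<epsilon>: "\<epsilon> > 0"
  shows "\<forall>\<^sub>F B in at_right 0. \<forall>I b x. array I b B \<longrightarrow> a \<le> x \<longrightarrow>
     \<bar>tails b I (r * x) - r powr - t * tails b I x\<bar> \<le> \<epsilon> * tails b I x"
proof -
  have "\<forall>\<^sub>F u in at_top. dist (F (r * u) / F u) (r powr - t) < \<epsilon>"
    using tendstoD[OF tail_rv[OF r] \<epsilon>] .
  with tail_pos have "\<forall>\<^sub>F u in at_top. \<bar>F (r * u) - r powr - t * F u\<bar> \<le> \<epsilon> * F u"
  proof eventually_elim
    case (elim u)
    have "\<bar>F (r * u) - r powr - t * F u\<bar> = \<bar>F (r * u) / F u - r powr - t\<bar> * F u"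
    proof -
      have "F (r * u) - r powr - t * F u = (F (r * u) / F u - r powr - t) * F u"
        using elim(1) by (simp add: field_simps)
      then show ?thesis using elim(1) by (simp add: abs_mult)
    qed
    also have "\<dots> \<le> \<epsilon> * F u" using elim by (intro mult_right_mono) (auto simp: dist_real_def)
    finally show ?case .
  qed
  then obtain u1 where u1: "\<And>u. u \<ge> u1 \<Longrightarrow> \<bar>F (r * u) - r powr - t * F u\<bar> \<le> \<epsilon> * F u"
    unfolding eventually_at_top_linorder by blast
  define u0 where "u0 = max 1 u1"
  have u0: "u0 > 0" "u0 \<ge> u1" by (auto simp: u0_def)
  have "a / u0 > 0" using a u0 by simp
  from eventually_le_at_right[OF this] show ?thesis
  proof eventually_elim
    case (elim B)
    show ?case
    proof (intro allI impI)
      fix I b x assume arr: "array I b B" and x: "a \<le> x"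
      have b: "b i > 0" if "i \<in> I" for i using arr that unfolding array_def by auto
      have tx: "tails b I y = (\<Sum>i\<in>I. F (y / b i))" for y
        unfolding tails_def using b by (intro sum.cong refl prob_scaled_eq_F) auto
      have "\<bar>tails b I (r * x) - r powr - t * tails b I x\<bar> = \<bar>\<Sum>i\<in>I. F (r * (x / b i)) - r powr - t * F (x / b i)\<bar>"
        unfolding tx by (simp add: sum_subtractf sum_distrib_left)
      also have "\<dots> \<le> (\<Sum>i\<in>I. \<bar>F (r * (x / b i)) - r powr - t * F (x / b i)\<bar>)" by (rule sum_abs)
      also have "\<dots> \<le> (\<Sum>i\<in>I. \<epsilon> * F (x / b i))"
      proof (intro sum_mono u1)
        fix i assume "i \<in> I"
        from ratio_ge[OF arr this a x _ u0(1)] elim u0 show "u1 \<le> x / b i" by linarith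
      qed
      also have "\<dots> = \<epsilon> * tails b I x" unfolding tx by (simp add: sum_distrib_left)
      finally show "\<bar>tails b I (r * x) - r powr - t * tails b I x\<bar> \<le> \<epsilon> * tails b I x" .
    qed
  qed
qed

text \<open>Markov's inequality for the p-th moment and the Lyapunov sum. It makes A(x) negligible
  against the normal tail for bounded x and controls the Bonferroni square.\<close>

lemma tails_small:
  assumes a: "a > 0" and \<kappa>: "\<kappa> > 0"
  shows "\<forall>\<^sub>F B in at_right 0. \<forall>I b x. array I b B \<longrightarrow> a \<le> x \<longrightarrow> tails b I x \<le> \<kappa>"
proof -
  define m where "m = (mom + 1) / (a powr p * var)"
  have m: "m > 0" unfolding m_def using a mom_nonneg var_gt_0 by (auto intro!: divide_pos_pos mult_pos_pos)
  define r where "r = p - 2"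
  have r: "r > 0" using p by (simp add: r_def)
  have "((\<lambda>B. m * B powr r) \<longlongrightarrow> 0) (at_right 0)" using m r by real_asymp
  from order_tendstoD(2)[OF this \<kappa>] show ?thesis
  proof eventually_elim
    case (elim B)
    show ?case
    proof (intro allI impI)
      fix I b x assume arr: "array I b B" and x: "a \<le> x"
      have "tails b I x \<le> (\<Sum>i\<in>I. b i powr p * ((mom + 1) / a powr p))"
        unfolding tails_def
      proof (rule sum_mono)
        fix i assume "i \<in> I"
        then have bi: "b i > 0" using arr unfolding array_def by auto
        have "\<P>(\<omega> in M. b i * \<xi> i \<omega> \<ge> x) \<le> b i powr p * mom / x powr p"
          by (rule prob_scaled_ge_le) (use bi a x in auto)
        also have "\<dots> \<le> b i powr p * (mom + 1) / a powr p"
          using mom_nonneg a x p by (intro frac_le mult_left_mono powr_mono2) auto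
        finally show "\<P>(\<omega> in M. b i * \<xi> i \<omega> \<ge> x) \<le> b i powr p * ((mom + 1) / a powr p)" by simp
      qed
      also have "\<dots> = (\<Sum>i\<in>I. b i powr p) * ((mom + 1) / a powr p)" by (rule sum_distrib_right[symmetric])
      also have "\<dots> \<le> B powr (p - 2) / var * ((mom + 1) / a powr p)"
        using array_sum_powr[OF arr] mom_nonneg by (intro mult_right_mono) auto
      also have "\<dots> = m * B powr r" by (simp add: m_def r_def mult_ac)
      also have "\<dots> \<le> \<kappa>" using elim by simp
      finally show "tails b I x \<le> \<kappa>" .
    qed
  qed
qed

text \<open>A single summand suffices, the one whose weight attains B.\<close>

lemma tails_lower:
  assumes a: "a > 0"
  obtains c where "c > 0" "\<forall>\<^sub>F B in at_right 0. \<forall>I b x. array I b B \<longrightarrow> (\<exists>i\<in>I. b i = B) \<longrightarrow> a \<le> x \<longrightarrow>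
     c * (B / x) powr (t + 1) \<le> tails b I x"
proof (rule F_lower)
  fix c u0 :: real
  assume c: "c > 0" and u0: "u0 > 0" and lower: "\<And>u. u \<ge> u0 \<Longrightarrow> c * u powr - (t + 1) \<le> F u"
  show thesis
  proof (rule that[OF c])
    have "a / u0 > 0" using a u0 by simp
    from eventually_le_at_right[OF this]
    show "\<forall>\<^sub>F B in at_right 0. \<forall>I b x. array I b B \<longrightarrow> (\<exists>i\<in>I. b i = B) \<longrightarrow> a \<le> x \<longrightarrow>
       c * (B / x) powr (t + 1) \<le> tails b I x"
    proof eventually_elim
      case (elim B)
      show ?case
      proof (intro allI impI)
        fix I b x assume arr: "array I b B" and ex: "\<exists>i\<in>I. b i = B" and x: "a \<le> x"
        obtain i where i: "i \<in> I" "b i = B" using ex by blast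
        have fin: "finite I" using arr unfolding array_def by simp
        have "u0 \<le> x / B" using ratio_ge[OF arr i(1) a x _ u0] elim i by simp
        then have "c * (x / B) powr - (t + 1) \<le> F (x / B)" by (rule lower)
        also have "(x / B) powr - (t + 1) = (B / x) powr (t + 1)"
          using inverse_powr[of "x / B" "t + 1"] powr_minus[of "x / B" "t + 1"] elim x a by simp
        also have "F (x / B) = \<P>(\<omega> in M. b i * \<xi> i \<omega> \<ge> x)" using prob_scaled_eq_F[where b = B and i = i and x = x] elim i by simp
        also have "\<dots> \<le> tails b I x"
          unfolding tails_def using fin i(1) by (intro member_le_sum) auto
        finally show "c * (B / x) powr (t + 1) \<le> tails b I x" .
      qed
    qed
  qed
qed

text \<open>First e is fixed with (1 - e)^-t close to 1. Beyond \<open>X0\<close> the Chebyshev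
  factor is small; below \<open>X0\<close> it is only bounded, but there the tails are at most
  \<kappa> and the term is absorbed by the normal tail.\<close>

lemma jump_upper:
  assumes a: "a > 0" and \<eta>: "\<eta> > 0" and \<epsilon>: "\<epsilon> > 0"
  obtains e where "0 < e" "\<forall>\<^sub>F B in at_right 0. \<forall>I b x. array I b B \<longrightarrow> a \<le> x \<longrightarrow>
     jump_upper_term b I e \<eta> x \<le> tails b I x + \<epsilon> * (tails b I x + normal_tail x)"
proof -
  have "((\<lambda>e. (1 - e) powr - t) \<longlongrightarrow> (1 - 0) powr - t) (at_right 0)"
    by (intro tendsto_intros) auto
  then have "\<forall>\<^sub>F e in at_right 0. (1 - e) powr - t < 1 + \<epsilon> / 3"
    by (rule order_tendstoD(2)) (use \<epsilon> in auto)
  moreover have "\<forall>\<^sub>F e in at_right 0. 0 < e \<and> e \<le> (1/2 :: real)" by (rule eventually_le_at_right) simp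
  ultimately have "\<forall>\<^sub>F e in at_right 0. (1 - e) powr - t < 1 + \<epsilon> / 3 \<and> 0 < e \<and> e \<le> (1/2 :: real)"
    by eventually_elim simp
  then obtain e where e: "(1 - e) powr - t < 1 + \<epsilon> / 3" "0 < e" "e \<le> 1/2"
    using eventually_happens'[of "at_right (0::real)"] by auto
  define H where "H = \<eta> powr - t + 1"
  have H: "H > 0" using \<eta> by (simp add: H_def add_nonneg_pos)
  define X0 where "X0 = sqrt (3 * H / \<epsilon>) / e"
  have X0: "X0 > 0" using H \<epsilon> e by (simp add: X0_def)
  have X0': "H / (e * X0)\<^sup>2 = \<epsilon> / 3" using H \<epsilon> e by (simp add: X0_def)
  \<comment> \<open>Solves H \<kappa> / (e a)^2 = \<epsilon> \<open>normal_tail X0\<close>, the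
    worst case on a \<le> x < \<open>X0\<close>.\<close>
  define \<kappa> where "\<kappa> = \<epsilon> * normal_tail X0 * (e * a)\<^sup>2 / H"
  have \<kappa>: "\<kappa> > 0" unfolding \<kappa>_def using \<epsilon> normal_tail_pos[of X0] e a H by simp
  have e1: "1 - e > 0" using e by simp
  have e3: "\<epsilon> / 3 > 0" using \<epsilon> by simp
  show thesis
  proof (rule that[OF e(2)])
    show "\<forall>\<^sub>F B in at_right 0. \<forall>I b x. array I b B \<longrightarrow> a \<le> x \<longrightarrow>
     jump_upper_term b I e \<eta> x \<le> tails b I x + \<epsilon> * (tails b I x + normal_tail x)"
      using tails_scale[OF a e1 e3] tails_scale[OF a \<eta> zero_less_one] tails_small[OF a \<kappa>]
    proof eventually_elim
      case (elim B)
      show ?case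
      proof (intro allI impI)
        fix I b x assume arr: "array I b B" and ax: "a \<le> x"
        have x: "x > 0" using a ax by simp
        let ?t = "tails b I x"
        note t0 = tails_nonneg[of b I x]
        have s1: "\<bar>tails b I ((1 - e) * x) - (1 - e) powr - t * ?t\<bar> \<le> \<epsilon> / 3 * ?t"
          and s2: "\<bar>tails b I (\<eta> * x) - \<eta> powr - t * ?t\<bar> \<le> 1 * ?t" and s3: "?t \<le> \<kappa>"
          using elim arr ax by blast+
        have "(1 - e) powr - t * ?t \<le> (1 + \<epsilon> / 3) * ?t" using e t0 by (intro mult_right_mono) auto
        then have u1: "tails b I ((1 - e) * x) \<le> ?t + \<epsilon> / 3 * ?t + \<epsilon> / 3 * ?t"
          using s1 unfolding distrib_right mult_1_left by linarith
        have u2: "tails b I (\<eta> * x) \<le> H * ?t"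
          using s2 unfolding H_def distrib_right mult_1_left by linarith
        have u3: "tails b I (\<eta> * x) / (e * x)\<^sup>2 \<le> \<epsilon> / 3 * ?t + \<epsilon> * normal_tail x"
        proof (cases "x \<ge> X0")
          case True
          have "tails b I (\<eta> * x) / (e * x)\<^sup>2 \<le> (H * ?t) / (e * X0)\<^sup>2"
            using u2 True X0 e H t0 by (intro frac_le power_mono mult_left_mono) auto
          also have "\<dots> = \<epsilon> / 3 * ?t" by (simp add: X0'[symmetric])
          finally show ?thesis using \<epsilon> normal_tail_pos[of x] by (simp add: add_increasing2)
        next
          case False
          have "tails b I (\<eta> * x) / (e * x)\<^sup>2 \<le> (H * \<kappa>) / (e * a)\<^sup>2"
            using order_trans[OF u2 mult_left_mono[OF s3 less_imp_le[OF H]]] ax a e H \<kappa>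
            by (intro frac_le power_mono mult_left_mono) auto
          also have "\<dots> = \<epsilon> * normal_tail X0" using H e a by (simp add: \<kappa>_def)
          also have "\<dots> \<le> \<epsilon> * normal_tail x" using False \<epsilon> by (intro mult_left_mono normal_tail_antimono) auto
          finally show ?thesis using \<epsilon> t0 by (simp add: add_increasing)
        qed
        have "\<epsilon> / 3 * ?t + \<epsilon> / 3 * ?t + \<epsilon> / 3 * ?t = \<epsilon> * ?t" by simp
        then show "jump_upper_term b I e \<eta> x \<le> ?t + \<epsilon> * (?t + normal_tail x)"
          using u1 u3 unfolding distrib_left by linarith
      qed
    qed
  qed
qed

text \<open>The same split at \<open>X0\<close>; below it the jump part is dropped entirely, since
  the tails are already at most \<epsilon> times the normal tail.\<close>

lemma jump_lower:
  assumes a: "a > 0" and \<epsilon>: "0 < \<epsilon>" "\<epsilon> \<le> 1"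
  obtains e where "0 < e" "\<forall>\<^sub>F B in at_right 0. \<forall>I b x. array I b B \<longrightarrow> a \<le> x \<longrightarrow>
     tails b I x - \<epsilon> * (tails b I x + normal_tail x) \<le>
       max 0 (jump_lower_term b I e x)"
proof -
  have "((\<lambda>e. (1 + e) powr - t) \<longlongrightarrow> (1 + 0) powr - t) (at_right 0)"
    by (intro tendsto_intros) auto
  then have "\<forall>\<^sub>F e in at_right 0. 1 - \<epsilon> / 4 < (1 + e) powr - t"
    by (rule order_tendstoD(1)) (use \<epsilon> in auto)
  moreover have "\<forall>\<^sub>F e in at_right 0. 0 < e \<and> e \<le> (1 :: real)" by (rule eventually_le_at_right) simp
  ultimately have "\<forall>\<^sub>F e in at_right 0. 1 - \<epsilon> / 4 < (1 + e) powr - t \<and> 0 < e"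
    by eventually_elim simp
  then obtain e where e: "1 - \<epsilon> / 4 < (1 + e) powr - t" "0 < e"
    using eventually_happens'[of "at_right (0::real)"] by auto
  define X0 where "X0 = sqrt (4 / \<epsilon>) / e"
  have X0: "X0 > 0" using \<epsilon> e by (simp add: X0_def)
  have X0': "1 / (e * X0)\<^sup>2 = \<epsilon> / 4" using \<epsilon> e by (simp add: X0_def)
  define \<kappa> where "\<kappa> = min (\<epsilon> / 4) (\<epsilon> * normal_tail X0)"
  have \<kappa>: "\<kappa> > 0" unfolding \<kappa>_def using \<epsilon> normal_tail_pos[of X0] by simp
  have e1: "1 + e > 0" using e by simp
  have e4: "\<epsilon> / 4 > 0" using \<epsilon> by simp
  show thesis
  proof (rule that[OF e(2)])
    show "\<forall>\<^sub>F B in at_right 0. \<forall>I b x. array I b B \<longrightarrow> a \<le> x \<longrightarrow>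
     tails b I x - \<epsilon> * (tails b I x + normal_tail x) \<le>
       max 0 (jump_lower_term b I e x)"
      using tails_scale[OF a e1 e4] tails_small[OF a \<kappa>]
    proof eventually_elim
      case (elim B)
      show ?case
      proof (intro allI impI)
        fix I b x assume arr: "array I b B" and ax: "a \<le> x"
        have x: "x > 0" using a ax by simp
        let ?t = "tails b I x" and ?s = "tails b I ((1 + e) * x)"
        note t0 = tails_nonneg[of b I x] and s0 = tails_nonneg[of b I "(1 + e) * x"]
        have s1: "\<bar>?s - (1 + e) powr - t * ?t\<bar> \<le> \<epsilon> / 4 * ?t"
          and s2: "?t \<le> \<kappa>" and s3: "?s \<le> \<kappa>"
        proof -
          have "a \<le> (1 + e) * x"
            using ax mult_pos_pos[OF e(2) x] unfolding distrib_right mult_1_left by linarith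
          then show "\<bar>?s - (1 + e) powr - t * ?t\<bar> \<le> \<epsilon> / 4 * ?t" "?t \<le> \<kappa>" "?s \<le> \<kappa>"
            using elim arr ax by blast+
        qed
        show "?t - \<epsilon> * (?t + normal_tail x) \<le> max 0 (?s * (1 - 1 / (e * x)\<^sup>2) - ?s\<^sup>2)"
        proof (cases "x \<ge> X0")
          \<comment> \<open>The deviation of (1 + e)^-t from 1 and the error of regular variation
            cost \<epsilon>/4 each, giving a factor 1 - \<epsilon>/2; Chebyshev and Bonferroni cost
            \<epsilon>/4 each, giving another. Their product is at least 1 - \<epsilon>.\<close>
          case True
          have "(1 - \<epsilon> / 4) * ?t \<le> (1 + e) powr - t * ?t" using e t0 by (intro mult_right_mono) auto
          then have sl: "(1 - \<epsilon> / 2) * ?t \<le> ?s"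
            using s1 unfolding left_diff_distrib mult_1_left by linarith
          have "1 / (e * x)\<^sup>2 \<le> 1 / (e * X0)\<^sup>2"
            using True X0 e by (intro divide_left_mono power_mono mult_left_mono) auto
          then have "1 - \<epsilon> / 2 \<le> 1 - 1 / (e * x)\<^sup>2 - ?s"
            using s3 unfolding X0' \<kappa>_def by simp
          then have "?s * (1 - \<epsilon> / 2) \<le> ?s * (1 - 1 / (e * x)\<^sup>2 - ?s)"
            using s0 by (intro mult_left_mono) auto
          moreover have "((1 - \<epsilon> / 2) * ?t) * (1 - \<epsilon> / 2) \<le> ?s * (1 - \<epsilon> / 2)"
            using sl \<epsilon> by (intro mult_right_mono) auto
          moreover have "((1 - \<epsilon> / 2) * ?t) * (1 - \<epsilon> / 2) = ?t - \<epsilon> * ?t + (\<epsilon> / 2)\<^sup>2 * ?t"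
            by (simp add: power2_eq_square field_simps)
          moreover have "0 \<le> (\<epsilon> / 2)\<^sup>2 * ?t" "0 \<le> \<epsilon> * normal_tail x"
            using t0 \<epsilon> normal_tail_pos[of x] by auto
          moreover have "?s * (1 - 1 / (e * x)\<^sup>2 - ?s) = ?s * (1 - 1 / (e * x)\<^sup>2) - ?s\<^sup>2"
            by (simp add: power2_eq_square right_diff_distrib)
          ultimately show ?thesis unfolding distrib_left by linarith
        next
          case False
          have "?t \<le> \<epsilon> * normal_tail X0" using s2 by (simp add: \<kappa>_def)
          also have "\<dots> \<le> \<epsilon> * normal_tail x" using False \<epsilon> by (intro mult_left_mono normal_tail_antimono) auto
          finally have "?t \<le> \<epsilon> * normal_tail x" .
          moreover have "0 \<le> \<epsilon> * ?t" using t0 \<epsilon> by simp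
          ultimately show ?thesis unfolding distrib_left by linarith
        qed
      qed
    qed
  qed
qed

text \<open>The regimes truncate at different levels \<open>\<eta>1\<close> and
  \<open>\<eta>2\<close>, hence two upper jump estimates. In the large regime truncated and normal
  tails are both absorbed by \<open>d * tails b I x\<close>, and the lower bound keeps the jump part
  alone.\<close>

lemma wsum_tail_asymp:
  assumes a: "a > 0" and \<epsilon>: "\<epsilon> > 0"
  shows "\<forall>\<^sub>F B in at_right 0. \<forall>I b x. array I b B \<longrightarrow> (\<exists>i\<in>I. b i = B) \<longrightarrow> a \<le> x \<longrightarrow>
     \<bar>wsum_tail b I x - (tails b I x + normal_tail x)\<bar> \<le> \<epsilon> * (tails b I x + normal_tail x)"
proof -
  \<comment> \<open>One power of B/x is thus left over when (B/x)^(T+1) is compared with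
    \<open>tails_lower\<close>.\<close>
  define T where "T = t + 1"
  have T: "T > 0" using t_pos by (simp add: T_def)
  \<comment> \<open>At most three errors of relative size \<open>d\<close> add up on either side;
    \<open>d \<le> 1\<close> is for \<open>jump_lower\<close>.\<close>
  define d where "d = min 1 (\<epsilon> / 4)"
  have d: "0 < d" "d \<le> 1" "4 * d \<le> \<epsilon>" using \<epsilon> by (auto simp: d_def)
  define \<eta>1 where "\<eta>1 = (p - 2) / (2 * (T + 1))"
  have \<eta>1: "0 < \<eta>1" "\<eta>1 \<le> 1" using p T by (auto simp: \<eta>1_def field_simps)
  obtain K0 C where K0: "K0 > 0" and C: "C > 0" and large: "\<forall>\<^sub>F B in at_right 0. \<forall>I b x. array I b B \<longrightarrow> 0 < x \<longrightarrow> K0 * ln (1 / B) \<le> x\<^sup>2 \<longrightarrow>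
     1 \<le> x \<and> tsum_tail b ((p - 2) / (2 * (T + 1)) * x) I x \<le> C * (B / x) powr (T + 1) \<and>
     normal_tail x \<le> C * (B / x) powr (T + 1)"
    by (rule large_regime[OF T])
  \<comment> \<open>\<open>K \<ge> K0\<close> makes the regimes cover all x;
    \<open>K \<ge> 1\<close> keeps \<open>\<eta>2\<close> at most 1, as
    \<open>one_jump_lower\<close> demands.\<close>
  define K where "K = max K0 1"
  have K: "K > 0" by (simp add: K_def)
  define \<eta>2 where "\<eta>2 = (p - 2) / (4 * K)"
  have \<eta>2: "0 < \<eta>2" "\<eta>2 \<le> 1" using p K by (auto simp: \<eta>2_def K_def field_simps)
  obtain e1 where e1: "0 < e1" and ju1: "\<forall>\<^sub>F B in at_right 0. \<forall>I b x. array I b B \<longrightarrow> a \<le> x \<longrightarrow>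
     jump_upper_term b I e1 \<eta>1 x \<le> tails b I x + d * (tails b I x + normal_tail x)"
    by (rule jump_upper[OF a \<eta>1(1) d(1)])
  obtain e2 where e2: "0 < e2" and ju2: "\<forall>\<^sub>F B in at_right 0. \<forall>I b x. array I b B \<longrightarrow> a \<le> x \<longrightarrow>
     jump_upper_term b I e2 \<eta>2 x \<le> tails b I x + d * (tails b I x + normal_tail x)"
    by (rule jump_upper[OF a \<eta>2(1) d(1)])
  obtain e where e: "0 < e" and jl: "\<forall>\<^sub>F B in at_right 0. \<forall>I b x. array I b B \<longrightarrow> a \<le> x \<longrightarrow>
     tails b I x - d * (tails b I x + normal_tail x) \<le>
       max 0 (jump_lower_term b I e x)"
    by (rule jump_lower[OF a d(1,2)])
  obtain c where c: "c > 0" and tl: "\<forall>\<^sub>F B in at_right 0. \<forall>I b x. array I b B \<longrightarrow> (\<exists>i\<in>I. b i = B) \<longrightarrow> a \<le> x \<longrightarrow>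
     c * (B / x) powr (t + 1) \<le> tails b I x"
    by (rule tails_lower[OF a])
  \<comment> \<open>Below this threshold the spare factor B/x outweighs the constants
    \<open>C\<close> and \<open>c\<close>.\<close>
  have "min 1 (d * c / C) > 0" using d c C by simp
  note evB = eventually_le_at_right[OF this]
  show ?thesis
    using large moderate_regime[OF a K d(1)] ju1 ju2 jl tl evB
  proof eventually_elim
    case (elim B)
    note lg = elim(1) and mo = elim(2) and u1 = elim(3) and u2 = elim(4) and lo = elim(5) and tl = elim(6)
    have B: "0 < B" "B \<le> 1" "B \<le> d * c / C" using elim(7) by auto
    show ?case
    proof (intro allI impI)
      fix I b x assume arr: "array I b B" and ex: "\<exists>i\<in>I. b i = B" and ax: "a \<le> x"
      have x: "x > 0" using a ax by simp
      let ?P = "wsum_tail b I x" and ?t = "tails b I x"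
      define R where "R = normal_tail x"
      define J where "J = max 0 (jump_lower_term b I e x)"
      have t0: "0 \<le> ?t" and R0: "0 < R" by (rule tails_nonneg, unfold R_def, rule normal_tail_pos)
      have dt: "0 \<le> d * ?t" and dR: "0 \<le> d * R" using d t0 R0 by auto
      have J: "?t - (d * ?t + d * R) \<le> J" using lo arr ax unfolding J_def R_def distrib_left by blast
      have eps: "4 * (d * ?t + d * R) \<le> \<epsilon> * (?t + R)"
        using mult_right_mono[OF d(3), of "?t + R"] t0 R0 by (simp add: distrib_left)
      have "\<bar>?P - (?t + R)\<bar> \<le> \<epsilon> * (?t + R)"
      proof (cases "x\<^sup>2 \<le> K * ln (1 / B)")
        case True
        let ?W = "tsum_tail b (\<eta>2 * x) I x"
          and ?E = "\<Sum>i\<in>I. scaled_tail b i (\<eta>2 * x) * tsum_tail b (\<eta>2 * x) (I - {i}) x"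
        have m: "\<bar>?W - R\<bar> \<le> d * R" "?E \<le> d * R"
          using mo arr ax True unfolding \<eta>2_def[symmetric] R_def by blast+
        have m1: "?W \<le> R + d * R" and m2: "R - d * R \<le> ?W" using m(1) by (simp_all add: abs_le_iff)
        have "jump_upper_term b I e2 \<eta>2 x \<le> ?t + (d * ?t + d * R)"
          using u2 arr ax unfolding distrib_left R_def by blast
        with one_jump_upper[OF arr x e2 \<eta>2(1)] have "?P \<le> ?W + (?t + (d * ?t + d * R))"
          by (rule order_trans[OF _ add_left_mono])
        then have up: "?P \<le> R + ?t + 2 * (d * ?t + d * R)" using m1 dt dR by argo
        have "?W - ?E + J \<le> ?P"
          unfolding J_def by (rule order_trans[OF add_right_mono[OF max.cobounded2] one_jump_lower[OF arr x e \<eta>2]])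
        then have "R + ?t - 3 * (d * ?t + d * R) \<le> ?P" using m2 m(2) J dt dR by argo
        with up eps dt dR show ?thesis unfolding abs_le_iff by argo
      next
        case False
        have "K0 * ln (1 / B) \<le> K * ln (1 / B)"
          using B by (intro mult_right_mono) (auto simp: K_def)
        with False have xK: "K0 * ln (1 / B) \<le> x\<^sup>2" by simp
        let ?W = "tsum_tail b (\<eta>1 * x) I x"
          and ?E = "\<Sum>i\<in>I. scaled_tail b i (\<eta>1 * x) * tsum_tail b (\<eta>1 * x) (I - {i}) x"
        have l: "1 \<le> x" "?W \<le> C * (B / x) powr (T + 1)" "R \<le> C * (B / x) powr (T + 1)"
          using lg arr x xK unfolding \<eta>1_def[symmetric] R_def by blast+
        have "C * (B / x) powr (T + 1) = C * (B / x) * (B / x) powr T"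
          using B x by (simp add: powr_add)
        also have "\<dots> \<le> (d * c) * (B / x) powr T"
        proof (intro mult_right_mono)
          have "B / x \<le> B / 1" using l(1) B x by (intro divide_left_mono) auto
          then have "C * (B / x) \<le> C * (d * c / C)" using B C by (intro mult_left_mono) auto
          then show "C * (B / x) \<le> d * c" using C by simp
        qed simp
        also have "\<dots> = d * (c * (B / x) powr (t + 1))" by (simp add: T_def)
        also have "\<dots> \<le> d * ?t"
        proof (intro mult_left_mono)
          show "c * (B / x) powr (t + 1) \<le> ?t" using tl arr ex ax by blast
        qed (use d in simp)
        finally have small: "C * (B / x) powr (T + 1) \<le> d * ?t" .
        have "jump_upper_term b I e1 \<eta>1 x \<le> ?t + (d * ?t + d * R)"
          using u1 arr ax unfolding distrib_left R_def by blast
        with one_jump_upper[OF arr x e1 \<eta>1(1)] have "?P \<le> ?W + (?t + (d * ?t + d * R))"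
          by (rule order_trans[OF _ add_left_mono])
        then have up: "?P \<le> R + ?t + 2 * (d * ?t + d * R)" using l(2) small dt dR R0 by argo
        have "0 + J \<le> ?P"
          unfolding J_def by (rule order_trans[OF add_right_mono[OF max.cobounded1] one_jump_lower[OF arr x e \<eta>1]])
        then have "R + ?t - 3 * (d * ?t + d * R) \<le> ?P" using l(3) small J dt dR by argo
        with up eps dt dR show ?thesis unfolding abs_le_iff by argo
      qed
      then show "\<bar>?P - (?t + normal_tail x)\<bar> \<le> \<epsilon> * (?t + normal_tail x)"
        unfolding R_def .
    qed
  qed
qed

end

section \<open>From the uniform estimate for one row to the sequence of weighted sums\<close>

theorem theorem2p1:
  fixes M :: "'a measure"
    and \<xi> :: "int \<Rightarrow> 'a \<Rightarrow> real"
    and h :: "real \<Rightarrow> real"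
    and t p a :: real
    and k :: "nat \<Rightarrow> nat"
    and c :: "nat \<Rightarrow> nat \<Rightarrow> real"
    and x :: "nat \<Rightarrow> real"
    and S :: "nat \<Rightarrow> 'a \<Rightarrow> real"
    and \<sigma> :: "nat \<Rightarrow> real"
  defines "S \<equiv> weighted_sum c k \<xi>"
    and "\<sigma> \<equiv> (\<lambda>n. std_dev M (S n))"
  assumes "prob_space M"
    and "iid M \<xi>"
    and "integrable M (\<xi> 0)" and "prob_space.expectation M (\<xi> 0) = 0"
    and "integrable M (\<lambda>\<omega>. (\<xi> 0 \<omega>)\<^sup>2)"
    and "t > 2" and "slowly_varying h"
    and "\<forall>\<^sub>F y in at_top. \<P>(\<omega> in M. \<xi> 0 \<omega> \<ge> y) = h y / y powr t"
    and "p > 2" and "integrable M (\<lambda>\<omega>. \<bar>\<xi> 0 \<omega>\<bar> powr p)"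
    and "\<And>n. n \<ge> 1 \<Longrightarrow> k n \<ge> 1"
    and "\<And>n i. n \<ge> 1 \<Longrightarrow> 1 \<le> i \<Longrightarrow> i \<le> k n \<Longrightarrow> c n i > 0"
    and "(\<lambda>n. MAX i\<in>{1..k n}. (c n i)\<^sup>2 / (\<sigma> n)\<^sup>2) \<longlonglongrightarrow> 0"
    and "a > 0" and "\<And>n. n \<ge> 1 \<Longrightarrow> x n \<ge> a"
  shows "\<exists>\<epsilon> \<delta> :: nat \<Rightarrow> real. \<epsilon> \<longlonglongrightarrow> 0 \<and> \<delta> \<longlonglongrightarrow> 0 \<and>
    (\<forall>n\<ge>1. \<P>(\<omega> in M. S n \<omega> \<ge> x n * \<sigma> n) =
       (1 + \<epsilon> n) * (\<Sum>i = 1..k n. \<P>(\<omega> in M. c n i * \<xi> 0 \<omega> \<ge> x n * \<sigma> n))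
       + (1 - cdf std_normal_distribution (x n)) * (1 + \<delta> n))"
proof -
  interpret prob_space M by fact
  define D where "D = distr M borel (\<xi> 0)"
  have indep: "indep_vars (\<lambda>_. borel) \<xi> UNIV" and law: "distr M borel (\<xi> i) = D" for i
    using \<open>iid M \<xi>\<close> unfolding iid_def D_def by blast+
  have rv[measurable]: "random_variable borel (\<xi> i)" for i
    using indep unfolding indep_vars_def by auto
  \<comment> \<open>The Taylor remainder used for the replacement argument needs an exponent at most 3.\<close>
  define p' where "p' = min p 3"
  have p': "2 < p'" "p' \<le> 3" "p' \<le> p" using \<open>p > 2\<close> by (auto simp: p'_def)
  have tail: "measure D {u..} = \<P>(\<omega> in M. \<xi> 0 \<omega> \<ge> u)" for u
    unfolding D_def by (subst measure_distr) (auto intro!: arg_cong[where f = prob])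
  have intD: "integrable D g \<longleftrightarrow> integrable M (\<lambda>\<omega>. g (\<xi> 0 \<omega>))" if "g \<in> borel_measurable borel" for g :: "real \<Rightarrow> real"
    unfolding D_def using that by (subst integrable_distr_eq) auto
  have ED: "(\<integral>u. g u \<partial>D) = expectation (\<lambda>\<omega>. g (\<xi> 0 \<omega>))" if "g \<in> borel_measurable borel" for g :: "real \<Rightarrow> real"
    unfolding D_def using that by (subst integral_distr) auto
  have h_pos: "\<forall>\<^sub>F u in at_top. 0 < h u"
    and h_lim: "\<And>r. r > 0 \<Longrightarrow> ((\<lambda>u. h (r * u) / h u) \<longlongrightarrow> 1) at_top"
    using \<open>slowly_varying h\<close> unfolding slowly_varying_def by auto
  have tail_h: "\<forall>\<^sub>F u in at_top. measure D {u..} = h u / u powr t"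
    using assms(10) unfolding tail .
  have tail_pos: "\<forall>\<^sub>F u in at_top. 0 < measure D {u..}"
    using tail_h h_pos eventually_gt_at_top[of 0] by eventually_elim simp
  have tail_rv: "((\<lambda>u. measure D {r * u..} / measure D {u..}) \<longlongrightarrow> r powr - t) at_top" if r: "r > 0" for r
  proof -
    have "filterlim (\<lambda>u. r * u) at_top at_top"
      using r by (intro filterlim_tendsto_pos_mult_at_top[OF tendsto_const _ filterlim_ident])
    then have "\<forall>\<^sub>F u in at_top. measure D {r * u..} = h (r * u) / (r * u) powr t"
      by (rule eventually_compose_filterlim[OF tail_h])
    then have "\<forall>\<^sub>F u in at_top. r powr - t * (h (r * u) / h u) = measure D {r * u..} / measure D {u..}"
      using tail_h h_pos eventually_gt_at_top[of 0]
    proof eventually_elim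
      case (elim u)
      show ?case unfolding elim(1,2) using elim(3,4) r by (simp add: powr_mult powr_minus divide_simps)
    qed
    moreover have "((\<lambda>u. r powr - t * (h (r * u) / h u)) \<longlongrightarrow> r powr - t * 1) at_top"
      by (intro tendsto_intros h_lim r)
    ultimately show ?thesis by (simp add: tendsto_cong)
  qed
  \<comment> \<open>A degenerate law is excluded by the positive right tail, through Chebyshev's
    inequality at a level u > 0.\<close>
  have var_pos: "0 < (\<integral>u. u\<^sup>2 \<partial>D)"
  proof -
    obtain u where u: "0 < u" "0 < \<P>(\<omega> in M. \<xi> 0 \<omega> \<ge> u)"
      using eventually_happens'[OF _ eventually_conj[OF eventually_gt_at_top[of "0::real"] tail_pos]]
      unfolding tail by auto
    have "\<P>(\<omega> in M. \<xi> 0 \<omega> \<ge> u) \<le> \<P>(\<omega> in M. \<bar>\<xi> 0 \<omega>\<bar> \<ge> u)"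
      by (intro finite_measure_mono) auto
    also have "\<dots> \<le> expectation (\<lambda>\<omega>. (\<xi> 0 \<omega>)\<^sup>2) / u\<^sup>2"
      by (rule second_moment_method[OF rv assms(7) u(1)])
    finally have "0 < expectation (\<lambda>\<omega>. (\<xi> 0 \<omega>)\<^sup>2) / u\<^sup>2" using u by linarith
    then show ?thesis using u by (simp add: ED zero_less_divide_iff)
  qed
  have intp: "integrable D (\<lambda>u. \<bar>u\<bar> powr p')"
  proof -
    have "integrable M (\<lambda>\<omega>. \<bar>\<xi> 0 \<omega>\<bar> powr p')"
    proof (rule Bochner_Integration.integrable_bound)
      show "integrable M (\<lambda>\<omega>. 1 + \<bar>\<xi> 0 \<omega>\<bar> powr p)" using assms(12) by simp
      have "\<bar>u\<bar> powr p' \<le> 1 + \<bar>u\<bar> powr p" for u :: real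
      proof (cases "\<bar>u\<bar> \<le> 1")
        case True
        then have "\<bar>u\<bar> powr p' \<le> 1" using p' by (intro powr_le1) auto
        then show ?thesis by (simp add: add_increasing2)
      next
        case False
        then have "\<bar>u\<bar> powr p' \<le> \<bar>u\<bar> powr p" using p' by (intro powr_mono) auto
        then show ?thesis by simp
      qed
      then show "AE \<omega> in M. norm (\<bar>\<xi> 0 \<omega>\<bar> powr p') \<le> norm (1 + \<bar>\<xi> 0 \<omega>\<bar> powr p)"
        by (intro AE_I2) (simp add: add_nonneg_nonneg)
    qed measurable
    then show ?thesis by (subst intD) auto
  qed
  interpret heavy_tailed_array M \<xi> D p' t
  proof (unfold_locales)
    show "integrable D (\<lambda>u. u)" using assms(5) by (subst intD) auto
    show "(\<integral>u. u \<partial>D) = 0" using assms(6) by (subst ED) auto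
  qed (use indep law p' intp var_pos tail_pos tail_rv \<open>t > 2\<close> in auto)
  \<comment> \<open>The variables are indexed by integers, the weights by naturals;
    \<open>int\<close> and \<open>nat\<close> mediate between them.\<close>
  define I where "I = (\<lambda>n. int ` {1..k n})"
  define b where "b = (\<lambda>n j. c n (nat j) / \<sigma> n)"
  define B where "B = (\<lambda>n. sqrt (MAX i\<in>{1..k n}. (c n i)\<^sup>2 / (\<sigma> n)\<^sup>2))"
  have k: "1 \<le> k n" if "n \<ge> 1" for n by (rule assms(13)[OF that])
  have c: "0 < c n i" if "n \<ge> 1" "1 \<le> i" "i \<le> k n" for n i by (rule assms(14)[OF that])
  have cI: "0 < c n (nat j)" if "n \<ge> 1" "j \<in> I n" for n j
    using that c by (auto simp: I_def)
  have sum_I: "(\<Sum>j\<in>I n. g (nat j) j) = (\<Sum>i = 1..k n. g i (int i))" for n and g :: "nat \<Rightarrow> int \<Rightarrow> real"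
    unfolding I_def by (subst sum.reindex) auto
  have finI: "finite (I n)" for n by (simp add: I_def)
  have S_eq: "S n = wsum (\<lambda>j. c n (nat j)) (I n)" for n
    unfolding S_def weighted_sum_def[abs_def] wsum_def[abs_def]
    by (intro ext sum_I[symmetric, where g = "\<lambda>i j. c n i * \<xi> j _"])
  have \<sigma>2: "(\<sigma> n)\<^sup>2 = var * (\<Sum>i = 1..k n. (c n i)\<^sup>2)" and \<sigma>: "\<sigma> n > 0" if n: "n \<ge> 1" for n
  proof -
    have "variance (S n) = var * (\<Sum>i = 1..k n. (c n i)\<^sup>2)"
      using wsum_second_moment[OF finI cI[OF n]] sum_I[of "\<lambda>i j. (c n i)\<^sup>2" n] unfolding S_eq by simp
    moreover have "0 < var * (\<Sum>i = 1..k n. (c n i)\<^sup>2)"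
      using k[OF n] c[OF n] var_gt_0 by (intro mult_pos_pos sum_pos) (auto simp: less_imp_neq[symmetric])
    ultimately show "(\<sigma> n)\<^sup>2 = var * (\<Sum>i = 1..k n. (c n i)\<^sup>2)" "\<sigma> n > 0"
      unfolding \<sigma>_def std_dev_def by simp_all
  qed
  have arr: "array (I n) (b n) (B n)" and attained: "\<exists>j\<in>I n. b n j = B n" and B_pos: "B n > 0" if n: "n \<ge> 1" for n
  proof -
    let ?m = "\<lambda>i. (c n i)\<^sup>2 / (\<sigma> n)\<^sup>2"
    have ne: "{1..k n} \<noteq> {}" using k[OF n] by simp
    have b_sqrt: "b n (int i) = sqrt (?m i)" if "i \<in> {1..k n}" for i
      using c[OF n, of i] \<sigma>[OF n] that by (simp add: b_def real_sqrt_divide)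
    have bpos: "b n j > 0" if "j \<in> I n" for j using cI[OF n that] \<sigma>[OF n] by (simp add: b_def)
    have "Max (?m ` {1..k n}) \<in> ?m ` {1..k n}" using ne by (intro Max_in) auto
    then obtain i where i: "i \<in> {1..k n}" "Max (?m ` {1..k n}) = ?m i" by auto
    then have "b n (int i) = B n" using b_sqrt[OF i(1)] by (simp add: B_def)
    then show ex: "\<exists>j\<in>I n. b n j = B n" using i(1) by (auto simp: I_def)
    then show "B n > 0" using bpos by metis
    have le: "b n j \<le> B n" if "j \<in> I n" for j
    proof -
      obtain i where i: "i \<in> {1..k n}" "j = int i" using \<open>j \<in> I n\<close> by (auto simp: I_def)
      then show ?thesis unfolding i(2) b_sqrt[OF i(1)] B_def by (intro real_sqrt_le_mono Max_ge) auto
    qed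
    have "(\<Sum>j\<in>I n. (b n j)\<^sup>2) = (\<Sum>i = 1..k n. (c n i)\<^sup>2) / (\<sigma> n)\<^sup>2"
      using sum_I[of "\<lambda>i j. (c n i / \<sigma> n)\<^sup>2" n] by (simp add: b_def power_divide sum_divide_distrib)
    then have "var * (\<Sum>j\<in>I n. (b n j)\<^sup>2) = (\<sigma> n)\<^sup>2 / (\<sigma> n)\<^sup>2"
      by (simp only: \<sigma>2[OF n] times_divide_eq_right)
    then have "var * (\<Sum>j\<in>I n. (b n j)\<^sup>2) = 1" using \<sigma>[OF n] by simp
    then show "array (I n) (b n) (B n)" unfolding array_def using finI bpos le by simp
  qed
  define A where "A = (\<lambda>n. \<Sum>i = 1..k n. \<P>(\<omega> in M. c n i * \<xi> 0 \<omega> \<ge> x n * \<sigma> n))"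
  define P where "P = (\<lambda>n. \<P>(\<omega> in M. S n \<omega> \<ge> x n * \<sigma> n))"
  have P_eq: "P n = \<P>(\<omega> in M. wsum (b n) (I n) \<omega> \<ge> x n)" if n: "n \<ge> 1" for n
  proof -
    have "wsum (b n) (I n) \<omega> = S n \<omega> / \<sigma> n" for \<omega>
      unfolding S_eq wsum_def b_def by (simp add: sum_divide_distrib)
    then have "x n \<le> wsum (b n) (I n) \<omega> \<longleftrightarrow> x n * \<sigma> n \<le> S n \<omega>" for \<omega>
      using \<sigma>[OF n] by (simp add: pos_le_divide_eq)
    then show ?thesis unfolding P_def by simp
  qed
  have A_eq: "A n = tails (b n) (I n) (x n)" if n: "n \<ge> 1" for n
  proof -
    have "tails (b n) (I n) (x n) = (\<Sum>j\<in>I n. \<P>(\<omega> in M. c n (nat j) * \<xi> 0 \<omega> \<ge> x n * \<sigma> n))"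
      unfolding tails_def
    proof (rule sum.cong[OF refl])
      fix j assume j: "j \<in> I n"
      have "b n j > 0" using cI[OF n j] \<sigma>[OF n] by (simp add: b_def)
      then have "\<P>(\<omega> in M. b n j * \<xi> j \<omega> \<ge> x n) = measure D {x n / b n j..}" by (rule prob_scaled_eq_F)
      also have "x n / b n j = x n * \<sigma> n / c n (nat j)" by (simp add: b_def)
      also have "measure D {x n * \<sigma> n / c n (nat j)..} = \<P>(\<omega> in M. c n (nat j) * \<xi> 0 \<omega> \<ge> x n * \<sigma> n)"
        by (rule prob_scaled_eq_F[OF cI[OF n j], symmetric])
      finally show "\<P>(\<omega> in M. b n j * \<xi> j \<omega> \<ge> x n) = \<P>(\<omega> in M. c n (nat j) * \<xi> 0 \<omega> \<ge> x n * \<sigma> n)" .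
    qed
    then show ?thesis unfolding A_def using sum_I[of "\<lambda>i j. \<P>(\<omega> in M. c n i * \<xi> 0 \<omega> \<ge> x n * \<sigma> n)" n] by simp
  qed
  have pos: "0 < A n + normal_tail (x n)" for n
    using normal_tail_pos[of "x n"] unfolding A_def by (intro add_nonneg_pos sum_nonneg) auto
  have "B \<longlonglongrightarrow> sqrt 0"
    unfolding B_def by (intro tendsto_real_sqrt assms(15))
  moreover have "\<forall>\<^sub>F n in sequentially. B n > 0"
    using eventually_ge_at_top[of 1] by eventually_elim (rule B_pos)
  \<comment> \<open>Strict positivity of \<open>B n\<close> is what upgrades convergence to 0 to
    convergence from the right.\<close>
  ultimately have B_lim: "filterlim B (at_right 0) sequentially"
    by (simp add: tendsto_imp_filterlim_at_right)
  \<comment> \<open>The same relative error serves as \<epsilon> and \<delta>; the denominator is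
    positive for every n because the normal tail is.\<close>
  define r where "r = (\<lambda>n. P n / (A n + normal_tail (x n)) - 1)"
  have r_lim: "r \<longlonglongrightarrow> 0"
  proof (rule tendstoI)
    fix \<epsilon> :: real assume "\<epsilon> > 0"
    then have "\<epsilon> / 2 > 0" by simp
    from eventually_compose_filterlim[OF wsum_tail_asymp[OF \<open>a > 0\<close> this] B_lim]
    have "\<forall>\<^sub>F n in sequentially. \<forall>I b x. array I b (B n) \<longrightarrow> (\<exists>i\<in>I. b i = B n) \<longrightarrow> a \<le> x \<longrightarrow>
       \<bar>wsum_tail b I x - (tails b I x + normal_tail x)\<bar> \<le> \<epsilon> / 2 * (tails b I x + normal_tail x)" .
    then show "\<forall>\<^sub>F n in sequentially. dist (r n) 0 < \<epsilon>"
      using eventually_ge_at_top[of 1]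
    proof eventually_elim
      case (elim n)
      note n = elim(2)
      have "\<bar>P n - (A n + normal_tail (x n))\<bar> \<le> \<epsilon> / 2 * (A n + normal_tail (x n))"
        unfolding P_eq[OF n] A_eq[OF n] using elim(1) arr[OF n] attained[OF n] assms(17)[OF n] by blast
      moreover have "r n = (P n - (A n + normal_tail (x n))) / (A n + normal_tail (x n))"
        unfolding r_def using pos[of n] by (simp add: diff_divide_distrib)
      ultimately have "\<bar>r n\<bar> \<le> \<epsilon> / 2" using pos[of n] by (simp add: abs_divide divide_le_eq)
      then show ?case using \<open>\<epsilon> > 0\<close> by simp
    qed
  qed
  have "P n = (1 + r n) * A n + normal_tail (x n) * (1 + r n)" for n
  proof -
    have "(1 + r n) * (A n + normal_tail (x n)) = P n"
      unfolding r_def using pos[of n] by simp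
    then show ?thesis by (simp add: distrib_left mult.commute)
  qed
  with r_lim show ?thesis unfolding P_def A_def by blast
qed

end
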